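(* Let $G=(V,\mathsf{E})$ be a locally finite, connected, infinite graph (parallel edges allowed) such that $\mathsf{WSF}$-almost surely every component of the wired uniform spanning forest of $G$ has one end. Then for every anchor $\mathcal{D}$ the map $\psi_{\mathcal{D}}:\mathcal{T}\to\mathcal{R}$ arising from the anchored burning rule of $\mathcal{D}$ is continuous, injective, and measure preserving from $(\mathcal{T},\mathsf{WSF})$ to $(\mathcal{R},\nu)$, i.e. the image of $\mathsf{WSF}$ under $\psi_{\mathcal{D}}$ equals $\nu$.
   Context: **Sandpiles and trees on finite graphs.** For a finite multigraph $H=(W\cup\{s\},\mathsf{E}_H)$ with distinguished vertex $s\notin W$ (the sink), $\mathcal{T}_H$ is the set of spanning trees of $H$, and $\mathcal{R}_H$ (recurrent sandpiles) is the set of $\eta\in\prod_{x\in W}\{0,\dots,\deg_H(x)-1\}$ that are ample for every $\emptyset\ne F\subset W$. Here $\eta$ is ample for $F$ if there is $x\in F$ with $\eta(x)\ge \deg_F(x)$, and $\deg_F(x)$ denotes the number of edges joining $x$ to vertices of $F$. $\nu_H$ is the uniform distribution on $\mathcal{R}_H$, $\mathsf{UST}_H$ the uniform distribution on $\mathcal{T}_H$. **Infinite graph.** For finite $\Lambda\subset V$ the wired graph $G_\Lambda=(\Lambda\cup\{s\},\mathsf{E}_\Lambda)$ is obtained from $G$ by identifying all vertices of $V\setminus\Lambda$ to the single vertex $s$ and removing loops at $s$; its edges are identified with the edges of $G$ having an endpoint in $\Lambda$. $\mathsf{WSF}$ is the weak limit of $\mathsf{UST}_{G_\Lambda}$ as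 $\Lambda\uparrow V$. An infinite tree has one end if any two infinite self-avoiding paths in it have finite symmetric difference. $\mathcal{T}$ is the set of spanning subgraphs of $G$ all of whose components are infinite one-ended trees (a subset of $\{0,1\}^{\mathsf{E}}$ with the product topology). $\mathcal{R}$ is the set of $\eta\in\prod_{x\in V}\{0,\dots,\deg_G(x)-1\}$ (product topology) that are ample for every finite $\emptyset\ne F\subset V$. $\nu$ is the weak limit of $\nu_{G_\Lambda}$ as $\Lambda\uparrow V$; it is known that under the one-end assumption this limit exists and does not depend on the exhaustion. **Anchor.** A set $D\subset V$ is simply connected if all connected components of $V\setminus D$ are infinite. An anchor is a sequence $\mathcal{D}=\{D_1,D_2,\dots\}$ of finite simply connected subsets of $V$ with $D_1\subset D_2\subset\cdots$ and $\bigcup_k D_k=V$. Put $D_0=\emptyset$. For each $v\in V$ fix a linear ordering $\prec_v$ of the oriented edges of $G$ with tail $v$. **Anchored burning rule on a finite graph.** Let $H=(W\cup\{s\},\mathsf{E}_H)$ be a finite graph whose edges are identified with a subset of $\mathsf{E}$, and let $m\ge0$ with $D_m\subset W$. Given $\eta\in\mathcal{R}_H$, burn in phases $i=1,\dots,m+1$. Set $B^{(1)}_0=\{s\}$, $U^{(1)}_0=W$, and for $i\ge2$ set $B^{(i)}_0=\bigcup_{j\ge0}B^{(i-1)}_j$, $U^{(i)}_0=W\setminus B^{(i)}_0$ (so $B^{(i)}_0$ is the set of everything burnt by the end of phase $i-1$). For $j\ge1$, $$B^{(i)}_j=\{v\in U^{(i)}_{j-1}\setminus D_{m-i+1}:\eta(v)\ge\deg_{U^{(i)}_{j-1}}(v)\},\qquad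 U^{(i)}_j=U^{(i)}_{j-1}\setminus B^{(i)}_j .$$ Every $v\in W$ belongs to exactly one $B^{(i)}_j$ with $1\le i\le m+1$, $j\ge1$; for this $(i,j)$ let $m_v$ be the number of oriented edges from $v$ into $\bigcup_{j'<j}B^{(i)}_{j'}$ and $F_v$ the set of oriented edges from $v$ into $B^{(i)}_{j-1}$. Then $\eta(v)=\deg_H(v)-m_v+\ell$ for some $0\le\ell<|F_v|$; let $e_v\in F_v$ be the edge with $|\{f\in F_v:f\prec_v e_v\}|=\ell$. The map $\varphi_{H,m}:\mathcal{R}_H\to\mathcal{T}_H$, $\eta\mapsto\{e_v:v\in W\}$ (orientations forgotten), is a bijection. **The map $\psi_{\mathcal D}$.** For $k\ge1$ and finite simply connected $W$ with $D_k\subset W\subset V$, let $G^*_{W,k}=(W\cup\{s\},\mathsf{E}^*_{W,k})$ be the graph containing all edges of $G$ with both endpoints in $W$ and, for each edge of $G$ joining $u\in D_k$ to a vertex of $V\setminus W$, an edge between $u$ and $s$; $\mathsf{E}^*_{W,k}$ is identified with a subset of $\mathsf{E}$. Let $\psi_{W,k}=\varphi_{G^*_{W,k},\,k-1}^{-1}:\mathcal{T}_{G^*_{W,k}}\to\mathcal{R}_{G^*_{W,k}}$. For $t\in\mathcal{T}$ and finite $D\subset V$, $\mathrm{desc}_t(D)$ is the set of vertices $v$ such that the unique infinite self-avoiding path in $t$ starting at $v$ has a vertex in $D$. Put $W_k=\mathrm{desc}_t(D_k)$, which is finite, and let $t_{W_k,k}$ be the restriction of $t$ to $\mathsf{E}^*_{W_k,k}$.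 The configurations $\psi_{W_k,k}(t_{W_k,k})$ on $W_k$, $k\ge1$, are consistent, and $\psi_{\mathcal{D}}(t)$ is the configuration on $V$ whose restriction to each $W_k$ is $\psi_{W_k,k}(t_{W_k,k})$; it lies in $\mathcal{R}$. *)

theory Defs
  imports "HOL-Probability.Probability"
begin

section \<open>Multigraphs\<close>

text \<open>
  Edges carry their own identity, so parallel edges are allowed; \<open>ends\<close> gives the
  two-element set of endpoints, so there are no loops.  Consequently an oriented edge
  with tail \<open>v\<close> is the same thing as an edge incident to \<open>v\<close>, and this is how
  oriented edges are represented throughout.
\<close>

record ('v, 'e) mgraph =
  verts :: "'v set"
  edges :: "'e set"
  ends :: "'e \<Rightarrow> 'v set"

definition multigraph :: "('v, 'e) mgraph \<Rightarrow> bool" where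
  "multigraph H \<longleftrightarrow> (\<forall>e\<in>edges H. ends H e \<subseteq> verts H \<and> card (ends H e) = 2)"

definition incident :: "('v, 'e) mgraph \<Rightarrow> 'v \<Rightarrow> 'e set" where
  "incident H v = {e \<in> edges H. v \<in> ends H e}"

definition degree :: "('v, 'e) mgraph \<Rightarrow> 'v \<Rightarrow> nat" where
  "degree H v = card (incident H v)"

definition locally_finite :: "('v, 'e) mgraph \<Rightarrow> bool" where
  "locally_finite H \<longleftrightarrow> (\<forall>v\<in>verts H. finite (incident H v))"

definition edges_into :: "('v, 'e) mgraph \<Rightarrow> 'v \<Rightarrow> 'v set \<Rightarrow> 'e set" where
  "edges_into H v X = {e \<in> edges H. \<exists>y\<in>X. ends H e = {v, y}}"

definition degree_in :: "('v, 'e) mgraph \<Rightarrow> 'v set \<Rightarrow> 'v \<Rightarrow> nat" where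
  "degree_in H F x = card (edges_into H x F)"

text \<open>A subgraph with the same vertex set is given by its set \<open>t\<close> of edges.\<close>

definition adj_rel :: "('v, 'e) mgraph \<Rightarrow> 'e set \<Rightarrow> 'v rel" where
  "adj_rel H t = {(x, y). \<exists>e\<in>t. ends H e = {x, y}}"

definition comp_of :: "('v, 'e) mgraph \<Rightarrow> 'e set \<Rightarrow> 'v \<Rightarrow> 'v set" where
  "comp_of H t v = {w. (v, w) \<in> (adj_rel H t)\<^sup>*}"

definition connected_by :: "('v, 'e) mgraph \<Rightarrow> 'e set \<Rightarrow> bool" where
  "connected_by H t \<longleftrightarrow> (\<forall>x\<in>verts H. \<forall>y\<in>verts H. (x, y) \<in> (adj_rel H t)\<^sup>*)"

definition connected_graph :: "('v, 'e) mgraph \<Rightarrow> bool" where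
  "connected_graph H \<longleftrightarrow> connected_by H (edges H)"

text \<open>Distinctness of the edges matters for cycles of length 2.\<close>

definition is_cycle :: "('v, 'e) mgraph \<Rightarrow> 'v list \<Rightarrow> 'e list \<Rightarrow> bool" where
  "is_cycle H vs es \<longleftrightarrow> vs \<noteq> [] \<and> length es = length vs \<and> distinct vs \<and> distinct es \<and>
     (\<forall>i<length vs. ends H (es ! i) = {vs ! i, vs ! (Suc i mod length vs)})"

definition acyclic_edges :: "('v, 'e) mgraph \<Rightarrow> 'e set \<Rightarrow> bool" where
  "acyclic_edges H t \<longleftrightarrow> \<not> (\<exists>vs es. is_cycle H vs es \<and> set es \<subseteq> t)"

definition spanning_trees :: "('v, 'e) mgraph \<Rightarrow> 'e set set" where
  "spanning_trees H = {t. t \<subseteq> edges H \<and> connected_by H t \<and> acyclic_edges H t}"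

definition is_ray :: "('v, 'e) mgraph \<Rightarrow> 'e set \<Rightarrow> (nat \<Rightarrow> 'v) \<Rightarrow> bool" where
  "is_ray H t p \<longleftrightarrow> range p \<subseteq> verts H \<and> inj p \<and> (\<forall>n. (p n, p (Suc n)) \<in> adj_rel H t)"

definition one_ended :: "('v, 'e) mgraph \<Rightarrow> 'e set \<Rightarrow> 'v set \<Rightarrow> bool" where
  "one_ended H t C \<longleftrightarrow> (\<forall>p q. is_ray H t p \<and> range p \<subseteq> C \<and> is_ray H t q \<and> range q \<subseteq> C \<longrightarrow>
     finite ((range p - range q) \<union> (range q - range p)))"

definition one_end_forests :: "('v, 'e) mgraph \<Rightarrow> 'e set set" where
  "one_end_forests G = {t. t \<subseteq> edges G \<and> acyclic_edges G t \<and>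
     (\<forall>v\<in>verts G. infinite (comp_of G t v) \<and> one_ended G t (comp_of G t v))}"


section \<open>Graphs with a sink\<close>

text \<open>
  In a graph of type \<open>('v option, 'e) mgraph\<close> the sink is \<open>None\<close>.
  \<open>sink_graph G W F\<close> keeps the edges \<open>F\<close> of \<open>G\<close> and sends all
  vertices outside \<open>W\<close> to the sink.
\<close>

definition nonsink :: "('v option, 'e) mgraph \<Rightarrow> 'v set" where
  "nonsink H = {v. Some v \<in> verts H}"

definition sink_graph :: "('v, 'e) mgraph \<Rightarrow> 'v set \<Rightarrow> 'e set \<Rightarrow> ('v option, 'e) mgraph" where
  "sink_graph G W F = \<lparr>verts = insert None (Some ` W), edges = F,
     ends = (\<lambda>e. (\<lambda>v. if v \<in> W then Some v else None) ` ends G e)\<rparr>"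

definition wired_graph :: "('v, 'e) mgraph \<Rightarrow> 'v set \<Rightarrow> ('v option, 'e) mgraph" where
  "wired_graph G \<Lambda> = sink_graph G \<Lambda> {e \<in> edges G. ends G e \<inter> \<Lambda> \<noteq> {}}"

definition anchored_edges :: "('v, 'e) mgraph \<Rightarrow> 'v set \<Rightarrow> 'v set \<Rightarrow> 'e set" where
  "anchored_edges G W D = {e \<in> edges G. ends G e \<subseteq> W} \<union>
     {e \<in> edges G. \<exists>u\<in>D. \<exists>w\<in>verts G - W. ends G e = {u, w}}"

definition anchored_graph :: "('v, 'e) mgraph \<Rightarrow> 'v set \<Rightarrow> 'v set \<Rightarrow> ('v option, 'e) mgraph" where
  "anchored_graph G W D = sink_graph G W (anchored_edges G W D)"


section \<open>Recurrent sandpiles\<close>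

definition ample :: "('v, 'e) mgraph \<Rightarrow> ('v \<Rightarrow> nat) \<Rightarrow> 'v set \<Rightarrow> bool" where
  "ample H \<eta> F \<longleftrightarrow> (\<exists>x\<in>F. \<eta> x \<ge> degree_in H F x)"

definition recurrent :: "('v option, 'e) mgraph \<Rightarrow> ('v \<Rightarrow> nat) set" where
  "recurrent H = {\<eta> \<in> (\<Pi>\<^sub>E x\<in>nonsink H. {..<degree H (Some x)}).
     \<forall>F. F \<noteq> {} \<and> F \<subseteq> nonsink H \<longrightarrow> ample H (\<lambda>x. \<eta> (the x)) (Some ` F)}"

definition recurrent_inf :: "('v, 'e) mgraph \<Rightarrow> ('v \<Rightarrow> nat) set" where
  "recurrent_inf G = {\<eta> \<in> (\<Pi>\<^sub>E x\<in>verts G. {..<degree G x}).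
     \<forall>F. finite F \<and> F \<noteq> {} \<and> F \<subseteq> verts G \<longrightarrow> ample G \<eta> F}"


section \<open>Topologies, weak limits and the limit measures\<close>

definition edge_topology :: "('v, 'e) mgraph \<Rightarrow> 'e set topology" where
  \<comment> \<open>\<open>{0,1}\<close> to the power of the edge set, with configurations seen as sets of edges\<close>
  "edge_topology G = pullback_topology (Pow (edges G)) (\<lambda>t. \<lambda>e\<in>edges G. e \<in> t)
     (product_topology (\<lambda>_. discrete_topology (UNIV :: bool set)) (edges G))"

definition sandpile_topology :: "('v, 'e) mgraph \<Rightarrow> ('v \<Rightarrow> nat) topology" where
  "sandpile_topology G = product_topology (\<lambda>x. discrete_topology {..<degree G x}) (verts G)"

definition borel_of :: "'a topology \<Rightarrow> 'a measure" where
  "borel_of X = sigma (topspace X) {U. openin X U}"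

definition weak_limit :: "'a topology \<Rightarrow> ('i \<Rightarrow> 'a measure) \<Rightarrow> 'i filter \<Rightarrow> 'a measure \<Rightarrow> bool" where
  "weak_limit X M \<F> N \<longleftrightarrow> prob_space N \<and> sets N = sets (borel_of X) \<and>
     (\<forall>f :: 'a \<Rightarrow> real. continuous_map X euclideanreal f \<and> bounded (f ` topspace X) \<longrightarrow>
        ((\<lambda>i. integral\<^sup>L (M i) f) \<longlongrightarrow> integral\<^sup>L N f) \<F>)"

definition UST :: "('v, 'e) mgraph \<Rightarrow> 'e set measure" where
  "UST H = uniform_count_measure (spanning_trees H)"

definition sandpile_finite :: "('v option, 'e) mgraph \<Rightarrow> ('v \<Rightarrow> nat) measure" where
  "sandpile_finite H = uniform_count_measure (recurrent H)"

definition is_WSF :: "('v, 'e) mgraph \<Rightarrow> 'e set measure \<Rightarrow> bool" where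
  "is_WSF G M \<longleftrightarrow> weak_limit (edge_topology G)
     (\<lambda>\<Lambda>. distr (UST (wired_graph G \<Lambda>)) (borel_of (edge_topology G)) (\<lambda>t. t))
     (finite_subsets_at_top (verts G)) M"

text \<open>Configurations on \<open>\<Lambda>\<close> are extended by \<open>0\<close>; this does not affect the limit.\<close>

definition extend_conf :: "('v, 'e) mgraph \<Rightarrow> 'v set \<Rightarrow> ('v \<Rightarrow> nat) \<Rightarrow> 'v \<Rightarrow> nat" where
  "extend_conf G \<Lambda> \<eta> = (\<lambda>x\<in>verts G. if x \<in> \<Lambda> then \<eta> x else 0)"

definition sandpile_measure :: "('v, 'e) mgraph \<Rightarrow> ('v \<Rightarrow> nat) measure" where
  "sandpile_measure G = (THE M. weak_limit (sandpile_topology G)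
     (\<lambda>\<Lambda>. distr (sandpile_finite (wired_graph G \<Lambda>)) (borel_of (sandpile_topology G)) (extend_conf G \<Lambda>))
     (finite_subsets_at_top (verts G)) M)"


section \<open>Anchors and the anchored burning rule\<close>

definition simply_connected_in :: "('v, 'e) mgraph \<Rightarrow> 'v set \<Rightarrow> bool" where
  "simply_connected_in G D \<longleftrightarrow> D \<subseteq> verts G \<and>
     (\<forall>v\<in>verts G - D. infinite (comp_of G {e \<in> edges G. ends G e \<subseteq> verts G - D} v))"

definition anchor :: "('v, 'e) mgraph \<Rightarrow> (nat \<Rightarrow> 'v set) \<Rightarrow> bool" where
  "anchor G D \<longleftrightarrow> D 0 = {} \<and>
     (\<forall>k\<ge>1. finite (D k) \<and> simply_connected_in G (D k) \<and> D k \<subseteq> D (Suc k)) \<and>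
     (\<Union>k\<in>{1..}. D k) = verts G"

text \<open>
  One phase: \<open>A\<close> is the set of vertices that are not allowed to burn in it and
  \<open>B\<^sub>0\<close> is what has burnt before.
\<close>

definition burnable :: "('v option, 'e) mgraph \<Rightarrow> ('v \<Rightarrow> nat) \<Rightarrow> 'v set \<Rightarrow> 'v set \<Rightarrow> 'v set" where
  "burnable H \<eta> A U = {v \<in> U - A. \<eta> v \<ge> degree_in H (Some ` U) (Some v)}"

primrec unburnt ::
  "('v option, 'e) mgraph \<Rightarrow> ('v \<Rightarrow> nat) \<Rightarrow> 'v set \<Rightarrow> 'v option set \<Rightarrow> nat \<Rightarrow> 'v set" where
  "unburnt H \<eta> A B\<^sub>0 0 = {v \<in> nonsink H. Some v \<notin> B\<^sub>0}"
| "unburnt H \<eta> A B\<^sub>0 (Suc j) = unburnt H \<eta> A B\<^sub>0 j - burnable H \<eta> A (unburnt H \<eta> A B\<^sub>0 j)"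

primrec layer ::
  "('v option, 'e) mgraph \<Rightarrow> ('v \<Rightarrow> nat) \<Rightarrow> 'v set \<Rightarrow> 'v option set \<Rightarrow> nat \<Rightarrow> 'v option set" where
  "layer H \<eta> A B\<^sub>0 0 = B\<^sub>0"
| "layer H \<eta> A B\<^sub>0 (Suc j) = Some ` burnable H \<eta> A (unburnt H \<eta> A B\<^sub>0 j)"

text \<open>\<open>burnt_after H \<eta> D m n\<close> is everything burnt by the end of phase \<open>n\<close>.\<close>

primrec burnt_after ::
  "('v option, 'e) mgraph \<Rightarrow> ('v \<Rightarrow> nat) \<Rightarrow> (nat \<Rightarrow> 'v set) \<Rightarrow> nat \<Rightarrow> nat \<Rightarrow> 'v option set" where
  "burnt_after H \<eta> D m 0 = {None}"
| "burnt_after H \<eta> D m (Suc n) = (\<Union>j. layer H \<eta> (D (m - n)) (burnt_after H \<eta> D m n) j)"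

definition burn_layer ::
  "('v option, 'e) mgraph \<Rightarrow> ('v \<Rightarrow> nat) \<Rightarrow> (nat \<Rightarrow> 'v set) \<Rightarrow> nat \<Rightarrow> nat \<Rightarrow> nat \<Rightarrow> 'v option set" where
  \<comment> \<open>layer \<open>j\<close> of phase \<open>i\<close>, where \<open>1 \<le> i \<le> m + 1\<close>\<close>
  "burn_layer H \<eta> D m i j = layer H \<eta> (D (m + 1 - i)) (burnt_after H \<eta> D m (i - 1)) j"

definition burn_edge ::
  "('v \<Rightarrow> 'e rel) \<Rightarrow> ('v option, 'e) mgraph \<Rightarrow> (nat \<Rightarrow> 'v set) \<Rightarrow> nat \<Rightarrow> ('v \<Rightarrow> nat) \<Rightarrow> 'v \<Rightarrow> 'e" where
  "burn_edge prec H D m \<eta> v = (THE e. \<exists>i\<in>{1..m + 1}. \<exists>j\<ge>1. Some v \<in> burn_layer H \<eta> D m i j \<and>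
     (let mv = card (edges_into H (Some v) (\<Union>j'<j. burn_layer H \<eta> D m i j'));
          Fv = edges_into H (Some v) (burn_layer H \<eta> D m i (j - 1))
      in e \<in> Fv \<and> \<eta> v + mv = degree H (Some v) + card {f \<in> Fv. (f, e) \<in> prec v}))"

definition burn_tree ::
  "('v \<Rightarrow> 'e rel) \<Rightarrow> ('v option, 'e) mgraph \<Rightarrow> (nat \<Rightarrow> 'v set) \<Rightarrow> nat \<Rightarrow> ('v \<Rightarrow> nat) \<Rightarrow> 'e set" where
  "burn_tree prec H D m \<eta> = burn_edge prec H D m \<eta> ` nonsink H"


section \<open>The map from forests to sandpiles\<close>

definition anchored_psi ::
  "('v \<Rightarrow> 'e rel) \<Rightarrow> ('v, 'e) mgraph \<Rightarrow> (nat \<Rightarrow> 'v set) \<Rightarrow> 'v set \<Rightarrow> nat \<Rightarrow> 'e set \<Rightarrow> 'v \<Rightarrow> nat" where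
  "anchored_psi prec G D W k = (let H = anchored_graph G W (D k)
     in the_inv_into (recurrent H) (burn_tree prec H D (k - 1)))"

definition ray_from :: "('v, 'e) mgraph \<Rightarrow> 'e set \<Rightarrow> 'v \<Rightarrow> nat \<Rightarrow> 'v" where
  "ray_from G t v = (THE p. is_ray G t p \<and> p 0 = v)"

definition desc :: "('v, 'e) mgraph \<Rightarrow> 'e set \<Rightarrow> 'v set \<Rightarrow> 'v set" where
  "desc G t D = {v \<in> verts G. range (ray_from G t v) \<inter> D \<noteq> {}}"

definition psi ::
  "('v \<Rightarrow> 'e rel) \<Rightarrow> ('v, 'e) mgraph \<Rightarrow> (nat \<Rightarrow> 'v set) \<Rightarrow> 'e set \<Rightarrow> 'v \<Rightarrow> nat" where
  "psi prec G D t = (THE \<eta>. \<eta> \<in> extensional (verts G) \<and>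
     (\<forall>k\<ge>1. let W = desc G t (D k)
       in restrict \<eta> W = anchored_psi prec G D W k (t \<inter> anchored_edges G W (D k))))"

end

theory Submission
  imports Defs
begin

text \<open>
  Directing the trees of a one-ended forest \<open>t\<close> towards infinity, every vertex has one outgoing edge and
  finitely many descendants.  The anchored burning rule is then inverted by an explicit formula.  Let
  \<open>r v\<close> be the least \<open>k\<close> such that the path from \<open>v\<close> meets \<open>D k\<close>, and \<open>j v\<close> the number of steps along that
  path until \<open>r\<close> increases.  A vertex burns earlier than another if its \<open>r\<close> is larger, or if \<open>r\<close> agrees
  and its \<open>j\<close> is smaller; this is the order in which every finite anchored graph burns, the phase being
  determined by \<open>r\<close> and the layer by \<open>j\<close>.  The number of grains at \<open>v\<close> is the number of edges to vertices
  that do not burn earlier, plus the rank of the outgoing edge among the edges to the preceding layer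
  (\<open>label_height\<close>).  On finite graphs this formula is shown to be the inverse of the burning map, in
  one direction by following the burning of \<open>label_height\<close> (\<open>burn_tree_labels\<close>), in the other by
  reading labels off the burning of an arbitrary recurrent sandpile (\<open>exists_labelling\<close>) and noting
  that a tree has only one labelling (\<open>labelled_trees_unique\<close>).  So \<open>burn_tree\<close> is a bijection from
  recurrent sandpiles to spanning trees (\<open>burn_tree_bij\<close>).

  The formula is local: the sandpile on \<open>D k\<close> depends only on the edges of the forest at the finite set
  \<open>desc G t (D k)\<close>, and this remains true if the forest is replaced by a spanning tree of a large wired
  graph with the same edges there (\<open>labelled_trees_agree_height\<close>, with the consequences \<open>psi_local\<close> and
  \<open>burn_tree_inverse_local\<close>).  Continuity is immediate.  For injectivity, \<open>desc G t (D k)\<close> is recovered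
  from the sandpile as the largest finite set in which no vertex outside \<open>D k\<close> can burn after everything
  else has burnt; on it the finite bijection returns the edges (\<open>psi_inj\<close>).

  For the measures, almost every sample of the wired spanning forest is a one-ended forest with infinite
  components.  Finitely many cylinders, each fixing the edges at some \<open>desc G t (D k)\<close>, carry almost all of
  the mass; on them the sandpile of a spanning tree of a large wired graph equals that of the forest on a
  given finite set.  As the burning bijection turns the uniform spanning tree into the uniform recurrent
  sandpile, the sandpile measures of the wired graphs converge weakly to the image of the wired spanning
  forest (\<open>sandpile_weak_limit\<close>).  This proves that the limit in the definition of \<open>sandpile_measure\<close>
  exists and identifies it.
\<close>

section \<open>Adjacency, components and bridges\<close>

lemma multigraphD:
  assumes "multigraph G" "e \<in> edges G"
  shows "ends G e \<subseteq> verts G" "card (ends G e) = 2"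
  using assms by (auto simp: multigraph_def)

lemma other_end_exists:
  assumes "multigraph G" "e \<in> edges G" "v \<in> ends G e"
  obtains w where "ends G e = {v, w}" "w \<noteq> v" "w \<in> verts G" "v \<in> verts G"
proof -
  from multigraphD[OF assms(1,2)] obtain a b where ab: "ends G e = {a, b}" "a \<noteq> b" "{a, b} \<subseteq> verts G"
    by (auto simp: card_2_iff)
  with assms(3) that show ?thesis
    by (cases "v = a") (auto simp: insert_commute)
qed

lemma adj_rel_sym: "(x, y) \<in> adj_rel H t \<Longrightarrow> (y, x) \<in> adj_rel H t"
  by (auto simp: adj_rel_def insert_commute)

lemma adj_rel_mono: "s \<subseteq> t \<Longrightarrow> adj_rel H s \<subseteq> adj_rel H t"
  by (auto simp: adj_rel_def)

lemma adj_relI: "e \<in> t \<Longrightarrow> ends H e = {x, y} \<Longrightarrow> (x, y) \<in> adj_rel H t"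
  by (auto simp: adj_rel_def)

lemma comp_of_refl [simp]: "v \<in> comp_of H t v"
  by (simp add: comp_of_def)

lemma comp_of_sym: "w \<in> comp_of H t v \<Longrightarrow> v \<in> comp_of H t w"
  unfolding comp_of_def mem_Collect_eq
  by (erule symD[OF sym_rtrancl, rotated]) (auto simp: sym_def intro: adj_rel_sym)

lemma comp_of_trans: "w \<in> comp_of H t v \<Longrightarrow> u \<in> comp_of H t w \<Longrightarrow> u \<in> comp_of H t v"
  by (auto simp: comp_of_def)

lemma comp_of_eq: "w \<in> comp_of H t v \<Longrightarrow> comp_of H t w = comp_of H t v"
  using comp_of_sym comp_of_trans by (metis subsetI subset_antisym)

lemma comp_of_mono: "s \<subseteq> t \<Longrightarrow> comp_of H s v \<subseteq> comp_of H t v"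
  unfolding comp_of_def using rtrancl_mono[OF adj_rel_mono] by blast

lemma comp_of_step: "w \<in> comp_of H t v \<Longrightarrow> (w, u) \<in> adj_rel H t \<Longrightarrow> u \<in> comp_of H t v"
  by (auto simp: comp_of_def)

lemma comp_of_subset:
  assumes "v \<in> X" "\<And>x y. x \<in> X \<Longrightarrow> (x, y) \<in> adj_rel H t \<Longrightarrow> y \<in> X"
  shows "comp_of H t v \<subseteq> X"
proof
  fix w assume "w \<in> comp_of H t v"
  then have "(v, w) \<in> (adj_rel H t)\<^sup>*" by (simp add: comp_of_def)
  then show "w \<in> X" by induction (use assms in auto)
qed

lemma comp_of_verts:
  assumes "multigraph G" "t \<subseteq> edges G" "v \<in> verts G"
  shows "comp_of G t v \<subseteq> verts G"
  by (rule comp_of_subset[OF assms(3)]) (use assms multigraphD in \<open>fastforce simp: adj_rel_def\<close>)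

text \<open>A walk is cut back to the first visit of its new end vertex whenever it closes a loop.\<close>

lemma simple_path_of_rtrancl:
  assumes "(x, y) \<in> (adj_rel H s)\<^sup>*"
  obtains vs es where "length vs = Suc (length es)" "hd vs = x" "last vs = y" "distinct vs"
    "set es \<subseteq> s" "\<And>i. i < length es \<Longrightarrow> ends H (es ! i) = {vs ! i, vs ! Suc i}"
  using assms
proof (induction arbitrary: thesis rule: rtrancl_induct)
  case base
  show ?case by (rule base[of "[x]" "[]"]) auto
next
  case (step y z)
  obtain vs es where p: "length vs = Suc (length es)" "hd vs = x" "last vs = y" "distinct vs"
    "set es \<subseteq> s" "\<And>i. i < length es \<Longrightarrow> ends H (es ! i) = {vs ! i, vs ! Suc i}"
    using step.IH by blast
  from step.hyps obtain e where e: "e \<in> s" "ends H e = {y, z}" by (auto simp: adj_rel_def)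
  show ?case
  proof (cases "z \<in> set vs")
    case True
    then obtain n where n: "n < length vs" "vs ! n = z" by (auto simp: in_set_conv_nth)
    show ?thesis
    proof (rule step.prems[of "take (Suc n) vs" "take n es"])
      show "last (take (Suc n) vs) = z" using n by (simp add: take_Suc_conv_app_nth)
      show "hd (take (Suc n) vs) = x" using p(2) by (simp add: take_hd_drop)
      show "set (take n es) \<subseteq> s" using p(5) set_take_subset[of n es] by blast
    qed (use n p in auto)
  next
    case False
    have vs: "vs \<noteq> []" using p(1) by auto
    show ?thesis
    proof (rule step.prems[of "vs @ [z]" "es @ [e]"])
      fix i assume i: "i < length (es @ [e])"
      show "ends H ((es @ [e]) ! i) = {(vs @ [z]) ! i, (vs @ [z]) ! Suc i}"
      proof (cases "i = length es")
        case True
        then have "vs ! i = y" using p(1,3) vs by (simp add: last_conv_nth)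
        then show ?thesis using True e p(1) by (simp add: nth_append)
      next
        case False
        then show ?thesis using i p(1,6) by (simp add: nth_append)
      qed
    qed (use p e False vs in auto)
  qed
qed

text \<open>A path joining the ends of \<open>e\<close> without using \<open>e\<close> would close up with \<open>e\<close> to a cycle.  The edges
  of a path are distinct because an edge is determined by the positions of its two ends.\<close>

lemma acyclic_bridge:
  assumes ac: "acyclic_edges H t" and e: "e \<in> t" "ends H e = {x, y}"
  shows "y \<notin> comp_of H (t - {e}) x"
proof
  assume "y \<in> comp_of H (t - {e}) x"
  then have "(x, y) \<in> (adj_rel H (t - {e}))\<^sup>*" by (simp add: comp_of_def)
  then obtain vs es where p: "length vs = Suc (length es)" "hd vs = x" "last vs = y" "distinct vs"
    "set es \<subseteq> t - {e}" "\<And>i. i < length es \<Longrightarrow> ends H (es ! i) = {vs ! i, vs ! Suc i}"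
    by (rule simple_path_of_rtrancl) blast
  have vs: "vs \<noteq> []" using p(1) by auto
  have "distinct es"
    unfolding distinct_conv_nth
  proof (intro allI impI)
    fix i k assume ik: "i < length es" "k < length es" "i \<noteq> k"
    show "es ! i \<noteq> es ! k"
    proof
      assume "es ! i = es ! k"
      then have "{vs ! i, vs ! Suc i} = {vs ! k, vs ! Suc k}" using p(6) ik by metis
      then show False using ik p(1,4) by (auto simp: doubleton_eq_iff nth_eq_iff_index_eq)
    qed
  qed
  moreover have "ends H ((es @ [e]) ! i) = {vs ! i, vs ! (Suc i mod length vs)}"
    if "i < length vs" for i
  proof (cases "i = length es")
    case True
    then have "vs ! i = y" "vs ! 0 = x" using p(1-3) vs by (simp_all add: last_conv_nth hd_conv_nth)
    then show ?thesis using True e p(1) by (simp add: insert_commute)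
  next
    case False
    then show ?thesis using that p(1,6) by (simp add: nth_append)
  qed
  ultimately have "is_cycle H vs (es @ [e])"
    using vs p by (auto simp: is_cycle_def)
  moreover have "set (es @ [e]) \<subseteq> t" using p(5) e by auto
  ultimately show False using ac unfolding acyclic_edges_def by blast
qed

text \<open>The last edge of a cycle is not a bridge.\<close>

lemma acyclic_if_bridges:
  assumes "\<And>e x y. e \<in> t \<Longrightarrow> ends H e = {x, y} \<Longrightarrow> y \<notin> comp_of H (t - {e}) x"
  shows "acyclic_edges H t"
  unfolding acyclic_edges_def
proof
  assume "\<exists>vs es. is_cycle H vs es \<and> set es \<subseteq> t"
  then obtain vs es where c: "is_cycle H vs es" "set es \<subseteq> t" by blast
  define n where "n = length es - 1"
  have len: "length vs = Suc n" "length es = Suc n"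
    using c by (auto simp: is_cycle_def n_def)
  have d: "distinct es" and en: "\<And>i. i < Suc n \<Longrightarrow> ends H (es ! i) = {vs ! i, vs ! (Suc i mod Suc n)}"
    using c len by (auto simp: is_cycle_def)
  have "vs ! i \<in> comp_of H (t - {es ! n}) (vs ! 0)" if "i \<le> n" for i
    using that
  proof (induction i)
    case (Suc i)
    have "es ! i \<in> t - {es ! n}"
      using c(2) len Suc.prems d by (auto simp: nth_eq_iff_index_eq)
    moreover have "ends H (es ! i) = {vs ! i, vs ! Suc i}" using en[of i] Suc.prems by simp
    ultimately show ?case using Suc comp_of_step adj_relI by (metis Suc_leD)
  qed simp
  then have "vs ! n \<in> comp_of H (t - {es ! n}) (vs ! 0)" by simp
  moreover have "ends H (es ! n) = {vs ! 0, vs ! n}" using en[of n] by (simp add: insert_commute)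
  moreover have "es ! n \<in> t" using c(2) len nth_mem[of n es] by auto
  ultimately show False using assms[of "es ! n" "vs ! 0" "vs ! n"] by blast
qed

section \<open>Koenig's lemma\<close>

lemma finite_neighbours:
  assumes "multigraph G" "locally_finite G" "t \<subseteq> edges G" "v \<in> verts G"
  shows "finite {w. (v, w) \<in> adj_rel G t}"
proof (rule finite_subset)
  show "{w. (v, w) \<in> adj_rel G t} \<subseteq> (\<Union>e\<in>incident G v. ends G e)"
    using assms(3) by (auto simp: adj_rel_def incident_def)
  have "finite (ends G e)" if "e \<in> incident G v" for e
    using that multigraphD(2)[OF assms(1), of e] by (auto simp: incident_def intro: card_ge_0_finite)
  then show "finite (\<Union>e\<in>incident G v. ends G e)"
    using assms(2,4) by (auto simp: locally_finite_def)
qed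

lemma ray_mono: "is_ray G s p \<Longrightarrow> s \<subseteq> t \<Longrightarrow> is_ray G t p"
  using adj_rel_mono[of s t G] by (auto simp: is_ray_def)

lemma ray_in_comp: "is_ray G t p \<Longrightarrow> range p \<subseteq> comp_of G t (p 0)"
proof -
  assume r: "is_ray G t p"
  have "p n \<in> comp_of G t (p 0)" for n
    by (induction n) (use r in \<open>auto simp: is_ray_def intro: comp_of_step\<close>)
  then show ?thesis by auto
qed

text \<open>The ray is built by deleting the vertices visited so far and keeping the component of the
  current end vertex infinite: one of the finitely many neighbours always has an infinite
  component.\<close>

lemma koenig_ray:
  assumes G: "multigraph G" "locally_finite G" and t: "t \<subseteq> edges G" and v: "v \<in> verts G"
    and inf: "infinite (comp_of G t v)"
  obtains p where "is_ray G t p" "p 0 = v"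
proof -
  define avoid where "avoid X = {e \<in> t. ends G e \<inter> X = {}}" for X
  have av: "avoid X \<subseteq> edges G" "avoid X \<subseteq> t" for X using t by (auto simp: avoid_def)
  define P where "P s \<longleftrightarrow> snd s \<in> verts G - fst s \<and> infinite (comp_of G (avoid (fst s)) (snd s))"
    for s :: "'a set \<times> 'a"
  define Q where "Q s s' \<longleftrightarrow> fst s' = insert (snd s) (fst s) \<and> (snd s, snd s') \<in> adj_rel G t"
    for s s' :: "'a set \<times> 'a"
  have step: "\<exists>s'. P s' \<and> Q s s'" if "P s" for s
  proof -
    obtain X w where s: "s = (X, w)" by (cases s)
    have w: "w \<in> verts G" "w \<notin> X" and infw: "infinite (comp_of G (avoid X) w)"
      using that s by (auto simp: P_def)
    let ?N = "{w'. (w, w') \<in> adj_rel G (avoid X)}"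
    let ?Z = "insert w (\<Union>w'\<in>?N. comp_of G (avoid (insert w X)) w')"
    have "comp_of G (avoid X) w \<subseteq> ?Z"
    proof (rule comp_of_subset)
      fix x y assume x: "x \<in> ?Z" and xy: "(x, y) \<in> adj_rel G (avoid X)"
      show "y \<in> ?Z"
      proof (cases "x = w \<or> y = w")
        case True
        then show ?thesis using xy comp_of_refl[of y G "avoid (insert w X)"] by blast
      next
        case False
        then obtain w' where w': "w' \<in> ?N" "x \<in> comp_of G (avoid (insert w X)) w'" using x by blast
        have "(x, y) \<in> adj_rel G (avoid (insert w X))"
          using xy False by (auto simp: adj_rel_def avoid_def)
        with w' show ?thesis using comp_of_step by fastforce
      qed
    qed simp
    then have "infinite ?Z" using infw finite_subset by blast
    moreover have "finite ?N" using finite_neighbours[OF G av(1) w(1)] .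
    ultimately obtain w' where w': "w' \<in> ?N" "infinite (comp_of G (avoid (insert w X)) w')"
      by (metis (no_types, lifting) finite_UN finite_insert)
    then obtain e where e: "e \<in> avoid X" "ends G e = {w, w'}" by (auto simp: adj_rel_def)
    moreover have "e \<in> edges G" using e(1) t by (auto simp: avoid_def)
    ultimately have "w' \<in> verts G" "w' \<noteq> w" "w' \<notin> X"
      using multigraphD[OF G(1), of e] by (auto simp: avoid_def)
    then have "P (insert w X, w') \<and> Q s (insert w X, w')"
      using w' s subsetD[OF adj_rel_mono[OF av(2)]] by (auto simp: P_def Q_def)
    then show ?thesis by blast
  qed
  have "P ({}, v)" using v inf by (simp add: P_def avoid_def)
  then have "\<exists>f. f 0 = ({}, v) \<and> (\<forall>n. P (f n) \<and> Q (f n) (f (Suc n)))"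
    using dependent_nat_choice[of "\<lambda>n s. P s \<and> (n = 0 \<longrightarrow> s = ({}, v))" "\<lambda>n. Q"] step by auto
  then obtain f where f: "f 0 = ({}, v)" "\<And>n. P (f n)" "\<And>n. Q (f n) (f (Suc n))" by auto
  define p where "p n = snd (f n)" for n
  have X: "p n \<in> fst (f m)" if "n < m" for n m
    using that
  proof (induction m)
    case (Suc m)
    then show ?case using f(3)[of m] by (cases "n = m") (auto simp: Q_def p_def)
  qed simp
  have "p m \<notin> fst (f m)" "p m \<in> verts G" for m using f(2)[of m] by (auto simp: P_def p_def)
  then have "inj p" using X by (intro linorder_injI) metis
  then have "is_ray G t p"
    using f(3) \<open>\<And>m. p m \<in> verts G\<close> by (auto simp: is_ray_def p_def Q_def)
  then show ?thesis using that f(1) by (simp add: p_def)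
qed

section \<open>Burning labels\<close>

definition head :: "('v, 'e) mgraph \<Rightarrow> ('v \<Rightarrow> 'e) \<Rightarrow> 'v \<Rightarrow> 'v" where
  "head G e v = (THE w. ends G (e v) = {v, w})"

lemma ends_head:
  assumes "multigraph G" "e v \<in> edges G" "v \<in> ends G (e v)"
  shows "ends G (e v) = {v, head G e v}" "head G e v \<noteq> v" "head G e v \<in> verts G"
proof -
  obtain w where w: "ends G (e v) = {v, w}" "w \<noteq> v" "w \<in> verts G"
    using other_end_exists[OF assms] by blast
  then have "head G e v = w"
    unfolding head_def by (auto simp: doubleton_eq_iff)
  with w show "ends G (e v) = {v, head G e v}" "head G e v \<noteq> v" "head G e v \<in> verts G" by auto
qed

lemma head_eqI:
  assumes "ends G (e v) = {v, w}"
  shows "head G e v = w"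
  using assms unfolding head_def by (auto simp: doubleton_eq_iff)

text \<open>
  The labels \<open>(r v, j v)\<close> record when \<open>v\<close> burns: in layer \<open>j v\<close> of phase \<open>M + 1 - r v\<close>, where \<open>M\<close>
  is the number of phases.  Phases are counted backwards because this makes \<open>r v\<close> the least \<open>k\<close>
  for which the path from \<open>v\<close> to the sink meets \<open>D k\<close> (and \<open>M\<close> if there is none), which refers to
  the number of phases only as a cap.  Vertices outside \<open>W\<close> stand for the sink; they get \<open>Suc M\<close>, which counts as
  burnt before everything else.  The edge \<open>e v\<close> points from \<open>v\<close> to its parent in the tree.
\<close>

definition burn_labels ::
  "('v, 'e) mgraph \<Rightarrow> (nat \<Rightarrow> 'v set) \<Rightarrow> 'v set \<Rightarrow> nat \<Rightarrow> ('v \<Rightarrow> nat) \<Rightarrow> ('v \<Rightarrow> nat) \<Rightarrow> ('v \<Rightarrow> 'e) \<Rightarrow> bool" where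
  "burn_labels G D W M r j e \<longleftrightarrow> W \<subseteq> verts G \<and> (\<forall>v. v \<notin> W \<longrightarrow> r v = Suc M) \<and>
     (\<forall>v\<in>W. e v \<in> edges G \<and> v \<in> ends G (e v) \<and> 0 < r v \<and> r v \<le> M \<and> v \<notin> D (r v - 1) \<and>
        0 < j v \<and> r v \<le> r (head G e v) \<and>
        (r v < r (head G e v) \<longrightarrow> j v = 1 \<and> (r v < M \<longrightarrow> v \<in> D (r v))) \<and>
        (r v = r (head G e v) \<longrightarrow> j v = Suc (j (head G e v))))"

definition not_before :: "('v \<Rightarrow> nat) \<Rightarrow> ('v \<Rightarrow> nat) \<Rightarrow> 'v \<Rightarrow> 'v set" where
  "not_before r j v = {w. r w < r v \<or> r w = r v \<and> j v \<le> j w}"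

text \<open>Layer 0 of a phase is everything burnt in earlier phases, hence the case \<open>j v = 1\<close>.\<close>

definition just_before :: "('v \<Rightarrow> nat) \<Rightarrow> ('v \<Rightarrow> nat) \<Rightarrow> 'v \<Rightarrow> 'v set" where
  "just_before r j v = (if j v = 1 then {w. r v < r w} else {w. r w = r v \<and> Suc (j w) = j v})"

text \<open>
  The sandpile that burns according to the labels: \<open>v\<close> needs at least as many grains as it has edges
  to vertices that are not yet burnt when its turn comes, and the surplus selects the edge \<open>e v\<close> among
  those leading to the layer burnt immediately before.  All edges of \<open>G\<close> are counted, not only those
  of the finite graph in which the burning takes place, so the value is the same in different
  finite graphs as soon as the labels are.
\<close>

definition label_height ::
  "('v \<Rightarrow> 'e rel) \<Rightarrow> ('v, 'e) mgraph \<Rightarrow> ('v \<Rightarrow> nat) \<Rightarrow> ('v \<Rightarrow> nat) \<Rightarrow> ('v \<Rightarrow> 'e) \<Rightarrow> 'v \<Rightarrow> nat" where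
  "label_height prec G r j e v = card (edges_into G v (not_before r j v)) +
     card {f \<in> edges_into G v (just_before r j v). (f, e v) \<in> prec v}"

lemma edges_into_mono: "X \<subseteq> Y \<Longrightarrow> edges_into G v X \<subseteq> edges_into G v Y"
  by (auto simp: edges_into_def)

lemma edges_into_incident: "edges_into G v X \<subseteq> incident G v"
  by (auto simp: edges_into_def incident_def)

lemma edges_into_disjoint:
  assumes "X \<inter> Y = {}" shows "edges_into G v X \<inter> edges_into G v Y = {}"
  using assms by (auto simp: edges_into_def doubleton_eq_iff)

lemma edges_into_Un: "edges_into G v (X \<union> Y) = edges_into G v X \<union> edges_into G v Y"
  by (auto simp: edges_into_def)

lemma strict_linear_order_onD:
  assumes "strict_linear_order_on A r"
  shows "trans r" "\<And>x. (x, x) \<notin> r" "\<And>x y. x \<in> A \<Longrightarrow> y \<in> A \<Longrightarrow> x \<noteq> y \<Longrightarrow> (x, y) \<in> r \<or> (y, x) \<in> r"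
  using assms by (auto simp: strict_linear_order_on_def irrefl_def total_on_def)

lemma rank_less_card:
  assumes "strict_linear_order_on A r" "finite F" "F \<subseteq> A" "e \<in> F"
  shows "card {f \<in> F. (f, e) \<in> r} < card F"
  using assms strict_linear_order_onD(2)[OF assms(1), of e] by (intro psubset_card_mono) auto

lemma rank_strict_mono:
  assumes "strict_linear_order_on A r" "finite F" "F \<subseteq> A" "e \<in> F" "e' \<in> F" "(e, e') \<in> r"
  shows "card {f \<in> F. (f, e) \<in> r} < card {f \<in> F. (f, e') \<in> r}"
proof (intro psubset_card_mono psubsetI)
  show "{f \<in> F. (f, e) \<in> r} \<subseteq> {f \<in> F. (f, e') \<in> r}"
    using strict_linear_order_onD(1)[OF assms(1)] assms(6) by (auto dest: transD)
  show "{f \<in> F. (f, e) \<in> r} \<noteq> {f \<in> F. (f, e') \<in> r}"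
    using strict_linear_order_onD(2)[OF assms(1), of e] assms(4,6) by auto
qed (use assms in auto)

lemma rank_inj:
  assumes "strict_linear_order_on A r" "finite F" "F \<subseteq> A" "e \<in> F" "e' \<in> F"
    "card {f \<in> F. (f, e) \<in> r} = card {f \<in> F. (f, e') \<in> r}"
  shows "e = e'"
proof (rule ccontr)
  assume "e \<noteq> e'"
  then have "(e, e') \<in> r \<or> (e', e) \<in> r"
    using strict_linear_order_onD(3)[OF assms(1), of e e'] assms(3-5) by blast
  then show False
    using rank_strict_mono[OF assms(1-3), of e e'] rank_strict_mono[OF assms(1-3), of e' e] assms(4-6)
    by linarith
qed

text \<open>The rank is an injection of \<open>F\<close> into \<open>{..<card F}\<close>, hence onto.\<close>

lemma rank_surj:
  assumes "strict_linear_order_on A r" "finite F" "F \<subseteq> A" "l < card F"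
  obtains e where "e \<in> F" "card {f \<in> F. (f, e) \<in> r} = l"
proof -
  let ?k = "\<lambda>e. card {f \<in> F. (f, e) \<in> r}"
  have "inj_on ?k F" using rank_inj[OF assms(1-3)] by (auto simp: inj_on_def)
  then have "card (?k ` F) = card F" by (rule card_image)
  moreover have "?k ` F \<subseteq> {..<card F}" using rank_less_card[OF assms(1-3)] by auto
  ultimately have "?k ` F = {..<card F}" by (intro card_subset_eq) auto
  with assms(4) have "l \<in> ?k ` F" by simp
  with that show ?thesis by auto
qed

locale labelled_tree =
  fixes G :: "('v, 'e) mgraph" and D :: "nat \<Rightarrow> 'v set" and W :: "'v set" and M :: nat
    and r j :: "'v \<Rightarrow> nat" and e :: "'v \<Rightarrow> 'e"
  assumes mg: "multigraph G" and Dmono: "mono D" and labels: "burn_labels G D W M r j e"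
begin

abbreviation "p \<equiv> head G e"

lemma W_verts: "W \<subseteq> verts G" using labels by (rule burn_labels_def[THEN iffD1, THEN conjunct1])
lemma r_out: "v \<notin> W \<Longrightarrow> r v = Suc M" using labels[unfolded burn_labels_def, THEN conjunct2, THEN conjunct1] by blast

lemma
  assumes "v \<in> W"
  shows e_edge: "e v \<in> edges G" and e_at: "v \<in> ends G (e v)" and r_pos: "0 < r v" and r_le: "r v \<le> M"
    and not_D: "v \<notin> D (r v - 1)" and j_pos: "0 < j v" and r_head: "r v \<le> r (p v)"
    and r_less: "r v < r (p v) \<Longrightarrow> j v = 1 \<and> (r v < M \<longrightarrow> v \<in> D (r v))"
    and r_eq: "r v = r (p v) \<Longrightarrow> j v = Suc (j (p v))"
proof -
  note * = labels[unfolded burn_labels_def, THEN conjunct2, THEN conjunct2, THEN bspec, OF assms]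
  show "e v \<in> edges G" "v \<in> ends G (e v)" "0 < r v" "r v \<le> M" "v \<notin> D (r v - 1)" "0 < j v" "r v \<le> r (p v)"
    using * by blast+
  show "j v = 1 \<and> (r v < M \<longrightarrow> v \<in> D (r v))" if "r v < r (p v)"
    using * that by (elim conjE) (erule (1) mp)
  show "j v = Suc (j (p v))" if "r v = r (p v)"
    using * that by (elim conjE) (erule (1) mp)
qed

lemma D_less: "a < b \<Longrightarrow> v \<in> D a \<Longrightarrow> v \<in> D (b - 1)"
  using monoD[OF Dmono, of a "b - 1"] by (cases b) auto

lemma ends_e: "v \<in> W \<Longrightarrow> ends G (e v) = {v, p v}"
  by (rule ends_head(1)[OF mg e_edge e_at])

lemma r_le_iff: "r v \<le> M \<longleftrightarrow> v \<in> W"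
  using r_le[of v] r_out[of v] by (cases "v \<in> W") auto

lemma j_one_iff: "v \<in> W \<Longrightarrow> j v = 1 \<longleftrightarrow> r v < r (p v)"
proof
  assume v: "v \<in> W" and "j v = 1"
  show "r v < r (p v)"
  proof (rule ccontr)
    assume "\<not> r v < r (p v)"
    then have "r v = r (p v)" using r_head[OF v] by simp
    with r_eq[OF v] \<open>j v = 1\<close> have "j (p v) = 0" by simp
    moreover have "p v \<in> W" using \<open>r v = r (p v)\<close> r_le[OF v] by (simp flip: r_le_iff)
    ultimately show False using j_pos by fastforce
  qed
qed (use r_less in blast)

text \<open>Heads burn strictly earlier.  This order replaces induction along paths of the tree.\<close>

lemma head_earlier: "v \<in> W \<Longrightarrow> r v < r (p v) \<or> r v = r (p v) \<and> j (p v) < j v"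
  using r_head[of v] r_eq[of v] by (cases "r v = r (p v)") auto

lemma e_inj: "inj_on e W"
proof (rule inj_onI, rule ccontr)
  fix v w assume vw: "v \<in> W" "w \<in> W" "e v = e w" "v \<noteq> w"
  then have "p v = w" "p w = v" using ends_e[of v] ends_e[of w] by (auto simp: doubleton_eq_iff)
  then show False using head_earlier[of v] head_earlier[of w] vw by auto
qed

lemma incident_e:
  assumes "v \<in> W" "f \<in> e ` W" "v \<in> ends G f" "f \<noteq> e v"
  obtains w where "w \<in> W" "f = e w" "p w = v" "w \<noteq> v"
proof -
  obtain w where w: "w \<in> W" "f = e w" using assms(2) by blast
  with assms(3,4) ends_e[of w] have "p w = v" "w \<noteq> v" by auto
  with w that show ?thesis by blast
qed

lemma not_before_subset: "v \<in> W \<Longrightarrow> not_before r j v \<subseteq> W"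
  using r_le[of v] by (force simp: not_before_def simp flip: r_le_iff)

lemma head_just_before: "v \<in> W \<Longrightarrow> p v \<in> just_before r j v"
  using j_one_iff[of v] r_head[of v] r_eq[of v] by (auto simp: just_before_def)

lemma e_just_before: "v \<in> W \<Longrightarrow> e v \<in> edges_into G v (just_before r j v)"
  using head_just_before e_edge ends_e by (auto simp: edges_into_def)

lemma not_before_just_before: "v \<in> W \<Longrightarrow> not_before r j v \<inter> just_before r j v = {}"
  using j_pos[of v] by (auto simp: not_before_def just_before_def)

end

text \<open>Two labelled trees that use the same edges at a set \<open>A\<close> closed under descendants
  direct them alike: where the directions disagreed one could follow the second tree inside \<open>A\<close>
  towards ever earlier labels.\<close>

lemma labelled_trees_agree_edges:
  assumes L0: "labelled_tree G D W0 M0 r0 j0 e0" and L: "labelled_tree G D W M r j e"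
    and A: "A \<subseteq> W0" "A \<subseteq> W"
    and closed: "\<And>w. w \<in> W0 \<Longrightarrow> head G e0 w \<in> A \<Longrightarrow> w \<in> A"
    and same: "\<And>f. ends G f \<inter> A \<noteq> {} \<Longrightarrow> f \<in> e0 ` W0 \<longleftrightarrow> f \<in> e ` W"
    and v: "v \<in> A"
  shows "e v = e0 v"
proof -
  interpret L0: labelled_tree G D W0 M0 r0 j0 e0 by (fact L0)
  interpret L: labelled_tree G D W M r j e by (fact L)
  have step: "L.p v \<in> A \<and> e (L.p v) \<noteq> e0 (L.p v)" if v: "v \<in> A" "e v \<noteq> e0 v" for v
  proof -
    have vW: "v \<in> W" "v \<in> W0" using v A by auto
    have "ends G (e v) \<inter> A \<noteq> {}" using v(1) L.e_at[OF vW(1)] by blast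
    then have "e v \<in> e0 ` W0" using same vW by blast
    then obtain w where w: "w \<in> W0" "e v = e0 w" "L0.p w = v" "w \<noteq> v"
      using L0.incident_e[OF vW(2) _ L.e_at[OF vW(1)] v(2)] by blast
    have "w \<in> A" using closed[OF w(1)] w(3) v(1) by simp
    moreover have "L.p v = w" using L.ends_e[OF vW(1)] L0.ends_e[OF w(1)] w by (auto simp: doubleton_eq_iff)
    moreover have "e w \<noteq> e v"
      using L.e_inj vW \<open>w \<in> A\<close> A w(4) by (auto dest: inj_onD)
    ultimately show ?thesis using w by auto
  qed
  show ?thesis
  proof (rule ccontr)
    assume ne: "e v \<noteq> e0 v"
    define B where "B = {v \<in> A. e v \<noteq> e0 v}"
    have "v \<in> B" using v ne by (simp add: B_def)
    \<comment> \<open>Among the disagreeing vertices, one that is earliest in the second tree contradicts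
      the previous fact.\<close>
    define R where "R = inv_image (less_than <*lex*> less_than) (\<lambda>c. (M - r c, j c))"
    have "wf R" by (simp add: R_def wf_lex_prod)
    then obtain c where c: "c \<in> B" "\<And>d. (d, c) \<in> R \<Longrightarrow> d \<notin> B"
      using wfE_min[OF _ \<open>v \<in> B\<close>] by metis
    have "L.p c \<in> B" using step c(1) by (auto simp: B_def)
    moreover have "c \<in> W" "L.p c \<in> W" using c(1) \<open>L.p c \<in> B\<close> A by (auto simp: B_def)
    then have "(L.p c, c) \<in> R"
      using L.head_earlier[of c] L.r_le[of "L.p c"] by (auto simp: R_def)
    ultimately show False using c(2) by blast
  qed
qed

text \<open>Given the directed edges, the labels of a vertex are computed from those of its head; the
  induction therefore starts at the vertices whose head lies outside \<open>A\<close>.\<close>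

lemma labelled_trees_agree_labels:
  assumes L0: "labelled_tree G D W0 M0 r0 j0 e0" and L: "labelled_tree G D W M r j e"
    and A: "A \<subseteq> W0" "A \<subseteq> W"
    and same: "\<And>v. v \<in> A \<Longrightarrow> e v = e0 v"
    and exit: "\<And>v. v \<in> A \<Longrightarrow> head G e v \<notin> A \<Longrightarrow> r v = r0 v \<and> j v = 1 \<and> j0 v = 1"
    and v: "v \<in> A"
  shows "r v = r0 v \<and> j v = j0 v"
proof -
  interpret L0: labelled_tree G D W0 M0 r0 j0 e0 by (fact L0)
  interpret L: labelled_tree G D W M r j e by (fact L)
  have pe: "L.p v = L0.p v" if "v \<in> A" for v using same[OF that] by (simp add: head_def)
  show ?thesis
    using v
  proof (induction "(M0 - r0 v, j0 v)" arbitrary: v rule: wf_induct_rule[OF wf_lex_prod[OF wf_less_than wf_less_than]])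
    case (1 v)
    have vW: "v \<in> W" "v \<in> W0" using 1 A by auto
    show ?case
    proof (cases "L.p v \<in> A")
      case True
      then have wW: "L0.p v \<in> W" "L0.p v \<in> W0" using pe[OF 1(2)] A by auto
      have "((M0 - r0 (L0.p v), j0 (L0.p v)), (M0 - r0 v, j0 v)) \<in> less_than <*lex*> less_than"
        using L0.head_earlier[OF vW(2)] L0.r_le[OF wW(2)] by auto
      with 1 True have IH: "r (L0.p v) = r0 (L0.p v)" "j (L0.p v) = j0 (L0.p v)"
        using pe by force+
      define \<rho> where "\<rho> = r0 (L0.p v)"
      \<comment> \<open>Both labels equal the least index of a set of the anchor containing \<open>v\<close>, if that is below \<open>\<rho>\<close>, and \<open>\<rho>\<close> otherwise.\<close>
      have 1: "r v < \<rho> \<Longrightarrow> v \<in> D (r v) \<and> j v = 1" "r0 v < \<rho> \<Longrightarrow> v \<in> D (r0 v) \<and> j0 v = 1"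
        using L.r_less[OF vW(1)] L0.r_less[OF vW(2)] L.r_le[OF wW(1)] L0.r_le[OF wW(2)] IH pe[OF 1(2)]
        by (auto simp: \<rho>_def)
      have 2: "v \<notin> D (r v - 1)" "v \<notin> D (r0 v - 1)" using L.not_D L0.not_D vW by auto
      have 3: "r v \<le> \<rho>" "r0 v \<le> \<rho>"
        using L.r_head[OF vW(1)] L0.r_head[OF vW(2)] IH pe[OF \<open>v \<in> A\<close>] by (auto simp: \<rho>_def)
      have "r v = r0 v"
      proof (rule linorder_cases[of "r v" "r0 v"])
        assume l: "r v < r0 v"
        then have "v \<in> D (r v)" using 1 3 by simp
        then show ?thesis using L.D_less[OF l] 2 by simp
      next
        assume l: "r0 v < r v"
        then have "v \<in> D (r0 v)" using 1 3 by simp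
        then show ?thesis using L.D_less[OF l] 2 by simp
      qed
      moreover have "j v = j0 v"
        using 1 3 IH L.r_eq[OF vW(1)] L0.r_eq[OF vW(2)] pe[OF \<open>v \<in> A\<close>] \<open>r v = r0 v\<close>
        by (cases "r v = \<rho>") (auto simp: \<rho>_def)
      ultimately show ?thesis by simp
    qed (use exit 1 in auto)
  qed
qed

text \<open>For \<open>k < M\<close>, a vertex with \<open>r w \<le> k\<close> is one whose path to the sink meets \<open>D k\<close>.  The next lemma
  is the locality of the construction: knowing the tree edges at the descendants of \<open>D k\<close> is
  enough to know the descendants of \<open>D k\<close> and all that happens there.\<close>

lemma labelled_trees_agree_descendants:
  assumes L0: "labelled_tree G D W0 M0 r0 j0 e0" and L: "labelled_tree G D W M r j e"
    and k: "k < M0" "k < M" and A: "A = {v. r0 v \<le> k}" "A \<subseteq> W" and D: "D k \<subseteq> A"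
    and same: "\<And>f. ends G f \<inter> A \<noteq> {} \<Longrightarrow> f \<in> e0 ` W0 \<longleftrightarrow> f \<in> e ` W"
  shows "{v. r v \<le> k} = A" and "\<And>v. v \<in> A \<Longrightarrow> e v = e0 v \<and> r v = r0 v \<and> j v = j0 v"
proof -
  interpret L0: labelled_tree G D W0 M0 r0 j0 e0 by (fact L0)
  interpret L: labelled_tree G D W M r j e by (fact L)
  have AW: "A \<subseteq> W0" using A(1) k(1) L0.r_le_iff by fastforce
  have closed: "w \<in> A" if "w \<in> W0" "L0.p w \<in> A" for w
    using L0.r_head[OF that(1)] that(2) A(1) by auto
  have eq: "e v = e0 v" if "v \<in> A" for v
    by (rule labelled_trees_agree_edges[OF L0 L AW A(2) closed same that])
  \<comment> \<open>The second path of \<open>w\<close> enters \<open>D k\<close> without changing phase, so induction on \<open>j\<close> applies.\<close>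
  have sub: "w \<in> A" if "w \<in> W" "r w \<le> k" for w
    using that
  proof (induction "j w" arbitrary: w rule: less_induct)
    case less
    show ?case
    proof (cases "w \<in> D k")
      case False
      have "r w = r (L.p w)"
      proof (rule ccontr)
        assume "r w \<noteq> r (L.p w)"
        then have "w \<in> D (r w)" using L.r_less[OF less(2)] L.r_head[OF less(2)] less(3) k by auto
        then show False using L.Dmono less(3) False by (auto simp: mono_def)
      qed
      moreover have "L.p w \<in> W" using \<open>r w = r (L.p w)\<close> less(3) k by (simp flip: L.r_le_iff)
      ultimately have pA: "L.p w \<in> A" using less L.r_eq by simp
      have "ends G (e w) \<inter> A \<noteq> {}" using L.ends_e[OF less(2)] pA by blast
      then have "e w \<in> e0 ` W0" using same less(2) by blast
      show ?thesis
      proof (cases "e w = e0 (L.p w)")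
        case True
        then have "e w = e (L.p w)" using eq[OF pA] by simp
        then have "w = L.p w" using L.e_inj less(2) \<open>L.p w \<in> W\<close> by (auto dest: inj_onD)
        then show ?thesis using pA by simp
      next
        case False
        obtain u where u: "u \<in> W0" "e w = e0 u" "L0.p u = L.p w" "u \<noteq> L.p w"
          using L0.incident_e[OF _ \<open>e w \<in> e0 ` W0\<close> _ False] pA AW L.ends_e[OF less(2)] by blast
        then have "u = w" using L0.ends_e[OF u(1)] L.ends_e[OF less(2)] by (auto simp: doubleton_eq_iff)
        then show ?thesis using closed[of w] u pA by auto
      qed
    qed (use D in auto)
  qed
  have lab: "r v = r0 v \<and> j v = j0 v" if "v \<in> A" for v
  proof (rule labelled_trees_agree_labels[OF L0 L AW A(2) eq _ that])
    fix v assume v: "v \<in> A" and out: "L.p v \<notin> A"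
    have vW: "v \<in> W" "v \<in> W0" using v A AW by auto
    have pe: "L0.p v = L.p v" using eq[OF v] by (simp add: head_def)
    have "k < r (L.p v)"
    proof (rule ccontr)
      assume c: "\<not> k < r (L.p v)"
      then have "L.p v \<in> W" using k by (simp flip: L.r_le_iff)
      then show False using sub c out by simp
    qed
    moreover have rv: "r0 v \<le> k" and "k < r0 (L0.p v)" using A(1) v out pe by auto
    then have 0: "v \<in> D (r0 v)" "j0 v = 1" using L0.r_less[OF vW(2)] k by auto
    have "r v \<le> r0 v"
    proof (rule ccontr)
      assume "\<not> r v \<le> r0 v"
      then have "v \<in> D (r v - 1)" using 0 L.D_less[of "r0 v" "r v" v] by simp
      then show False using L.not_D[OF vW(1)] by simp
    qed
    then have "j v = 1 \<and> v \<in> D (r v)" using L.r_less[OF vW(1)] \<open>k < r (L.p v)\<close> rv k by auto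
    moreover have "r0 v \<le> r v"
    proof (rule ccontr)
      assume "\<not> r0 v \<le> r v"
      then have "v \<in> D (r0 v - 1)" using calculation L.D_less[of "r v" "r0 v" v] by simp
      then show False using L0.not_D[OF vW(2)] by simp
    qed
    ultimately show "r v = r0 v \<and> j v = 1 \<and> j0 v = 1" using \<open>r v \<le> r0 v\<close> 0 by auto
  qed
  show "{v. r v \<le> k} = A"
  proof (intro equalityI subsetI)
    fix v assume "v \<in> {v. r v \<le> k}"
    moreover from this have "v \<in> W" using k by (simp flip: L.r_le_iff)
    ultimately show "v \<in> A" using sub by simp
  qed (use lab A(1) in auto)
  show "\<And>v. v \<in> A \<Longrightarrow> e v = e0 v \<and> r v = r0 v \<and> j v = j0 v" using eq lab by blast
qed

text \<open>The height of \<open>v\<close> only compares labels with that of \<open>v\<close>, so labels above \<open>k\<close> need not be known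
  exactly when \<open>r v \<le> k\<close>.\<close>

lemma label_height_cong:
  assumes "r v = r' v" "j v = j' v" "e v = e' v" "r v \<le> k"
    and "\<And>w. r w \<le> k \<Longrightarrow> r w = r' w \<and> j w = j' w" "\<And>w. r' w \<le> k \<Longrightarrow> r w \<le> k"
  shows "label_height prec G r j e v = label_height prec G r' j' e' v"
proof -
  have c: "(r w < r v) = (r' w < r v)" "(r v < r w) = (r v < r' w)" "(r w = r v) = (r' w = r v)"
    "r' w = r v \<Longrightarrow> j w = j' w" for w
  proof -
    have "r w = r' w \<and> j w = j' w \<or> k < r w \<and> k < r' w" using assms(5,6)[of w] by linarith
    then show "(r w < r v) = (r' w < r v)" "(r v < r w) = (r v < r' w)" "(r w = r v) = (r' w = r v)"
      "r' w = r v \<Longrightarrow> j w = j' w"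
      using assms(4) by auto
  qed
  have "not_before r j v = not_before r' j' v" "just_before r j v = just_before r' j' v"
    unfolding not_before_def just_before_def assms(1,2)[symmetric] using c by auto
  then show ?thesis using assms(1-3) by (simp add: label_height_def)
qed

lemma labelled_trees_agree_height:
  assumes L0: "labelled_tree G D W0 M0 r0 j0 e0" and L: "labelled_tree G D W M r j e"
    and k: "k < M0" "k < M" and A: "A = {v. r0 v \<le> k}" "A \<subseteq> W" and D: "D k \<subseteq> A"
    and same: "\<And>f. ends G f \<inter> A \<noteq> {} \<Longrightarrow> f \<in> e0 ` W0 \<longleftrightarrow> f \<in> e ` W"
    and v: "v \<in> A"
  shows "label_height prec G r j e v = label_height prec G r0 j0 e0 v"
proof -
  have agr: "{v. r v \<le> k} = A" "\<And>v. v \<in> A \<Longrightarrow> e v = e0 v \<and> r v = r0 v \<and> j v = j0 v"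
    by (rule labelled_trees_agree_descendants[OF L0 L k A D]; simp add: same)+
  have in_A: "r w \<le> k \<longleftrightarrow> w \<in> A" "r0 w \<le> k \<longleftrightarrow> w \<in> A" for w using agr(1) A(1) by blast+
  show ?thesis
    by (rule label_height_cong[where k = k]) (simp_all add: in_A agr(2) v)
qed

text \<open>A tree leaves no choice for the order of burning; this makes the burning map injective.\<close>

lemma labelled_trees_unique:
  assumes L0: "labelled_tree G D W M r0 j0 e0" and L: "labelled_tree G D W M r j e"
    and same: "e0 ` W = e ` W" and v: "v \<in> W"
  shows "e v = e0 v" "r v = r0 v" "j v = j0 v"
    "label_height prec G r j e v = label_height prec G r0 j0 e0 v"
proof -
  interpret L0: labelled_tree G D W M r0 j0 e0 by (fact L0)
  interpret L: labelled_tree G D W M r j e by (fact L)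
  have eq: "e v = e0 v" if "v \<in> W" for v
    by (rule labelled_trees_agree_edges[OF L0 L subset_refl subset_refl _ _ that]) (use same in auto)
  have lab: "r v = r0 v \<and> j v = j0 v" if "v \<in> W" for v
  proof (rule labelled_trees_agree_labels[OF L0 L subset_refl subset_refl eq _ that])
    fix v assume v: "v \<in> W" and out: "L.p v \<notin> W"
    have pe: "L0.p v = L.p v" using eq[OF v] by (simp add: head_def)
    have "r v < r (L.p v)" "r0 v < r0 (L0.p v)"
      using L.r_out[OF out] L0.r_out[OF out] L.r_le[OF v] L0.r_le[OF v] pe by auto
    note l = L.r_less[OF v this(1)] L0.r_less[OF v this(2)]
    have "r v = r0 v"
    proof (rule linorder_cases[of "r v" "r0 v"])
      assume a: "r v < r0 v"
      then show ?thesis using l L0.not_D[OF v] L0.r_le[OF v] L.D_less[OF a] by simp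
    next
      assume a: "r0 v < r v"
      then show ?thesis using l L.not_D[OF v] L.r_le[OF v] L.D_less[OF a] by simp
    qed
    with l show "r v = r0 v \<and> j v = 1 \<and> j0 v = 1" by simp
  qed
  show "e v = e0 v" "r v = r0 v" "j v = j0 v" using eq lab v by auto
  then show "label_height prec G r j e v = label_height prec G r0 j0 e0 v"
    by (intro label_height_cong[where k = M]) (simp_all add: L.r_le_iff L0.r_le_iff lab v)
qed

text \<open>Merging everything with label above \<open>k\<close> into the sink leaves the heights of the descendants of
  \<open>D k\<close> unchanged.  This makes the configurations on the sets \<open>desc G t (D k)\<close> consistent.\<close>

lemma labelled_tree_truncate:
  assumes L: "labelled_tree G D W M r j e" and k: "k < M"
  shows "labelled_tree G D {v. r v \<le> k} k (\<lambda>v. min (r v) (Suc k)) j e"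
    and "r v \<le> k \<Longrightarrow> label_height prec G (\<lambda>v. min (r v) (Suc k)) j e v = label_height prec G r j e v"
proof -
  interpret L: labelled_tree G D W M r j e by (fact L)
  have W: "v \<in> W" if "r v \<le> k" for v using that k by (simp flip: L.r_le_iff)
  have "burn_labels G D {v. r v \<le> k} k (\<lambda>v. min (r v) (Suc k)) j e"
    unfolding burn_labels_def
  proof (intro conjI ballI)
    show "{v. r v \<le> k} \<subseteq> verts G" using W L.W_verts by blast
  next
    fix v assume "v \<in> {v. r v \<le> k}"
    then have v: "r v \<le> k" "v \<in> W" using W by auto
    show "min (r v) (Suc k) < min (r (L.p v)) (Suc k) \<longrightarrow>
      j v = 1 \<and> (min (r v) (Suc k) < k \<longrightarrow> v \<in> D (min (r v) (Suc k)))"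
      using L.r_less[OF v(2)] v(1) k by (auto simp: min_def)
    show "min (r v) (Suc k) = min (r (L.p v)) (Suc k) \<longrightarrow> j v = Suc (j (L.p v))"
      using L.r_eq[OF v(2)] v(1) by (auto simp: min_def split: if_splits)
    show "min (r v) (Suc k) \<le> min (r (L.p v)) (Suc k)" using L.r_head[OF v(2)] by auto
    show "v \<notin> D (min (r v) (Suc k) - 1)" using L.not_D[OF v(2)] v(1) by (simp add: min_def)
  qed (use W L.e_edge L.e_at L.r_pos L.j_pos in auto)
  then show "labelled_tree G D {v. r v \<le> k} k (\<lambda>v. min (r v) (Suc k)) j e"
    using L.mg L.Dmono by (simp add: labelled_tree_def)
  show "r v \<le> k \<Longrightarrow> label_height prec G (\<lambda>v. min (r v) (Suc k)) j e v = label_height prec G r j e v"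
    by (rule label_height_cong[where k = k]) auto
qed

section \<open>The burning rule computes the labels\<close>

lemma UN_nat_split: "(\<Union>n. X n) = X 0 \<union> (\<Union>n. X (Suc n))"
proof (intro equalityI subsetI)
  fix x assume "x \<in> (\<Union>n. X n)"
  then obtain n where "x \<in> X n" by blast
  then show "x \<in> X 0 \<union> (\<Union>n. X (Suc n))" by (cases n) auto
qed auto

lemma nonsink_sink_graph [simp]: "nonsink (sink_graph G W F) = W"
  by (auto simp: nonsink_def sink_graph_def)

text \<open>
  The edge sets \<open>F\<close> for which burning in \<open>sink_graph G W F\<close> is described by labels; wired and anchored
  graphs are the instances needed.  By the last clause a vertex that burns in the first layer of a
  phase, either thanks to an edge to the sink or because it was held back by a set of the anchor
  before, has all its edges of \<open>G\<close> in \<open>F\<close>.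
\<close>

definition sink_edges :: "('v, 'e) mgraph \<Rightarrow> (nat \<Rightarrow> 'v set) \<Rightarrow> 'v set \<Rightarrow> nat \<Rightarrow> 'e set \<Rightarrow> bool" where
  "sink_edges G D W M F \<longleftrightarrow> F \<subseteq> edges G \<and> (\<forall>f\<in>F. ends G f \<inter> W \<noteq> {}) \<and>
     {f \<in> edges G. ends G f \<subseteq> W} \<subseteq> F \<and>
     (\<forall>v\<in>W. v \<in> D (M - 1) \<or> (\<exists>f\<in>F. v \<in> ends G f \<and> \<not> ends G f \<subseteq> W) \<longrightarrow> incident G v \<subseteq> F)"

locale sink_burning =
  fixes G :: "('v, 'e) mgraph" and D :: "nat \<Rightarrow> 'v set" and prec :: "'v \<Rightarrow> 'e rel"
    and W :: "'v set" and F :: "'e set" and m :: nat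
  assumes mg: "multigraph G" and lf: "locally_finite G" and W_fin: "finite W" and W_sub: "W \<subseteq> verts G"
    and Dmono: "mono D" and D0: "D 0 = {}"
    and prec: "\<And>v. v \<in> W \<Longrightarrow> strict_linear_order_on (incident G v) (prec v)"
    and F: "sink_edges G D W (Suc m) F"
begin

abbreviation "H \<equiv> sink_graph G W F"

lemma F_edges: "F \<subseteq> edges G" and F_touch: "f \<in> F \<Longrightarrow> ends G f \<inter> W \<noteq> {}"
  and F_inside: "f \<in> edges G \<Longrightarrow> ends G f \<subseteq> W \<Longrightarrow> f \<in> F"
  and F_complete: "v \<in> W \<Longrightarrow> v \<in> D m \<or> (\<exists>f\<in>F. v \<in> ends G f \<and> \<not> ends G f \<subseteq> W) \<Longrightarrow> incident G v \<subseteq> F"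
  using F[unfolded sink_edges_def diff_Suc_1] by blast+

lemma finite_incident: "v \<in> W \<Longrightarrow> finite (incident G v)"
  using lf W_sub by (auto simp: locally_finite_def)

lemma finite_edges_into: "v \<in> W \<Longrightarrow> finite (edges_into G v X)"
  using finite_incident edges_into_incident finite_subset by metis

lemma edges_into_H:
  assumes "v \<in> W"
  shows "edges_into H (Some v) Y = F \<inter> edges_into G v {y. (if y \<in> W then Some y else None) \<in> Y}"
proof -
  define \<phi> where "\<phi> = (\<lambda>y. if y \<in> W then Some y else None)"
  have \<phi>: "\<phi> y = Some v \<longleftrightarrow> y = v" for y using assms by (auto simp: \<phi>_def)
  have "(\<exists>z\<in>Y. \<phi> ` ends G f = {Some v, z}) \<longleftrightarrow> (\<exists>y. \<phi> y \<in> Y \<and> ends G f = {v, y})" if "f \<in> F" for f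
  proof
    assume "\<exists>z\<in>Y. \<phi> ` ends G f = {Some v, z}"
    then obtain z where z: "z \<in> Y" "\<phi> ` ends G f = {Some v, z}" by blast
    have "f \<in> edges G" using that F_edges by blast
    then obtain a b where ab: "ends G f = {a, b}" "a \<noteq> b"
      using multigraphD(2)[OF mg, of f] by (auto simp: card_2_iff)
    have "{\<phi> a, \<phi> b} = {Some v, z}" using z(2) ab(1) by simp
    then have "\<phi> a = Some v \<and> \<phi> b = z \<or> \<phi> b = Some v \<and> \<phi> a = z"
      by (auto simp: doubleton_eq_iff)
    then show "\<exists>y. \<phi> y \<in> Y \<and> ends G f = {v, y}"
      using z(1) ab unfolding \<phi> by (auto simp: insert_commute)
  next
    assume "\<exists>y. \<phi> y \<in> Y \<and> ends G f = {v, y}"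
    then obtain y where "\<phi> y \<in> Y" "ends G f = {v, y}" by blast
    then show "\<exists>z\<in>Y. \<phi> ` ends G f = {Some v, z}" using \<phi>[of v] by (intro bexI[of _ "\<phi> y"]) auto
  qed
  then have "{f \<in> F. \<exists>z\<in>Y. \<phi> ` ends G f = {Some v, z}} = {f \<in> F. \<exists>y. \<phi> y \<in> Y \<and> ends G f = {v, y}}"
    by blast
  moreover have "edges_into H (Some v) Y = {f \<in> F. \<exists>z\<in>Y. \<phi> ` ends G f = {Some v, z}}"
    by (simp add: edges_into_def sink_graph_def \<phi>_def)
  moreover have "{y. (if y \<in> W then Some y else None) \<in> Y} = {y. \<phi> y \<in> Y}" by (simp add: \<phi>_def)
  ultimately show ?thesis using F_edges by (auto simp: edges_into_def)
qed

lemma edges_into_H_Some: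
  assumes "v \<in> W" "U \<subseteq> W"
  shows "edges_into H (Some v) (Some ` U) = edges_into G v U"
proof -
  have "{y. (if y \<in> W then Some y else None) \<in> Some ` U} = U" using assms(2) by auto
  moreover have "edges_into G v U \<subseteq> F" using F_inside assms by (auto simp: edges_into_def)
  ultimately show ?thesis using assms(1) by (simp add: edges_into_H Int_absorb1)
qed

lemma degree_in_H: "v \<in> W \<Longrightarrow> U \<subseteq> W \<Longrightarrow> degree_in H (Some ` U) (Some v) = card (edges_into G v U)"
  by (simp add: degree_in_def edges_into_H_Some)

lemma incident_H: "v \<in> W \<Longrightarrow> incident H (Some v) = F \<inter> incident G v"
  using F_edges by (auto simp: incident_def sink_graph_def image_iff split: if_splits)

lemma incident_eq_edges_into: "v \<in> W \<Longrightarrow> incident G v = edges_into G v UNIV"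
proof (intro equalityI subsetI)
  fix f assume "v \<in> W" "f \<in> incident G v"
  then show "f \<in> edges_into G v UNIV"
    using other_end_exists[OF mg, of f v] by (auto simp: incident_def edges_into_def)
qed (auto simp: edges_into_def incident_def)

lemma degree_H_split:
  assumes "v \<in> W" "U \<subseteq> W"
  shows "degree H (Some v) = card (edges_into G v U) + card (F \<inter> edges_into G v (- U))"
proof -
  have "incident H (Some v) = edges_into G v U \<union> (F \<inter> edges_into G v (- U))"
    using assms F_inside edges_into_Un[of G v U "- U"]
    by (auto simp: incident_H incident_eq_edges_into edges_into_def)
  moreover have "edges_into G v U \<inter> (F \<inter> edges_into G v (- U)) = {}"
    using edges_into_disjoint[of U "- U" G v] by auto
  ultimately show ?thesis
    unfolding degree_def using finite_edges_into[OF assms(1)] by (simp add: card_Un_disjoint)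
qed

end

locale labelled_burning = sink_burning G D prec W F m + labelled_tree G D W "Suc m" r j e
  for G :: "('v, 'e) mgraph" and D prec W F m r j e +
  assumes eF: "v \<in> W \<Longrightarrow> e v \<in> F"
begin

abbreviation "lheight \<equiv> label_height prec G r j e"

text \<open>The edges that \<open>label_height\<close> ranks are edges of the finite graph: for \<open>j v > 1\<close> they
  stay inside \<open>W\<close>, and for \<open>j v = 1\<close> the vertex \<open>v\<close> keeps all its edges.\<close>

lemma just_before_F: "v \<in> W \<Longrightarrow> edges_into G v (just_before r j v) \<subseteq> F"
proof (cases "j v = 1")
  assume v: "v \<in> W" and "j v = 1"
  then have rv: "r v < r (p v)" using j_one_iff by simp
  have "incident G v \<subseteq> F"
  proof (rule F_complete[OF v])
    show "v \<in> D m \<or> (\<exists>f\<in>F. v \<in> ends G f \<and> \<not> ends G f \<subseteq> W)"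
    proof (cases "r v < Suc m")
      case True
      then have "v \<in> D (r v)" using r_less[OF v rv] by simp
      then show ?thesis using monoD[OF Dmono, of "r v" m] True by auto
    next
      case False
      then have "p v \<notin> W" using rv by (simp flip: r_le_iff)
      then show ?thesis using eF[OF v] ends_e[OF v] by blast
    qed
  qed
  then show ?thesis using edges_into_incident by (rule subset_trans[rotated])
next
  assume v: "v \<in> W" and "j v \<noteq> 1"
  then have "just_before r j v \<subseteq> W"
    using r_le[OF v] by (auto simp: just_before_def simp flip: r_le_iff)
  then show ?thesis using v F_inside by (auto simp: edges_into_def)
qed

lemma height_less:
  assumes "v \<in> W"
  shows "lheight v < card (edges_into G v (not_before r j v)) + card (edges_into G v (just_before r j v))"
  unfolding label_height_def
  using rank_less_card[OF prec[OF assms] finite_edges_into[OF assms] edges_into_incident e_just_before[OF assms]]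
  by simp

lemma height_ge: "card (edges_into G v (not_before r j v)) \<le> lheight v"
  by (simp add: label_height_def)

lemma height_less_wider:
  assumes "v \<in> W" "not_before r j v \<union> just_before r j v \<subseteq> U"
  shows "lheight v < card (edges_into G v U)"
proof -
  have "lheight v < card (edges_into G v (not_before r j v)) + card (edges_into G v (just_before r j v))"
    by (rule height_less[OF assms(1)])
  also have "\<dots> = card (edges_into G v (not_before r j v \<union> just_before r j v))"
    using edges_into_disjoint[OF not_before_just_before[OF assms(1)], of G v] finite_edges_into[OF assms(1)]
    by (simp add: edges_into_Un card_Un_disjoint)
  also have "\<dots> \<le> card (edges_into G v U)"
    using finite_edges_into[OF assms(1)] edges_into_mono[OF assms(2)] by (rule card_mono)
  finally show ?thesis .
qed

text \<open>What is unburnt after \<open>J\<close> layers of the phase with label \<open>\<rho>\<close>.\<close>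

definition still :: "nat \<Rightarrow> nat \<Rightarrow> 'v set" where
  "still \<rho> J = {w \<in> W. r w < \<rho> \<or> r w = \<rho> \<and> J < j w}"

text \<open>A vertex whose label is later still has its whole layer \<open>just_before\<close> unburnt and
  is too low to burn, unless \<open>j = 1\<close>; but then it lies in \<open>D (r v)\<close> and is not
  allowed to burn yet.\<close>

lemma burnable_still:
  assumes \<eta>: "\<forall>v\<in>W. \<eta> v = lheight v" and \<rho>: "0 < \<rho>" "\<rho> \<le> Suc m"
  shows "burnable H \<eta> (D (\<rho> - 1)) (still \<rho> J) = {w \<in> W. r w = \<rho> \<and> j w = Suc J}"
proof (intro equalityI subsetI)
  fix v assume "v \<in> {w \<in> W. r w = \<rho> \<and> j w = Suc J}"
  then have v: "v \<in> W" "r v = \<rho>" "j v = Suc J" by auto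
  have "not_before r j v = still \<rho> J"
    using not_before_subset[OF v(1)] v by (auto simp: not_before_def still_def)
  then show "v \<in> burnable H \<eta> (D (\<rho> - 1)) (still \<rho> J)"
    using v not_D[OF v(1)] height_ge[of v] not_before_subset[OF v(1)]
    by (auto simp: burnable_def \<eta> degree_in_H not_before_def)
next
  fix v assume b: "v \<in> burnable H \<eta> (D (\<rho> - 1)) (still \<rho> J)"
  then have v: "v \<in> W" "v \<notin> D (\<rho> - 1)" "r v < \<rho> \<or> r v = \<rho> \<and> J < j v"
    by (auto simp: burnable_def still_def)
  have "card (edges_into G v (still \<rho> J)) \<le> lheight v"
    using b v(1) degree_in_H[of v "still \<rho> J"] by (auto simp: burnable_def still_def \<eta>)
  then have ns: "\<not> not_before r j v \<union> just_before r j v \<subseteq> still \<rho> J"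
    using height_less_wider[OF v(1), of "still \<rho> J"] by auto
  show "v \<in> {w \<in> W. r w = \<rho> \<and> j w = Suc J}"
  proof (rule ccontr)
    assume c: "v \<notin> {w \<in> W. r w = \<rho> \<and> j w = Suc J}"
    \<comment> \<open>A vertex with \<open>j v = 1\<close> and a later label is not allowed to burn in this phase.\<close>
    have j1: "j v \<noteq> 1"
    proof
      assume "j v = 1"
      then have "r v < r (p v)" "r v < \<rho>" using c v j_one_iff[OF v(1)] by auto
      then have "v \<in> D (r v)" using r_less[OF v(1)] \<rho> by auto
      then show False using D_less[OF \<open>r v < \<rho>\<close>] v(2) by simp
    qed
    have "not_before r j v \<union> just_before r j v \<subseteq> still \<rho> J"
    proof
      fix w assume "w \<in> not_before r j v \<union> just_before r j v"
      then have w: "r w < r v \<or> r w = r v \<and> j v \<le> Suc (j w)"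
        using j1 by (auto simp: not_before_def just_before_def)
      then have "w \<in> W" using r_le[OF v(1)] by (auto simp flip: r_le_iff)
      then show "w \<in> still \<rho> J" using w v(3) c v(1) by (auto simp: still_def)
    qed
    with ns show False by simp
  qed
qed

lemma layers:
  assumes \<eta>: "\<forall>v\<in>W. \<eta> v = lheight v" and \<rho>: "0 < \<rho>" "\<rho> \<le> Suc m"
  defines "B \<equiv> insert None (Some ` {w \<in> W. \<rho> < r w})"
  shows "unburnt H \<eta> (D (\<rho> - 1)) B J = still \<rho> J"
    and "layer H \<eta> (D (\<rho> - 1)) B (Suc J) = Some ` {w \<in> W. r w = \<rho> \<and> j w = Suc J}"
    and "(\<Union>J. layer H \<eta> (D (\<rho> - 1)) B J) = insert None (Some ` {w \<in> W. \<rho> \<le> r w})"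
proof -
  have 1: "unburnt H \<eta> (D (\<rho> - 1)) B J = still \<rho> J" for J
  proof (induction J)
    case 0
    show ?case using j_pos by (auto simp: B_def still_def)
  next
    case (Suc J)
    show ?case
      unfolding unburnt.simps Suc burnable_still[OF \<eta> \<rho>] by (auto simp: still_def)
  qed
  have 2: "layer H \<eta> (D (\<rho> - 1)) B (Suc J) = Some ` {w \<in> W. r w = \<rho> \<and> j w = Suc J}" for J
    unfolding layer.simps 1 burnable_still[OF \<eta> \<rho>] ..
  have "(\<Union>J. layer H \<eta> (D (\<rho> - 1)) B J) =
      layer H \<eta> (D (\<rho> - 1)) B 0 \<union> (\<Union>J. layer H \<eta> (D (\<rho> - 1)) B (Suc J))"
    by (rule UN_nat_split)
  also have "\<dots> = insert None (Some ` {w \<in> W. \<rho> \<le> r w})"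
  proof -
    have "\<exists>J. j w = Suc J" if "w \<in> W" for w using j_pos[OF that] by (cases "j w") auto
    then have "(\<Union>J. {w \<in> W. r w = \<rho> \<and> j w = Suc J}) = {w \<in> W. r w = \<rho>}" by auto
    then have "(\<Union>J. layer H \<eta> (D (\<rho> - 1)) B (Suc J)) = Some ` {w \<in> W. r w = \<rho>}"
      unfolding 2 image_UN[symmetric] by simp
    moreover have "{w \<in> W. \<rho> \<le> r w} = {w \<in> W. \<rho> < r w} \<union> {w \<in> W. r w = \<rho>}" by auto
    ultimately show ?thesis by (simp add: B_def image_Un)
  qed
  finally show "(\<Union>J. layer H \<eta> (D (\<rho> - 1)) B J) = insert None (Some ` {w \<in> W. \<rho> \<le> r w})" .
  show "unburnt H \<eta> (D (\<rho> - 1)) B J = still \<rho> J"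
    and "layer H \<eta> (D (\<rho> - 1)) B (Suc J) = Some ` {w \<in> W. r w = \<rho> \<and> j w = Suc J}"
    by (rule 1, rule 2)
qed

lemma burnt_after_labels:
  assumes \<eta>: "\<forall>v\<in>W. \<eta> v = lheight v" and "n \<le> Suc m"
  shows "burnt_after H \<eta> D m n = insert None (Some ` {w \<in> W. Suc m - n < r w})"
  using assms(2)
proof (induction n)
  case 0
  show ?case using r_le by force
next
  case (Suc n)
  have eq: "m - n = (Suc m - n) - 1" by simp
  have "burnt_after H \<eta> D m (Suc n) = insert None (Some ` {w \<in> W. Suc m - n \<le> r w})"
    unfolding burnt_after.simps Suc.IH[OF Suc_leD[OF Suc.prems]] eq
    by (rule layers(3)[OF \<eta>]) (use Suc.prems in auto)
  moreover have "Suc m - n \<le> a \<longleftrightarrow> Suc m - Suc n < a" for a using Suc.prems by auto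
  ultimately show ?case by simp
qed

lemma burn_layer_labels:
  assumes \<eta>: "\<forall>v\<in>W. \<eta> v = lheight v" and i: "i \<in> {1..m + 1}"
  shows "burn_layer H \<eta> D m i 0 = insert None (Some ` {w \<in> W. Suc (Suc m) - i < r w})"
    and "burn_layer H \<eta> D m i (Suc J) = Some ` {w \<in> W. r w = Suc (Suc m) - i \<and> j w = Suc J}"
proof -
  have eq: "m + 1 - i = (Suc (Suc m) - i) - 1" by simp
  have ba: "burnt_after H \<eta> D m (i - 1) = insert None (Some ` {w \<in> W. Suc (Suc m) - i < r w})"
  proof -
    have c: "Suc m - (i - 1) = Suc (Suc m) - i" "i - 1 \<le> Suc m" using i by auto
    show ?thesis using burnt_after_labels[OF \<eta> c(2)] unfolding c(1) .
  qed
  show "burn_layer H \<eta> D m i 0 = insert None (Some ` {w \<in> W. Suc (Suc m) - i < r w})"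
    unfolding burn_layer_def ba by simp
  show "burn_layer H \<eta> D m i (Suc J) = Some ` {w \<in> W. r w = Suc (Suc m) - i \<and> j w = Suc J}"
    unfolding burn_layer_def ba eq by (rule layers(2)[OF \<eta>]) (use i in auto)
qed

text \<open>The label of \<open>v\<close> leaves one choice for the phase and the layer, and then the defining equation of the
  burning edge says that it has the same rank as \<open>e v\<close>.\<close>

lemma burn_edge_labels:
  assumes \<eta>: "\<forall>v\<in>W. \<eta> v = lheight v" and v: "v \<in> W"
  shows "burn_edge prec H D m \<eta> v = e v"
proof -
  let ?L = "burn_layer H \<eta> D m"
  define Q where "Q i J x \<longleftrightarrow> Some v \<in> ?L i J \<and>
     (let mv = card (edges_into H (Some v) (\<Union>J'<J. ?L i J'));
          Fv = edges_into H (Some v) (?L i (J - 1))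
      in x \<in> Fv \<and> \<eta> v + mv = degree H (Some v) + card {f \<in> Fv. (f, x) \<in> prec v})" for i J x
  define i where "i = Suc (Suc m) - r v"
  have i: "i \<in> {1..m + 1}" and ri: "Suc (Suc m) - i = r v" using r_pos[OF v] r_le[OF v] by (auto simp: i_def)
  note L0 = burn_layer_labels(1)[OF \<eta>] and LS = burn_layer_labels(2)[OF \<eta>]
  have phase: "i' = i \<and> J = j v" if c: "i' \<in> {1..m + 1}" "J \<ge> 1" "Some v \<in> ?L i' J" for i' J
  proof -
    obtain J' where J: "J = Suc J'" using c(2) by (cases J) auto
    show ?thesis using c(3) c(1) unfolding J LS[OF c(1)] by (auto simp: i_def)
  qed
  obtain J where J: "j v = Suc J" using j_pos[OF v] by (cases "j v") auto
  have in_layer: "Some v \<in> ?L i (j v)" using LS[OF i, of J] J v ri by simp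
  let ?N = "not_before r j v" and ?F = "edges_into G v (just_before r j v)"
  have N: "?N \<subseteq> W" by (rule not_before_subset[OF v])
  \<comment> \<open>Everything burnt before \<open>v\<close> is the complement of \<open>not_before r j v\<close>, sink included.\<close>
  have before: "(\<Union>J'<j v. ?L i J') = insert None (Some ` (W - ?N))"
  proof -
    have "{..<j v} = insert 0 (Suc ` {..<J})" unfolding J by (rule lessThan_Suc_eq_insert_0)
    then have "(\<Union>J'<j v. ?L i J') = ?L i 0 \<union> (\<Union>J'<J. ?L i (Suc J'))" by auto
    also have "\<dots> = insert None (Some ` {w \<in> W. r v < r w \<or> r w = r v \<and> j w < j v})"
    proof -
      have "\<exists>J'<J. j w = Suc J'" if "w \<in> W" "j w < j v" for w
        using j_pos[OF that(1)] that(2) J by (cases "j w") auto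
      then have "{w \<in> W. r v < r w \<or> r w = r v \<and> j w < j v} =
          {w \<in> W. r v < r w} \<union> (\<Union>J'<J. {w \<in> W. r w = r v \<and> j w = Suc J'})" using J by auto
      then show ?thesis unfolding L0[OF i] LS[OF i] ri by (simp add: image_Un image_UN)
    qed
    also have "{w \<in> W. r v < r w \<or> r w = r v \<and> j w < j v} = W - ?N"
      by (auto simp: not_before_def)
    finally show ?thesis .
  qed
  have mv: "edges_into H (Some v) (\<Union>J'<j v. ?L i J') = F \<inter> edges_into G v (- ?N)"
  proof -
    have "{y. (if y \<in> W then Some y else None) \<in> insert None (Some ` (W - ?N))} = - ?N"
      using N by auto
    then show ?thesis unfolding before edges_into_H[OF v] by simp
  qed
  have Fv: "edges_into H (Some v) (?L i (j v - 1)) = ?F"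
  proof -
    have "{y. (if y \<in> W then Some y else None) \<in> ?L i J} = just_before r j v"
    proof (cases J)
      case 0
      have "r v < r y" if "y \<notin> W" for y using r_out[OF that] r_le[OF v] by simp
      then show ?thesis unfolding 0 L0[OF i] ri just_before_def using J 0 by auto
    next
      case (Suc J')
      have "y \<in> W" if "r y = r v" for y using that r_le[OF v] by (simp flip: r_le_iff)
      then show ?thesis unfolding Suc LS[OF i] ri just_before_def using J Suc by auto
    qed
    then show ?thesis using just_before_F[OF v] edges_into_H[OF v, of "?L i J"] J by auto
  qed
  have Q: "Q i (j v) x \<longleftrightarrow> x \<in> ?F \<and> card {f \<in> ?F. (f, x) \<in> prec v} = card {f \<in> ?F. (f, e v) \<in> prec v}" for x
  proof -
    have "\<eta> v = card (edges_into G v ?N) + card {f \<in> ?F. (f, e v) \<in> prec v}"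
      using \<eta> v by (simp add: label_height_def)
    moreover have "degree H (Some v) = card (edges_into G v ?N) + card (F \<inter> edges_into G v (- ?N))"
      by (rule degree_H_split[OF v N])
    ultimately show ?thesis
      unfolding Q_def Let_def mv Fv using in_layer by auto
  qed
  have "(\<exists>i\<in>{1..m + 1}. \<exists>J\<ge>1. Q i J x) \<longleftrightarrow> x = e v" for x
  proof
    assume "\<exists>i\<in>{1..m + 1}. \<exists>J\<ge>1. Q i J x"
    then obtain i' J' where "i' \<in> {1..m + 1}" "J' \<ge> 1" "Q i' J' x" by blast
    moreover from this have "i' = i" "J' = j v" using phase by (auto simp: Q_def)
    ultimately have "Q i (j v) x" by simp
    then have "x \<in> ?F" "card {f \<in> ?F. (f, x) \<in> prec v} = card {f \<in> ?F. (f, e v) \<in> prec v}"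
      by (simp_all only: Q)
    then show "x = e v"
      using rank_inj[OF prec[OF v] finite_edges_into[OF v] edges_into_incident _ e_just_before[OF v]]
      by blast
  next
    assume "x = e v"
    then have "Q i (j v) x" using e_just_before[OF v] by (simp add: Q)
    moreover have "j v \<ge> 1" using j_pos[OF v] by simp
    ultimately show "\<exists>i\<in>{1..m + 1}. \<exists>J\<ge>1. Q i J x" using i by blast
  qed
  then show ?thesis unfolding burn_edge_def Q_def by simp
qed

lemma burn_tree_labels:
  assumes \<eta>: "\<forall>v\<in>W. \<eta> v = lheight v"
  shows "burn_tree prec H D m \<eta> = e ` W"
  using burn_edge_labels[OF assms] by (auto simp: burn_tree_def image_iff)

text \<open>Everything in \<open>U\<close> is still unburnt when its first vertex burns, so that vertex is ample.\<close>

lemma earliest_vertex: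
  assumes "U \<subseteq> W" "U \<noteq> {}"
  obtains x where "x \<in> U" "U \<subseteq> not_before r j x" "card (edges_into G x U) \<le> lheight x"
proof -
  define R where "R = inv_image (less_than <*lex*> less_than) (\<lambda>c. (Suc m - r c, j c))"
  have "wf R" by (simp add: R_def wf_lex_prod)
  moreover obtain u where "u \<in> U" using assms(2) by blast
  ultimately obtain x where x: "x \<in> U" "\<And>y. (y, x) \<in> R \<Longrightarrow> y \<notin> U"
    using wfE_min by metis
  have U: "U \<subseteq> not_before r j x"
  proof
    fix y assume y: "y \<in> U"
    then have "(y, x) \<notin> R" using x(2) by blast
    moreover have "r y \<le> Suc m" "r x \<le> Suc m" using y x(1) assms(1) r_le by auto
    ultimately show "y \<in> not_before r j x" by (auto simp: R_def not_before_def)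
  qed
  then have "card (edges_into G x U) \<le> card (edges_into G x (not_before r j x))"
    using x(1) assms(1) finite_edges_into by (intro card_mono edges_into_mono) auto
  with height_ge[of x] that[OF x(1) U] show ?thesis by simp
qed

lemma height_recurrent: "restrict lheight W \<in> recurrent H"
  unfolding recurrent_def nonsink_sink_graph mem_Collect_eq
proof (intro conjI allI impI)
  have "lheight v < degree H (Some v)" if v: "v \<in> W" for v
  proof -
    have "just_before r j v \<subseteq> - not_before r j v" using not_before_just_before[OF v] by blast
    then have "edges_into G v (just_before r j v) \<subseteq> F \<inter> edges_into G v (- not_before r j v)"
      using edges_into_mono[of _ "- not_before r j v" G v] just_before_F[OF v] by (simp add: le_infI)
    then have "card (edges_into G v (just_before r j v)) \<le> card (F \<inter> edges_into G v (- not_before r j v))"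
      using finite_edges_into[OF v] by (intro card_mono) auto
    then show ?thesis
      using height_less[OF v] degree_H_split[OF v not_before_subset[OF v]] by linarith
  qed
  then show "restrict lheight W \<in> (\<Pi>\<^sub>E x\<in>W. {..<degree H (Some x)})" by auto
  fix U assume "U \<noteq> {} \<and> U \<subseteq> W"
  then have U: "U \<subseteq> W" "U \<noteq> {}" by auto
  obtain x where x: "x \<in> U" "card (edges_into G x U) \<le> lheight x" by (rule earliest_vertex[OF U])
  moreover have "x \<in> W" using x U by blast
  ultimately show "ample H (\<lambda>x. restrict lheight W (the x)) (Some ` U)"
    using U degree_in_H[of x U] unfolding ample_def by (intro bexI[of _ "Some x"]) auto
qed

end

section \<open>Every recurrent sandpile comes from a labelling\<close>

locale recurrent_burning = sink_burning +
  fixes \<eta> :: "'a \<Rightarrow> nat"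
  assumes rec: "\<eta> \<in> recurrent H"
begin

text \<open>\<open>U n J\<close> is what is unburnt after \<open>J\<close> layers of phase \<open>n + 1\<close>.\<close>

definition U :: "nat \<Rightarrow> nat \<Rightarrow> 'a set" where
  "U n J = unburnt H \<eta> (D (m - n)) (burnt_after H \<eta> D m n) J"

lemma U_Suc: "U n (Suc J) = U n J - burnable H \<eta> (D (m - n)) (U n J)"
  by (simp add: U_def)

lemma U_W: "U n J \<subseteq> W"
  by (induction J) (auto simp: U_def)

lemma U_antimono: "J \<le> J' \<Longrightarrow> U n J' \<subseteq> U n J"
  by (rule lift_Suc_antimono_le[of "U n"]) (auto simp: U_Suc)

lemma U_next: "U (Suc n) 0 = (\<Inter>J. U n J)"
proof (intro equalityI subsetI)
  fix v assume "v \<in> U (Suc n) 0"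
  then have v: "v \<in> W" "\<And>J. Some v \<notin> layer H \<eta> (D (m - n)) (burnt_after H \<eta> D m n) J"
    by (auto simp: U_def)
  have "v \<in> U n J" for J
  proof (induction J)
    case 0
    show ?case using v(1) v(2)[of 0] by (auto simp: U_def)
  next
    case (Suc J)
    then show ?case using v(2)[of "Suc J"] by (auto simp: U_Suc U_def)
  qed
  then show "v \<in> (\<Inter>J. U n J)" by blast
next
  fix v assume v: "v \<in> (\<Inter>J. U n J)"
  have "Some v \<notin> layer H \<eta> (D (m - n)) (burnt_after H \<eta> D m n) J" for J
  proof (cases J)
    case 0
    have "v \<in> U n 0" using v by blast
    then show ?thesis using 0 by (simp add: U_def)
  next
    case (Suc J')
    have "v \<in> U n J" using v by blast
    then show ?thesis using Suc by (auto simp: U_def)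
  qed
  moreover have "v \<in> W" using v U_W by blast
  ultimately show "v \<in> U (Suc n) 0" by (auto simp: U_def)
qed

text \<open>The sets \<open>U n J\<close> decrease in \<open>J\<close> inside a finite set, so they become stationary, and nothing can
  burn at that point.\<close>

lemma phase_ends: "burnable H \<eta> (D (m - n)) (U (Suc n) 0) = {}"
proof -
  obtain J where J: "U n J = U (Suc n) 0"
  proof -
    have "\<forall>v\<in>W - U (Suc n) 0. \<exists>J. v \<notin> U n J" by (auto simp: U_next)
    then obtain K where K: "\<forall>v\<in>W - U (Suc n) 0. v \<notin> U n (K v)" by metis
    define J where "J = Max (insert 0 (K ` W))"
    have "K v \<le> J" if "v \<in> W" for v using that W_fin by (simp add: J_def)
    then have "U n J \<subseteq> U (Suc n) 0" using K U_antimono U_W by blast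
    moreover have "U (Suc n) 0 \<subseteq> U n J" by (auto simp: U_next)
    ultimately show ?thesis using that by blast
  qed
  have "U (Suc n) 0 \<subseteq> U n (Suc J)" unfolding U_next by blast
  then show ?thesis using J U_Suc[of n J] by (auto simp: burnable_def)
qed

lemma phases_subset: "n \<le> n' \<Longrightarrow> U n' 0 \<subseteq> U n 0"
  by (rule lift_Suc_antimono_le[of "\<lambda>n. U n 0"]) (auto simp: U_next)

lemma U_start: "U 0 0 = W"
  by (auto simp: U_def)

text \<open>Nothing is held back in the last phase, so what it leaves unburnt is a set for which the
  sandpile is not ample.\<close>

lemma U_end: "U (Suc m) 0 = {}"
proof (rule ccontr)
  assume ne: "U (Suc m) 0 \<noteq> {}"
  then have "ample H (\<lambda>x. \<eta> (the x)) (Some ` U (Suc m) 0)"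
    using rec U_W by (auto simp: recurrent_def)
  then show False using phase_ends[of m] by (auto simp: ample_def burnable_def D0)
qed

text \<open>Both counters start at 0: \<open>v\<close> burns in layer \<open>step v + 1\<close> of phase \<open>phase v + 1\<close>.\<close>

definition phase :: "'a \<Rightarrow> nat" where "phase v = (LEAST n. v \<notin> U (Suc n) 0)"
definition step :: "'a \<Rightarrow> nat" where "step v = (LEAST J. v \<notin> U (phase v) (Suc J))"

lemma phase_le: "phase v \<le> m"
  unfolding phase_def by (rule Least_le) (simp add: U_end)

lemma not_U_phase: "v \<notin> U (Suc (phase v)) 0"
  unfolding phase_def by (rule LeastI[of _ m]) (simp add: U_end)

lemma U_phase: "v \<in> W \<Longrightarrow> v \<in> U (phase v) 0"
proof (cases "phase v")
  case (Suc n)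
  then show ?thesis using not_less_Least[of n "\<lambda>n. v \<notin> U (Suc n) 0"] by (auto simp: phase_def)
qed (simp add: U_start)

lemma U0_iff: "v \<in> W \<Longrightarrow> v \<in> U n 0 \<longleftrightarrow> n \<le> phase v"
  using phases_subset[of n "phase v"] phases_subset[of "Suc (phase v)" n] U_phase[of v] not_U_phase[of v]
  by (cases "n \<le> phase v") auto

lemma not_U_step: assumes "v \<in> W" shows "v \<notin> U (phase v) (Suc (step v))"
proof -
  obtain J where "v \<notin> U (phase v) J" using not_U_phase[of v] by (auto simp: U_next)
  then have "v \<notin> U (phase v) (Suc J)" using U_antimono[of J "Suc J" "phase v"] by auto
  then show ?thesis unfolding step_def by (rule LeastI)
qed

lemma U_step: assumes "v \<in> W" shows "v \<in> U (phase v) (step v)"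
proof (cases "step v")
  case (Suc J)
  then show ?thesis using not_less_Least[of J "\<lambda>J. v \<notin> U (phase v) (Suc J)"] by (auto simp: step_def)
qed (use U_phase assms in simp)

lemma U_iff:
  assumes "v \<in> W"
  shows "v \<in> U n J \<longleftrightarrow> n < phase v \<or> n = phase v \<and> J \<le> step v"
proof (rule linorder_cases[of n "phase v"])
  assume "n < phase v"
  moreover from this have "v \<in> U (Suc n) 0" using U0_iff[OF assms, of "Suc n"] by simp
  ultimately show ?thesis by (auto simp: U_next)
next
  assume "phase v < n"
  then show ?thesis using U0_iff[OF assms, of n] U_antimono[of 0 J n] by auto
next
  assume n: "n = phase v"
  show ?thesis
    using U_antimono[of J "step v" n] U_antimono[of "Suc (step v)" J n] U_step[OF assms] not_U_step[OF assms] n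
    by (cases "J \<le> step v") auto
qed

definition r :: "'a \<Rightarrow> nat" where "r v = (if v \<in> W then Suc m - phase v else Suc (Suc m))"
definition j :: "'a \<Rightarrow> nat" where "j v = Suc (step v)"

lemma burnt_at_step: "v \<in> W \<Longrightarrow> v \<in> burnable H \<eta> (D (m - phase v)) (U (phase v) (step v))"
  using U_step[of v] not_U_step[of v] by (auto simp: U_Suc)

lemma not_before_U: "v \<in> W \<Longrightarrow> not_before r j v = U (phase v) (step v)"
proof (intro equalityI subsetI)
  fix w assume v: "v \<in> W" and w: "w \<in> not_before r j v"
  then have "w \<in> W" using phase_le[of v] by (auto simp: not_before_def r_def split: if_splits)
  then show "w \<in> U (phase v) (step v)"
    using v w phase_le[of w] phase_le[of v] by (auto simp: U_iff not_before_def r_def j_def)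
next
  fix w assume v: "v \<in> W" and w: "w \<in> U (phase v) (step v)"
  then have "w \<in> W" using U_W by blast
  then show "w \<in> not_before r j v"
    using v w phase_le[of w] phase_le[of v] by (auto simp: U_iff not_before_def r_def j_def)
qed

lemma just_before_first:
  assumes "v \<in> W" "step v = 0"
  shows "just_before r j v = - U (phase v) 0"
proof -
  have U: "U (phase v) 0 = not_before r j v" using not_before_U[OF assms(1)] assms(2) by simp
  show ?thesis
    unfolding U just_before_def not_before_def j_def assms(2)
    by (simp add: set_eq_iff, linarith)
qed

lemma just_before_Suc:
  assumes v: "v \<in> W" and "step v = Suc J"
  shows "just_before r j v = U (phase v) J - U (phase v) (Suc J)"
proof (intro equalityI subsetI)
  fix w assume w: "w \<in> just_before r j v"
  then have "w \<in> W" using v assms(2) phase_le[of v] by (auto simp: just_before_def r_def j_def split: if_splits)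
  then show "w \<in> U (phase v) J - U (phase v) (Suc J)"
    using assms w phase_le[of w] phase_le[of v] by (auto simp: U_iff just_before_def r_def j_def split: if_splits)
next
  fix w assume w: "w \<in> U (phase v) J - U (phase v) (Suc J)"
  then have "w \<in> W" using U_W by blast
  then show "w \<in> just_before r j v"
    using assms w phase_le[of w] phase_le[of v] by (auto simp: U_iff just_before_def r_def j_def)
qed

lemma degree_le: "v \<in> W \<Longrightarrow> card (edges_into G v (not_before r j v)) \<le> \<eta> v"
  using burnt_at_step[of v] degree_in_H[of v "U (phase v) (step v)"] U_W
  by (simp add: burnable_def not_before_U)

lemma not_D_phase: "v \<in> W \<Longrightarrow> v \<notin> D (r v - 1)"
  using burnt_at_step[of v] by (auto simp: burnable_def r_def)

text \<open>A vertex that burns at the start of a later phase was held back before, so it lies in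
  the set \<open>D\<close> of the previous phase.\<close>

lemma held_back:
  assumes "v \<in> W" "step v = 0" "r v < Suc m"
  shows "v \<in> D (r v)"
proof -
  obtain n where n: "phase v = Suc n" using assms by (cases "phase v") (auto simp: r_def)
  have "v \<in> U (Suc n) 0" using U_phase[OF assms(1)] n by simp
  moreover have "degree_in H (Some ` U (Suc n) 0) (Some v) \<le> \<eta> v"
    using burnt_at_step[OF assms(1)] n assms(2) by (simp add: burnable_def)
  ultimately have "v \<in> D (m - n)" using phase_ends[of n] by (auto simp: burnable_def)
  then show ?thesis using n assms(1) by (simp add: r_def)
qed

text \<open>The upper bound on \<open>\<eta> v\<close> holds since \<open>v\<close> did not burn one layer earlier, or, in the first layer of
  a phase, since \<open>\<eta> v\<close> is less than the degree of \<open>v\<close>.\<close>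

lemma less_just_before:
  assumes v: "v \<in> W"
  shows "\<eta> v < card (edges_into G v (not_before r j v)) + card (edges_into G v (just_before r j v)) \<and>
    edges_into G v (just_before r j v) \<subseteq> F"
proof (cases "step v")
  case 0
  let ?U = "U (phase v) 0"
  have deg: "\<eta> v < degree H (Some v)" using rec v by (auto simp: recurrent_def)
  also have "\<dots> = card (edges_into G v ?U) + card (F \<inter> edges_into G v (- ?U))"
    by (rule degree_H_split[OF v U_W])
  finally have less: "\<eta> v < card (edges_into G v ?U) + card (F \<inter> edges_into G v (- ?U))" .
  have "incident G v \<subseteq> F"
  proof (rule F_complete[OF v])
    show "v \<in> D m \<or> (\<exists>f\<in>F. v \<in> ends G f \<and> \<not> ends G f \<subseteq> W)"
    proof (cases "r v < Suc m")
      case True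
      then show ?thesis using held_back[OF v 0] monoD[OF Dmono, of "r v" m] by auto
    next
      case False
      then have "phase v = 0" using v by (auto simp: r_def)
      then have "card (F \<inter> edges_into G v (- W)) \<noteq> 0"
        using less degree_le[OF v] not_before_U[OF v] 0 by (simp add: U_start)
      then have "F \<inter> edges_into G v (- W) \<noteq> {}" by (metis card.empty)
      then obtain f where "f \<in> F" "f \<in> edges_into G v (- W)" by blast
      then show ?thesis by (auto simp: edges_into_def)
    qed
  qed
  then have F: "edges_into G v X \<subseteq> F" for X using edges_into_incident by (rule subset_trans[rotated])
  then show ?thesis
    using less 0 F[of "- ?U"] by (simp add: not_before_U[OF v] just_before_first[OF v 0] Int_absorb1)
next
  case (Suc J)
  let ?A = "U (phase v) (Suc J)" and ?B = "U (phase v) J"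
  have AB: "?A \<subseteq> ?B" by (rule U_antimono) simp
  have "v \<in> ?B" "v \<notin> burnable H \<eta> (D (m - phase v)) ?B"
    using U_step[OF v] Suc by (auto simp: U_Suc)
  moreover have "v \<notin> D (m - phase v)" using burnt_at_step[OF v] by (simp add: burnable_def)
  ultimately have "\<eta> v < card (edges_into G v ?B)"
    using degree_in_H[OF v U_W] by (auto simp: burnable_def)
  also have "edges_into G v ?B = edges_into G v ?A \<union> edges_into G v (?B - ?A)"
    using AB by (simp flip: edges_into_Un add: Un_absorb1)
  also have "card \<dots> = card (edges_into G v ?A) + card (edges_into G v (?B - ?A))"
    using finite_edges_into[OF v] edges_into_disjoint[of ?A "?B - ?A" G v] by (simp add: card_Un_disjoint)
  finally have "\<eta> v < card (edges_into G v ?A) + card (edges_into G v (?B - ?A))" .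
  moreover have "edges_into G v (?B - ?A) \<subseteq> F"
    using F_inside v U_W[of "phase v" J] by (auto simp: edges_into_def)
  ultimately show ?thesis
    using Suc by (simp add: not_before_U[OF v] just_before_Suc[OF v Suc])
qed

text \<open>The grains beyond those needed to burn are the rank of exactly one edge.\<close>

lemma edge_choice:
  assumes v: "v \<in> W"
  shows "\<exists>f. f \<in> edges_into G v (just_before r j v) \<and> f \<in> F \<and>
    \<eta> v = card (edges_into G v (not_before r j v)) +
      card {f' \<in> edges_into G v (just_before r j v). (f', f) \<in> prec v}"
proof -
  let ?E = "edges_into G v (just_before r j v)" and ?n = "card (edges_into G v (not_before r j v))"
  have "\<eta> v - ?n < card ?E" using less_just_before[OF v] degree_le[OF v] by linarith
  then obtain f where f: "f \<in> ?E" "card {f' \<in> ?E. (f', f) \<in> prec v} = \<eta> v - ?n"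
    by (rule rank_surj[OF prec[OF v] finite_edges_into[OF v] edges_into_incident])
  moreover have "f \<in> F" using less_just_before[OF v] f(1) by blast
  ultimately show ?thesis using degree_le[OF v] by auto
qed

text \<open>The burning process itself supplies the labels.\<close>

theorem exists_labelling:
  obtains r' j' e where "labelled_burning G D prec W F m r' j' e"
    "\<eta> = restrict (label_height prec G r' j' e) W"
proof -
  define Q where "Q v f \<longleftrightarrow> f \<in> edges_into G v (just_before r j v) \<and> f \<in> F \<and>
    \<eta> v = card (edges_into G v (not_before r j v)) +
      card {f' \<in> edges_into G v (just_before r j v). (f', f) \<in> prec v}" for v f
  have "\<forall>v\<in>W. \<exists>f. Q v f" unfolding Q_def by (intro ballI edge_choice)
  then have "\<exists>e. \<forall>v\<in>W. Q v (e v)" by (rule bchoice)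
  then obtain e where "\<forall>v\<in>W. Q v (e v)" by blast
  then have e: "\<And>v. v \<in> W \<Longrightarrow> e v \<in> edges_into G v (just_before r j v)" "\<And>v. v \<in> W \<Longrightarrow> e v \<in> F"
    "\<And>v. v \<in> W \<Longrightarrow> \<eta> v = label_height prec G r j e v"
    unfolding Q_def label_height_def by blast+
  have p: "e v \<in> edges G" "v \<in> ends G (e v)" "head G e v \<in> just_before r j v" if v: "v \<in> W" for v
  proof -
    obtain w where w: "e v \<in> edges G" "ends G (e v) = {v, w}" "w \<in> just_before r j v"
      using e(1)[OF v] by (auto simp: edges_into_def)
    moreover from w(2) have "head G e v = w" by (rule head_eqI)
    ultimately show "e v \<in> edges G" "v \<in> ends G (e v)" "head G e v \<in> just_before r j v" by auto
  qed
  have "burn_labels G D W (Suc m) r j e"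
    unfolding burn_labels_def
  proof (intro conjI ballI allI impI)
    fix v assume v: "v \<in> W"
    have h: "if step v = 0 then r v < r (head G e v) else r (head G e v) = r v \<and> Suc (j (head G e v)) = j v"
      using p(3)[OF v] by (auto simp: just_before_def j_def split: if_splits)
    show "e v \<in> edges G" "v \<in> ends G (e v)" using p v by auto
    show "0 < r v" "r v \<le> Suc m" using v phase_le[of v] by (auto simp: r_def)
    show "v \<notin> D (r v - 1)" by (rule not_D_phase[OF v])
    show "0 < j v" by (simp add: j_def)
    show "r v \<le> r (head G e v)" using h by (auto split: if_splits)
    show "j v = 1" if "r v < r (head G e v)" using h that by (auto simp: j_def split: if_splits)
    show "v \<in> D (r v)" if "r v < r (head G e v)" "r v < Suc m"
      using held_back[OF v] h that by (auto split: if_splits)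
    show "j v = Suc (j (head G e v))" if "r v = r (head G e v)"
      using h that by (auto split: if_splits)
  qed (use W_sub in \<open>auto simp: r_def\<close>)
  then have "labelled_tree G D W (Suc m) r j e" using mg Dmono by (simp add: labelled_tree_def)
  then have "labelled_burning G D prec W F m r j e"
    using e(2) sink_burning_axioms by (simp add: labelled_burning_def labelled_burning_axioms_def)
  moreover have "\<eta> \<in> extensional W" using rec by (auto simp: recurrent_def PiE_def)
  then have "\<eta> = restrict (label_height prec G r j e) W"
    using e(3) by (intro extensionalityI[of _ W]) auto
  ultimately show ?thesis by (rule that)
qed

end

context sink_burning begin

lemma burn_tree_inj: "inj_on (burn_tree prec H D m) (recurrent H)"
proof (rule inj_onI)
  fix \<eta> \<eta>' assume rec: "\<eta> \<in> recurrent H" "\<eta>' \<in> recurrent H"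
    and eq: "burn_tree prec H D m \<eta> = burn_tree prec H D m \<eta>'"
  obtain r j e where L: "labelled_burning G D prec W F m r j e" "\<eta> = restrict (label_height prec G r j e) W"
    using recurrent_burning.exists_labelling[of G D prec W F m \<eta>] rec(1) sink_burning_axioms
    by (auto simp: recurrent_burning_def recurrent_burning_axioms_def)
  obtain r' j' e' where L': "labelled_burning G D prec W F m r' j' e'" "\<eta>' = restrict (label_height prec G r' j' e') W"
    using recurrent_burning.exists_labelling[of G D prec W F m \<eta>'] rec(2) sink_burning_axioms
    by (auto simp: recurrent_burning_def recurrent_burning_axioms_def)
  have "e ` W = burn_tree prec H D m \<eta>" "e' ` W = burn_tree prec H D m \<eta>'"
    using labelled_burning.burn_tree_labels[OF L(1), of \<eta>] labelled_burning.burn_tree_labels[OF L'(1), of \<eta>'] L(2) L'(2)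
    by auto
  then have "e ` W = e' ` W" using eq by simp
  moreover have "labelled_tree G D W (Suc m) r j e" "labelled_tree G D W (Suc m) r' j' e'"
    using L(1) L'(1) by (simp_all add: labelled_burning_def)
  ultimately have "label_height prec G r' j' e' v = label_height prec G r j e v" if "v \<in> W" for v
    using labelled_trees_unique(4) that by metis
  then show "\<eta> = \<eta>'" using L(2) L'(2) by (auto simp: restrict_def)
qed

text \<open>Since a tree determines its labels, the heights read off the labels are the value of
  the inverse of the burning map.\<close>

lemma inverse_burn_tree:
  assumes L: "labelled_burning G D prec W F m r j e"
  shows "the_inv_into (recurrent H) (burn_tree prec H D m) (e ` W) = restrict (label_height prec G r j e) W"
proof -
  interpret L: labelled_burning G D prec W F m r j e by (fact L)
  have "burn_tree prec H D m (restrict L.lheight W) = e ` W" by (rule L.burn_tree_labels) simp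
  then show ?thesis using the_inv_into_f_eq[OF burn_tree_inj _ L.height_recurrent] by blast
qed

end

section \<open>Labels of a directed tree\<close>

text \<open>Following the edges towards the sink, staying put once \<open>W\<close> has been left, so that
  iterates keep recording that the sink was reached.\<close>

definition climb :: "('v, 'e) mgraph \<Rightarrow> 'v set \<Rightarrow> ('v \<Rightarrow> 'e) \<Rightarrow> 'v \<Rightarrow> 'v" where
  "climb G W e v = (if v \<in> W then head G e v else v)"

lemma climb_out: "v \<notin> W \<Longrightarrow> (climb G W e ^^ n) v = v"
  by (induction n) (auto simp: climb_def)

lemma climb_Suc: "v \<in> W \<Longrightarrow> (climb G W e ^^ Suc n) v = (climb G W e ^^ n) (head G e v)"
  unfolding funpow_Suc_right o_apply by (simp add: climb_def)

definition tree_phase :: "('v, 'e) mgraph \<Rightarrow> (nat \<Rightarrow> 'v set) \<Rightarrow> 'v set \<Rightarrow> nat \<Rightarrow> ('v \<Rightarrow> 'e) \<Rightarrow> 'v \<Rightarrow> nat" where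
  "tree_phase G D W M e v = (if v \<in> W
     then LEAST k. 0 < k \<and> (k = M \<or> (\<exists>n. (climb G W e ^^ n) v \<in> W \<inter> D k)) else Suc M)"

text \<open>The number of steps along the path until the phase changes.\<close>

definition tree_step :: "('v, 'e) mgraph \<Rightarrow> (nat \<Rightarrow> 'v set) \<Rightarrow> 'v set \<Rightarrow> nat \<Rightarrow> ('v \<Rightarrow> 'e) \<Rightarrow> 'v \<Rightarrow> nat" where
  "tree_step G D W M e v =
     (LEAST n. tree_phase G D W M e ((climb G W e ^^ n) v) \<noteq> tree_phase G D W M e v)"

locale directed_tree =
  fixes G :: "('v, 'e) mgraph" and D :: "nat \<Rightarrow> 'v set" and W :: "'v set" and M :: nat and e :: "'v \<Rightarrow> 'e"
  assumes mg: "multigraph G" and Dmono: "mono D" and D0: "D 0 = {}" and W_sub: "W \<subseteq> verts G" and M: "0 < M"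
    and e_edge: "v \<in> W \<Longrightarrow> e v \<in> edges G" and e_at: "v \<in> W \<Longrightarrow> v \<in> ends G (e v)"
    and leave: "v \<in> W \<Longrightarrow> \<exists>n. (climb G W e ^^ n) v \<notin> W"
begin

abbreviation "q \<equiv> climb G W e"
abbreviation "ph \<equiv> tree_phase G D W M e"
abbreviation "st \<equiv> tree_step G D W M e"

lemma ph_W: "v \<in> W \<Longrightarrow> ph v = (LEAST k. 0 < k \<and> (k = M \<or> (\<exists>n. (q ^^ n) v \<in> W \<inter> D k)))"
  by (simp add: tree_phase_def)

lemma ph_props:
  assumes "v \<in> W"
  shows "0 < ph v" "ph v \<le> M" "ph v = M \<or> (\<exists>n. (q ^^ n) v \<in> W \<inter> D (ph v))"
proof -
  have "0 < ph v \<and> (ph v = M \<or> (\<exists>n. (q ^^ n) v \<in> W \<inter> D (ph v)))"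
    unfolding ph_W[OF assms] by (rule LeastI[of _ M]) (use M in simp)
  then show "0 < ph v" "ph v = M \<or> (\<exists>n. (q ^^ n) v \<in> W \<inter> D (ph v))" by blast+
  show "ph v \<le> M" unfolding ph_W[OF assms] by (rule Least_le) (use M in simp)
qed

lemma ph_least: "v \<in> W \<Longrightarrow> (q ^^ n) v \<in> W \<inter> D k \<Longrightarrow> ph v \<le> k"
proof -
  assume v: "v \<in> W" and n: "(q ^^ n) v \<in> W \<inter> D k"
  then have "0 < k" using D0 by (cases k) auto
  then show "ph v \<le> k" unfolding ph_W[OF v] using n by (intro Least_le) blast
qed

lemma ph_le_iff:
  assumes "v \<in> W" "k < M"
  shows "ph v \<le> k \<longleftrightarrow> (\<exists>n. (q ^^ n) v \<in> W \<inter> D k)"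
proof
  assume "ph v \<le> k"
  moreover from this obtain n where "(q ^^ n) v \<in> W \<inter> D (ph v)" using ph_props(3)[OF assms(1)] assms(2) by auto
  ultimately show "\<exists>n. (q ^^ n) v \<in> W \<inter> D k" using monoD[OF Dmono, of "ph v" k] by blast
qed (use ph_least assms in blast)

lemma ph_out: "v \<notin> W \<Longrightarrow> ph v = Suc M"
  by (simp add: tree_phase_def)

lemma ph_head: "v \<in> W \<Longrightarrow> ph v \<le> ph (head G e v)"
proof (cases "head G e v \<in> W")
  case True
  assume v: "v \<in> W"
  show ?thesis
  proof (cases "ph (head G e v) = M")
    case False
    then obtain n where "(q ^^ n) (head G e v) \<in> W \<inter> D (ph (head G e v))" using ph_props(3)[OF True] by blast
    then show ?thesis using ph_least[OF v, of "Suc n"] climb_Suc[OF v] by metis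
  qed (use ph_props[OF v] in simp)
qed (use ph_props ph_out in fastforce)

lemma ph_less_D: "v \<in> W \<Longrightarrow> ph v < ph (head G e v) \<Longrightarrow> ph v < M \<Longrightarrow> v \<in> D (ph v)"
proof -
  assume v: "v \<in> W" and l: "ph v < ph (head G e v)" "ph v < M"
  then obtain n where n: "(q ^^ n) v \<in> W \<inter> D (ph v)" using ph_props(3)[OF v] by auto
  show ?thesis
  proof (cases n)
    case (Suc n')
    then have n': "(q ^^ n') (head G e v) \<in> W \<inter> D (ph v)" using n climb_Suc[OF v] by metis
    have "head G e v \<in> W"
    proof (rule ccontr)
      assume "head G e v \<notin> W"
      then show False using n' climb_out[where v = "head G e v" and n = n' and G = G and e = e] by simp
    qed
    then show ?thesis using ph_least[OF _ n'] l by simp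
  qed (use n in simp)
qed

lemma st_exists:
  assumes "v \<in> W" shows "\<exists>n. ph ((q ^^ n) v) \<noteq> ph v"
proof -
  obtain n where "(q ^^ n) v \<notin> W" using leave[OF assms] by blast
  then have "ph ((q ^^ n) v) \<noteq> ph v" using ph_out ph_props(2)[OF assms] by fastforce
  then show ?thesis by blast
qed

lemma st_head_less: "v \<in> W \<Longrightarrow> ph v < ph (head G e v) \<Longrightarrow> st v = 1"
proof -
  assume v: "v \<in> W" and l: "ph v < ph (head G e v)"
  show "st v = 1" unfolding tree_step_def
  proof (rule Least_equality)
    show "ph ((q ^^ 1) v) \<noteq> ph v" using l v by (simp add: climb_def)
    fix n assume "ph ((q ^^ n) v) \<noteq> ph v"
    then show "1 \<le> n" by (cases n) auto
  qed
qed

lemma st_head_eq: "v \<in> W \<Longrightarrow> ph v = ph (head G e v) \<Longrightarrow> st v = Suc (st (head G e v))"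
proof -
  assume v: "v \<in> W" and eq: "ph v = ph (head G e v)"
  let ?P = "\<lambda>n. ph ((q ^^ n) v) \<noteq> ph v"
  obtain n where n: "?P n" using st_exists[OF v] by blast
  have "(LEAST n. ?P n) = Suc (LEAST n. ?P (Suc n))" by (rule Least_Suc[of ?P n]) (use n in simp_all)
  then show "st v = Suc (st (head G e v))" unfolding tree_step_def climb_Suc[OF v] eq .
qed

lemma st_pos: "v \<in> W \<Longrightarrow> 0 < st v"
  using st_head_less[of v] st_head_eq[of v] ph_head[of v] by (cases "ph v = ph (head G e v)") auto

lemma not_D_ph: "v \<in> W \<Longrightarrow> v \<notin> D (ph v - 1)"
  using ph_least[of v 0 "ph v - 1"] ph_props(1)[of v] by auto

text \<open>The labels only depend on the path to the sink: \<open>tree_phase\<close> is the least \<open>k\<close> for which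
  the path meets \<open>D k\<close>, capped by \<open>M\<close>, and below the cap it is smaller at \<open>v\<close> than at the head only
  if \<open>v\<close> itself lies in that set.\<close>

lemma labelled: "labelled_tree G D W M ph st e"
proof -
  have "burn_labels G D W M ph st e"
    unfolding burn_labels_def
    using W_sub ph_out e_edge e_at ph_props not_D_ph st_pos ph_head st_head_less ph_less_D st_head_eq
    by blast
  then show ?thesis using mg Dmono by (simp add: labelled_tree_def)
qed

end

section \<open>Spanning trees of a graph with a sink\<close>

text \<open>The height \<open>h\<close> is the distance to the root \<open>s\<close> in the tree.\<close>

lemma spanning_tree_parents:
  assumes H: "multigraph H" and t: "t \<in> spanning_trees H" and s: "s \<in> verts H"
  obtains e and h :: "'a \<Rightarrow> nat" where "t = e ` (verts H - {s})"
    "\<And>x. x \<in> verts H - {s} \<Longrightarrow> \<exists>y. ends H (e x) = {x, y} \<and> h y < h x"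
proof -
  have tE: "t \<subseteq> edges H" and con: "connected_by H t" and ac: "acyclic_edges H t"
    using t by (auto simp: spanning_trees_def)
  define h where "h x = (LEAST n. (x, s) \<in> adj_rel H t ^^ n)" for x
  have "\<exists>f\<in>t. \<exists>y. ends H f = {x, y} \<and> h y < h x" if x: "x \<in> verts H - {s}" for x
  proof -
    have "(x, s) \<in> (adj_rel H t)\<^sup>*" using con x s by (auto simp: connected_by_def)
    then obtain n where "(x, s) \<in> adj_rel H t ^^ n" by (auto simp: rtrancl_power)
    then have hx: "(x, s) \<in> adj_rel H t ^^ h x" unfolding h_def by (rule LeastI)
    moreover have "h x \<noteq> 0"
    proof
      assume "h x = 0"
      then show False using hx x by simp
    qed
    ultimately obtain k where k: "h x = Suc k" "(x, s) \<in> adj_rel H t ^^ Suc k" by (cases "h x") auto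
    then obtain y where y: "(x, y) \<in> adj_rel H t" "(y, s) \<in> adj_rel H t ^^ k" by (meson relpow_Suc_E2)
    have "h y \<le> k" unfolding h_def by (rule Least_le) (rule y(2))
    with y(1) k(1) show ?thesis by (auto simp: adj_rel_def intro!: bexI)
  qed
  then have "\<forall>x\<in>verts H - {s}. \<exists>f. f \<in> t \<and> (\<exists>y. ends H f = {x, y} \<and> h y < h x)" by blast
  then have "\<exists>e. \<forall>x\<in>verts H - {s}. e x \<in> t \<and> (\<exists>y. ends H (e x) = {x, y} \<and> h y < h x)" by (rule bchoice)
  then obtain e where e: "\<And>x. x \<in> verts H - {s} \<Longrightarrow> e x \<in> t"
    "\<And>x. x \<in> verts H - {s} \<Longrightarrow> \<exists>y. ends H (e x) = {x, y} \<and> h y < h x" by blast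
  \<comment> \<open>An edge that is nobody's parent edge would close a cycle: both of its ends are joined
    to the root by parent edges.\<close>
  have "f \<in> e ` (verts H - {s})" if f: "f \<in> t" for f
  proof (rule ccontr)
    assume nf: "f \<notin> e ` (verts H - {s})"
    have conn: "x \<in> comp_of H (t - {f}) s" if "x \<in> verts H" for x
      using that
    proof (induction "h x" arbitrary: x rule: less_induct)
      case less
      show ?case
      proof (cases "x = s")
        case False
        with less have x: "x \<in> verts H - {s}" by simp
        obtain y where y: "ends H (e x) = {x, y}" "h y < h x" using e(2)[OF x] by blast
        have "y \<in> verts H" using multigraphD(1)[OF H, of "e x"] e(1)[OF x] tE y(1) by auto
        then have "y \<in> comp_of H (t - {f}) s" using less y(2) by blast
        moreover have "e x \<in> t - {f}" using e(1)[OF x] nf x by auto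
        then have "(y, x) \<in> adj_rel H (t - {f})" using y(1) by (auto simp: adj_rel_def insert_commute)
        ultimately show ?thesis by (rule comp_of_step)
      qed simp
    qed
    obtain a b where ab: "ends H f = {a, b}" using multigraphD(2)[OF H, of f] f tE by (auto simp: card_2_iff)
    then have "a \<in> verts H" "b \<in> verts H" using multigraphD(1)[OF H, of f] f tE by auto
    then have "b \<in> comp_of H (t - {f}) a" using conn comp_of_sym comp_of_trans by metis
    then show False using acyclic_bridge[OF ac f ab] by simp
  qed
  then have "t = e ` (verts H - {s})" using e(1) by auto
  then show ?thesis using that e(2) by blast
qed

context sink_burning begin

lemma sink_graph_multigraph: "multigraph H"
  unfolding multigraph_def
proof (intro ballI conjI)
  fix f assume "f \<in> edges H"
  then have f: "f \<in> F" "f \<in> edges G" using F_edges by (auto simp: sink_graph_def)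
  show "ends H f \<subseteq> verts H" by (auto simp: sink_graph_def)
  obtain v where v: "v \<in> ends G f" "v \<in> W" using F_touch[OF f(1)] by blast
  obtain w where w: "ends G f = {v, w}" "w \<noteq> v" by (rule other_end_exists[OF mg f(2) v(1)])
  then have "ends H f = {Some v, if w \<in> W then Some w else None}" using v(2) by (simp add: sink_graph_def)
  then show "card (ends H f) = 2" using w(2) by simp
qed

text \<open>Directing a spanning tree towards the sink gives labels.\<close>

lemma labelling_of_spanning_tree:
  assumes t: "t \<in> spanning_trees H"
  obtains r j e where "labelled_burning G D prec W F m r j e" "t = e ` W"
proof -
  have "None \<in> verts H" and vH: "verts H - {None} = Some ` W" by (auto simp: sink_graph_def)
  then obtain e' h where e': "t = e' ` Some ` W"
    "\<And>x. x \<in> Some ` W \<Longrightarrow> \<exists>y. ends H (e' x) = {x, y} \<and> (h y :: nat) < h x"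
    using spanning_tree_parents[OF sink_graph_multigraph t \<open>None \<in> verts H\<close>] by metis
  define e where "e v = e' (Some v)" for v
  have te: "t = e ` W" using e'(1) by (auto simp: e_def)
  have eF: "e v \<in> F" if "v \<in> W" for v
    using t te that by (auto simp: spanning_trees_def sink_graph_def)
  have e: "e v \<in> edges G \<and> v \<in> ends G (e v) \<and> (head G e v \<in> W \<longrightarrow> h (Some (head G e v)) < h (Some v))"
    if v: "v \<in> W" for v
  proof -
    obtain y where y: "ends H (e v) = {Some v, y}" "h y < h (Some v)" using e'(2)[of "Some v"] v by (auto simp: e_def)
    have "e v \<in> edges_into H (Some v) {y}" using eF[OF v] y(1) by (simp add: edges_into_def sink_graph_def)
    then obtain w where w: "ends G (e v) = {v, w}" "(if w \<in> W then Some w else None) = y" "e v \<in> edges G"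
      unfolding edges_into_H[OF v] by (auto simp: edges_into_def)
    then have "head G e v = w" by (intro head_eqI)
    then show ?thesis using w y(2) by auto
  qed
  have leave: "\<exists>n. (climb G W e ^^ n) v \<notin> W" if "v \<in> W" for v
    using that
  proof (induction "h (Some v)" arbitrary: v rule: less_induct)
    case less
    show ?case
    proof (cases "head G e v \<in> W")
      case True
      then obtain n where "(climb G W e ^^ n) (head G e v) \<notin> W" using less e by blast
      then show ?thesis using climb_Suc[OF less(2)] by metis
    next
      case False
      then have "(climb G W e ^^ 1) v \<notin> W" using less(2) by (simp add: climb_def)
      then show ?thesis by blast
    qed
  qed
  interpret T: directed_tree G D W "Suc m" e
    by unfold_locales (use mg Dmono D0 W_sub e leave in auto)
  have "labelled_burning G D prec W F m T.ph T.st e"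
    using T.labelled sink_burning_axioms eF by (simp add: labelled_burning_def labelled_burning_axioms_def)
  with te show ?thesis by (rule that[rotated])
qed

end

context labelled_burning begin

abbreviation "to_sink w \<equiv> (if w \<in> W then Some w else None)"

lemma ends_H: "v \<in> W \<Longrightarrow> ends H (e v) = {Some v, to_sink (p v)}"
  using ends_e[of v] by (simp add: sink_graph_def)

lemma climb_earlier:
  assumes "w \<in> W" "(climb G W e ^^ n) w = v" "v \<in> W"
  shows "v = w \<or> r w < r v \<or> r w = r v \<and> j v < j w"
  using assms(1,2)
proof (induction n arbitrary: w)
  case (Suc n)
  then have n: "(climb G W e ^^ n) (p w) = v" using climb_Suc by metis
  then have "p w \<in> W" using climb_out assms(3) by metis
  then show ?case using Suc.IH[OF _ n] head_earlier[OF Suc.prems(1)] by auto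
qed simp

text \<open>Heads burn earlier, so every vertex is connected to the sink.  The edge \<open>e v\<close> is a bridge because no
  other edge leaves the set of descendants of \<open>v\<close>.\<close>

lemma spanning_tree: "e ` W \<in> spanning_trees H"
  unfolding spanning_trees_def mem_Collect_eq
proof (intro conjI)
  show "e ` W \<subseteq> edges H" using eF by (auto simp: sink_graph_def)
  have "(Some v) \<in> comp_of H (e ` W) None" if "v \<in> W" for v
    using that
  proof (induction "(Suc m - r v, j v)" arbitrary: v rule: wf_induct_rule[OF wf_lex_prod[OF wf_less_than wf_less_than]])
    case (1 v)
    have "(to_sink (p v), Some v) \<in> adj_rel H (e ` W)"
      using ends_H[OF 1(2)] 1(2) by (intro adj_relI[of "e v"]) (auto simp: insert_commute)
    moreover have "to_sink (p v) \<in> comp_of H (e ` W) None"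
    proof (cases "p v \<in> W")
      case True
      then have "((Suc m - r (p v), j (p v)), (Suc m - r v, j v)) \<in> less_than <*lex*> less_than"
        using head_earlier[OF 1(2)] r_le[of "p v"] by auto
      then show ?thesis using 1(1) True by force
    qed simp
    ultimately show ?case by (rule comp_of_step[rotated])
  qed
  then have "x \<in> comp_of H (e ` W) None" if "x \<in> verts H" for x
    using that by (auto simp: sink_graph_def)
  then have "y \<in> comp_of H (e ` W) x" if "x \<in> verts H" "y \<in> verts H" for x y
    using that comp_of_sym comp_of_trans by metis
  then show "connected_by H (e ` W)" by (auto simp: connected_by_def comp_of_def)
  show "acyclic_edges H (e ` W)"
  proof (rule acyclic_if_bridges)
    fix f x y assume f: "f \<in> e ` W" and xy: "ends H f = {x, y}"
    obtain v where v: "v \<in> W" "f = e v" using f by blast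
    define S where "S = {w \<in> W. \<exists>n. (climb G W e ^^ n) w = v}"
    have "v \<in> S" using v by (auto simp: S_def intro: exI[of _ 0])
    have out: "to_sink (p v) \<notin> Some ` S"
    proof
      assume "to_sink (p v) \<in> Some ` S"
      then have "p v \<in> S" by (auto simp: S_def split: if_splits)
      then obtain n where "p v \<in> W" "(climb G W e ^^ n) (p v) = v" by (auto simp: S_def)
      then show False using climb_earlier[OF _ _ v(1)] head_earlier[OF v(1)] by fastforce
    qed
    have closed: "to_sink (p u) \<in> Some ` S \<longleftrightarrow> Some u \<in> Some ` S" if u: "u \<in> W" "u \<noteq> v" for u
    proof
      assume "to_sink (p u) \<in> Some ` S"
      then have "p u \<in> S" by (auto simp: S_def split: if_splits)
      then obtain n where "(climb G W e ^^ n) (p u) = v" by (auto simp: S_def)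
      then have "(climb G W e ^^ Suc n) u = v" using climb_Suc[OF u(1)] by metis
      then have "u \<in> S" unfolding S_def using u(1) by blast
      then show "Some u \<in> Some ` S" by (rule imageI)
    next
      assume "Some u \<in> Some ` S"
      then obtain n where n: "(climb G W e ^^ n) u = v" by (auto simp: S_def)
      then obtain n' where "n = Suc n'" using u(2) by (cases n) auto
      then have n': "(climb G W e ^^ n') (p u) = v" using climb_Suc[OF u(1)] n by metis
      then have "p u \<in> W" using climb_out v(1) by metis
      moreover from this n' have "p u \<in> S" unfolding S_def by blast
      ultimately show "to_sink (p u) \<in> Some ` S" by simp
    qed
    have sub: "comp_of H (e ` W - {f}) (Some v) \<subseteq> Some ` S"
    proof (rule comp_of_subset)
      fix a b assume a: "a \<in> Some ` S" and ab: "(a, b) \<in> adj_rel H (e ` W - {f})"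
      then obtain u where u: "u \<in> W" "e u \<noteq> e v" "ends H (e u) = {a, b}" by (auto simp: adj_rel_def v(2))
      then have "u \<noteq> v" by auto
      have "a = Some u \<and> b = to_sink (p u) \<or> b = Some u \<and> a = to_sink (p u)"
        using u(3) unfolding ends_H[OF u(1)] doubleton_eq_iff by blast
      then show "b \<in> Some ` S" using closed[OF u(1) \<open>u \<noteq> v\<close>] a by metis
    qed (use \<open>v \<in> S\<close> in blast)
    have "x = Some v \<and> y = to_sink (p v) \<or> y = Some v \<and> x = to_sink (p v)"
      using xy unfolding v(2) ends_H[OF v(1)] doubleton_eq_iff by blast
    moreover have "to_sink (p v) \<notin> comp_of H (e ` W - {f}) (Some v)" using sub out by blast
    moreover from this have "Some v \<notin> comp_of H (e ` W - {f}) (to_sink (p v))"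
      using comp_of_sym[of "Some v" H "e ` W - {f}" "to_sink (p v)"] by blast
    ultimately show "y \<notin> comp_of H (e ` W - {f}) x" by (elim disjE conjE) simp_all
  qed
qed

end

theorem (in sink_burning) burn_tree_bij: "bij_betw (burn_tree prec H D m) (recurrent H) (spanning_trees H)"
  unfolding bij_betw_def
proof (intro conjI equalityI subsetI)
  show "inj_on (burn_tree prec H D m) (recurrent H)" by (rule burn_tree_inj)
next
  fix t assume "t \<in> burn_tree prec H D m ` recurrent H"
  then obtain \<eta> where \<eta>: "\<eta> \<in> recurrent H" "t = burn_tree prec H D m \<eta>" by blast
  obtain r j e where L: "labelled_burning G D prec W F m r j e" "\<eta> = restrict (label_height prec G r j e) W"
    using recurrent_burning.exists_labelling[of G D prec W F m \<eta>] \<eta>(1) sink_burning_axioms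
    by (auto simp: recurrent_burning_def recurrent_burning_axioms_def)
  then show "t \<in> spanning_trees H"
    using labelled_burning.burn_tree_labels[OF L(1), of \<eta>] labelled_burning.spanning_tree[OF L(1)] \<eta>(2) by simp
next
  fix t assume "t \<in> spanning_trees H"
  then obtain r j e where L: "labelled_burning G D prec W F m r j e" "t = e ` W"
    by (rule labelling_of_spanning_tree)
  then show "t \<in> burn_tree prec H D m ` recurrent H"
    using labelled_burning.burn_tree_labels[OF L(1), of "restrict (label_height prec G r j e) W"]
      labelled_burning.height_recurrent[OF L(1)] by (auto simp: image_iff)
qed

section \<open>One-ended forests\<close>

text \<open>
  An edge of a one-ended forest is directed away from its finite side.  Unlike the definition by
  rays, the resulting description of one-ended forests involves only finiteness of components.
\<close>

definition out_edge :: "('v, 'e) mgraph \<Rightarrow> 'e set \<Rightarrow> 'v \<Rightarrow> 'e" where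
  "out_edge G t v = (THE e. e \<in> t \<and> v \<in> ends G e \<and> finite (comp_of G (t - {e}) v))"

locale directed_forest =
  fixes G :: "('v, 'e) mgraph" and t :: "'e set"
  assumes mg: "multigraph G" and lf: "locally_finite G" and t_edges: "t \<subseteq> edges G"
    and acyclic: "acyclic_edges G t"
    and inf_comp: "v \<in> verts G \<Longrightarrow> infinite (comp_of G t v)"
    and finite_side: "e \<in> t \<Longrightarrow> \<exists>v\<in>ends G e. finite (comp_of G (t - {e}) v)"

lemma comp_of_delete_edge:
  assumes "ends G e = {x, y}"
  shows "comp_of G t x \<subseteq> comp_of G (t - {e}) x \<union> comp_of G (t - {e}) y"
proof (rule comp_of_subset)
  fix a b assume a: "a \<in> comp_of G (t - {e}) x \<union> comp_of G (t - {e}) y" and ab: "(a, b) \<in> adj_rel G t"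
  obtain f where f: "f \<in> t" "ends G f = {a, b}" using ab by (auto simp: adj_rel_def)
  show "b \<in> comp_of G (t - {e}) x \<union> comp_of G (t - {e}) y"
  proof (cases "f = e")
    case True
    then have "b = x \<or> b = y" using f(2) assms by auto
    then show ?thesis by auto
  next
    case False
    then have "(a, b) \<in> adj_rel G (t - {e})" using f by (auto simp: adj_rel_def)
    then show ?thesis using a comp_of_step[of a G "t - {e}" _ b] by blast
  qed
qed simp

context directed_forest begin

lemma edge_ends:
  assumes "e \<in> t" "v \<in> ends G e"
  obtains w where "ends G e = {v, w}" "w \<noteq> v" "w \<in> verts G" "v \<in> verts G"
  using other_end_exists[OF mg _ assms(2)] assms(1) t_edges by blast

lemma bridge: "e \<in> t \<Longrightarrow> ends G e = {x, y} \<Longrightarrow> y \<notin> comp_of G (t - {e}) x"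
  by (rule acyclic_bridge[OF acyclic])

lemma one_finite_side:
  assumes e: "e \<in> t" "ends G e = {x, y}"
  shows "finite (comp_of G (t - {e}) x) \<longleftrightarrow> infinite (comp_of G (t - {e}) y)"
proof
  have "x \<in> verts G" using multigraphD(1)[OF mg, of e] e t_edges by auto
  then have "infinite (comp_of G (t - {e}) x \<union> comp_of G (t - {e}) y)"
    using inf_comp comp_of_delete_edge[OF e(2)] finite_subset by metis
  then show "finite (comp_of G (t - {e}) x) \<Longrightarrow> infinite (comp_of G (t - {e}) y)" by simp
  show "infinite (comp_of G (t - {e}) y) \<Longrightarrow> finite (comp_of G (t - {e}) x)"
    using finite_side[OF e(1)] e(2) by auto
qed

text \<open>If \<open>e\<close> and \<open>f\<close> both had their finite side at \<open>v\<close>, the component of \<open>v\<close>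
  would be the union of these two sides.\<close>

lemma out_edge_unique:
  assumes e: "e \<in> t" "v \<in> ends G e" "finite (comp_of G (t - {e}) v)"
    and f: "f \<in> t" "v \<in> ends G f" "finite (comp_of G (t - {f}) v)"
  shows "e = f"
proof (rule ccontr)
  assume ne: "e \<noteq> f"
  obtain y where y: "ends G e = {v, y}" "y \<noteq> v" "v \<in> verts G" by (rule edge_ends[OF e(1,2)])
  have "v \<notin> comp_of G (t - {e}) y"
    using bridge[OF e(1), of y v] y(1) by (simp add: insert_commute)
  have "comp_of G (t - {e}) y \<subseteq> comp_of G (t - {f}) v \<inter> comp_of G (t - {e}) y"
  proof (rule comp_of_subset)
    show "y \<in> comp_of G (t - {f}) v \<inter> comp_of G (t - {e}) y"
      using comp_of_step[of v G "t - {f}" v y] adj_relI[of e "t - {f}" G v y] e(1) ne y(1) by simp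
    fix a b assume a: "a \<in> comp_of G (t - {f}) v \<inter> comp_of G (t - {e}) y"
      and ab: "(a, b) \<in> adj_rel G (t - {e})"
    have b: "b \<in> comp_of G (t - {e}) y" using comp_of_step[OF _ ab] a by blast
    obtain g where g: "g \<in> t - {e}" "ends G g = {a, b}" using ab by (auto simp: adj_rel_def)
    have "g \<noteq> f"
      using g(2) f(2) a b \<open>v \<notin> comp_of G (t - {e}) y\<close> by auto
    then have "(a, b) \<in> adj_rel G (t - {f})" using g by (auto intro: adj_relI)
    then show "b \<in> comp_of G (t - {f}) v \<inter> comp_of G (t - {e}) y" using a b comp_of_step[of a G "t - {f}" v b] by blast
  qed
  then have "finite (comp_of G (t - {e}) y)" using f(3) finite_subset by blast
  then show False using one_finite_side[OF e(1) y(1)] e(3) by simp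
qed

text \<open>Otherwise the component of \<open>v\<close> would consist of \<open>v\<close> and the finite far sides of the
  finitely many edges at \<open>v\<close>.\<close>

lemma out_edge_exists:
  assumes v: "v \<in> verts G"
  shows "\<exists>e. e \<in> t \<and> v \<in> ends G e \<and> finite (comp_of G (t - {e}) v)"
proof (rule ccontr)
  assume none: "\<nexists>e. e \<in> t \<and> v \<in> ends G e \<and> finite (comp_of G (t - {e}) v)"
  let ?I = "t \<inter> incident G v"
  let ?Z = "insert v (\<Union>e\<in>?I. \<Union>y\<in>ends G e - {v}. comp_of G (t - {e}) y)"
  have "finite (\<Union>y\<in>ends G e - {v}. comp_of G (t - {e}) y)" if e: "e \<in> ?I" for e
  proof -
    obtain y where y: "ends G e = {v, y}" "y \<noteq> v"
      using edge_ends[of e v] e by (auto simp: incident_def)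
    moreover have "infinite (comp_of G (t - {e}) v)" using none e by (auto simp: incident_def)
    ultimately have "finite (comp_of G (t - {e}) y)" using one_finite_side[of e v y] e by simp
    then show ?thesis using y by auto
  qed
  moreover have "finite ?I" using lf v by (auto simp: locally_finite_def)
  ultimately have "finite ?Z" by simp
  moreover have "comp_of G t v \<subseteq> ?Z"
  proof (rule comp_of_subset)
    fix a b assume a: "a \<in> ?Z" and ab: "(a, b) \<in> adj_rel G t"
    obtain g where g: "g \<in> t" "ends G g = {a, b}" using ab by (auto simp: adj_rel_def)
    show "b \<in> ?Z"
    proof (cases "b = v \<or> a = v")
      case True
      moreover have "b \<in> ?Z" if "a = v" "b \<noteq> v"
        using g t_edges that by (auto simp: incident_def intro!: bexI[of _ g])
      ultimately show ?thesis by auto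
    next
      case False
      then obtain e y where ey: "e \<in> ?I" "y \<in> ends G e - {v}" "a \<in> comp_of G (t - {e}) y" using a by blast
      have "g \<noteq> e" using g(2) False ey(1) by (auto simp: incident_def)
      then have "b \<in> comp_of G (t - {e}) y"
        using comp_of_step[OF ey(3) adj_relI[of g]] g by simp
      then show ?thesis using ey by blast
    qed
  qed simp
  ultimately show False using inf_comp[OF v] finite_subset by blast
qed

abbreviation "E \<equiv> out_edge G t"
abbreviation "P \<equiv> head G E"

lemma
  assumes "v \<in> verts G"
  shows E_t: "E v \<in> t" and E_at: "v \<in> ends G (E v)" and E_fin: "finite (comp_of G (t - {E v}) v)"
proof -
  have "\<exists>!e. e \<in> t \<and> v \<in> ends G e \<and> finite (comp_of G (t - {e}) v)"
    using out_edge_exists[OF assms] out_edge_unique by (intro ex_ex1I) auto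
  from theI'[OF this] show "E v \<in> t" "v \<in> ends G (E v)" "finite (comp_of G (t - {E v}) v)"
    unfolding out_edge_def by auto
qed

lemma E_eqI: "e \<in> t \<Longrightarrow> v \<in> ends G e \<Longrightarrow> finite (comp_of G (t - {e}) v) \<Longrightarrow> E v = e"
  using out_edge_unique[of "E v" v e] E_t E_at E_fin edge_ends[of e v] by metis

lemma ends_E: "v \<in> verts G \<Longrightarrow> ends G (E v) = {v, P v}"
  using ends_head(1)[OF mg, of E v] E_t E_at t_edges by blast

lemma P_verts: "v \<in> verts G \<Longrightarrow> P v \<in> verts G"
  using ends_head(3)[OF mg, of E v] E_t E_at t_edges by blast

lemma P_pow_verts: "v \<in> verts G \<Longrightarrow> (P ^^ n) v \<in> verts G"
  by (induction n) (auto simp: P_verts)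

lemma t_eq: "t = E ` verts G"
proof (intro equalityI subsetI)
  fix e assume e: "e \<in> t"
  then obtain v where v: "v \<in> ends G e" "finite (comp_of G (t - {e}) v)" using finite_side by blast
  moreover have "v \<in> verts G" using edge_ends[OF e v(1)] by blast
  ultimately show "e \<in> E ` verts G" using E_eqI[OF e v] by force
qed (use E_t in auto)

lemma E_inj: "inj_on E (verts G)"
proof (rule inj_onI, rule ccontr)
  fix v w assume vw: "v \<in> verts G" "w \<in> verts G" "E v = E w" "v \<noteq> w"
  then have "ends G (E v) = {v, w}" using ends_E[of v] E_at[of w] by auto
  then show False using one_finite_side[OF E_t[OF vw(1)]] E_fin[of v] E_fin[of w] vw by metis
qed

lemma edge_cases:
  assumes "f \<in> t" "ends G f = {a, b}"
  shows "a \<in> verts G \<and> f = E a \<and> P a = b \<or> b \<in> verts G \<and> f = E b \<and> P b = a"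
proof -
  obtain u where u: "u \<in> verts G" "f = E u" using assms(1) t_eq by blast
  then show ?thesis using ends_E[OF u(1)] assms(2) by (auto simp: doubleton_eq_iff)
qed

text \<open>This bounds the number of descendants and keeps iterates of \<open>P\<close> from returning to their
  starting point.\<close>

lemma finite_side_iff:
  assumes v: "v \<in> verts G"
  shows "w \<in> comp_of G (t - {E v}) v \<longleftrightarrow> w \<in> verts G \<and> (\<exists>n. (P ^^ n) w = v)"
proof
  have "comp_of G (t - {E v}) v \<subseteq> {w \<in> verts G. \<exists>n. (P ^^ n) w = v}"
  proof (rule comp_of_subset)
    show "v \<in> {w \<in> verts G. \<exists>n. (P ^^ n) w = v}" using v by (auto intro: exI[of _ 0])
    fix a b assume a: "a \<in> {w \<in> verts G. \<exists>n. (P ^^ n) w = v}" and ab: "(a, b) \<in> adj_rel G (t - {E v})"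
    obtain f where f: "f \<in> t - {E v}" "ends G f = {a, b}" using ab by (auto simp: adj_rel_def)
    from a obtain n where n: "(P ^^ n) a = v" by blast
    consider "a \<in> verts G" "f = E a" "P a = b" | "b \<in> verts G" "f = E b" "P b = a"
      using edge_cases[of f a b] f by auto
    then show "b \<in> {w \<in> verts G. \<exists>n. (P ^^ n) w = v}"
    proof cases
      case 1
      then have "n \<noteq> 0" using f(1) n by (auto intro: ccontr)
      then obtain n' where "n = Suc n'" by (cases n) auto
      then have "(P ^^ n') b = v" using n 1(3) by (simp add: funpow_swap1)
      then show ?thesis using P_verts[OF 1(1)] 1(3) by auto
    next
      case 2
      then have "(P ^^ Suc n) b = v" using n by (simp add: funpow_swap1)
      then show ?thesis using 2 by blast
    qed
  qed
  then show "w \<in> comp_of G (t - {E v}) v \<Longrightarrow> w \<in> verts G \<and> (\<exists>n. (P ^^ n) w = v)" by blast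
  assume "w \<in> verts G \<and> (\<exists>n. (P ^^ n) w = v)"
  then obtain n where "w \<in> verts G" "(P ^^ n) w = v" by blast
  then show "w \<in> comp_of G (t - {E v}) v"
  proof (induction n arbitrary: w)
    case (Suc n)
    show ?case
    proof (cases "w = v")
      case False
      have "(P ^^ n) (P w) = v" using Suc.prems(2) by (simp add: funpow_swap1)
      then have "P w \<in> comp_of G (t - {E v}) v" using Suc P_verts by blast
      moreover have "E w \<in> t - {E v}"
        using E_t[OF Suc.prems(1)] E_inj v Suc.prems(1) False by (auto dest: inj_onD)
      then have "(P w, w) \<in> adj_rel G (t - {E v})"
        using ends_E[OF Suc.prems(1)] by (intro adj_relI) (auto simp: insert_commute)
      ultimately show ?thesis by (rule comp_of_step)
    qed simp
  qed simp
qed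

lemma P_pow_neq: "v \<in> verts G \<Longrightarrow> (P ^^ Suc n) v \<noteq> v"
proof
  assume v: "v \<in> verts G" and "(P ^^ Suc n) v = v"
  then have "(P ^^ n) (P v) = v" by (simp add: funpow_swap1)
  then have "P v \<in> comp_of G (t - {E v}) v" using finite_side_iff[OF v] P_verts[OF v] by blast
  then show False using bridge[OF E_t[OF v] ends_E[OF v]] by simp
qed

lemma P_pow_inj: "v \<in> verts G \<Longrightarrow> inj (\<lambda>n. (P ^^ n) v)"
proof (rule linorder_injI)
  fix i k :: nat assume v: "v \<in> verts G" and "i < k"
  then obtain d where d: "k = Suc d + i" using less_iff_Suc_add[of i k] by (auto simp: add.commute)
  then show "(P ^^ i) v \<noteq> (P ^^ k) v"
    using P_pow_neq[OF P_pow_verts[OF v], of d i] by (simp add: funpow_add)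
qed

lemma P_adj: "v \<in> verts G \<Longrightarrow> (v, P v) \<in> adj_rel G t"
  using E_t ends_E by (blast intro: adj_relI)

lemma P_ray: "v \<in> verts G \<Longrightarrow> is_ray G t (\<lambda>n. (P ^^ n) v)"
  using P_pow_inj P_pow_verts P_adj by (auto simp: is_ray_def)

lemma ray_first_step:
  assumes q: "is_ray G t q"
  shows "q (Suc 0) = P (q 0)"
proof (rule ccontr)
  assume c: "q (Suc 0) \<noteq> P (q 0)"
  have qv: "q n \<in> verts G" for n using q by (auto simp: is_ray_def)
  have qs: "(q n, q (Suc n)) \<in> adj_rel G t" and qi: "inj q" for n using q by (auto simp: is_ray_def)
  obtain f where ft: "f \<in> t" "ends G f = {q 0, q (Suc 0)}" using qs[of 0] by (auto simp: adj_rel_def)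
  then have f: "E (q (Suc 0)) = f" "ends G f = {q 0, q (Suc 0)}" using edge_cases[OF ft] c by auto
  \<comment> \<open>If the ray starts against the direction it is caught in a finite side.\<close>
  have "q (Suc n) \<in> comp_of G (t - {f}) (q (Suc 0))" for n
  proof (induction n)
    case (Suc n)
    obtain g where g: "g \<in> t" "ends G g = {q (Suc n), q (Suc (Suc n))}" using qs by (auto simp: adj_rel_def)
    have "q 0 \<noteq> q (Suc n)" "q 0 \<noteq> q (Suc (Suc n))" using qi by (auto dest: injD)
    then have "g \<noteq> f" using g(2) f(2) by auto
    then show ?case using comp_of_step[OF Suc adj_relI[of g]] g by simp
  qed simp
  then have "range (\<lambda>n. q (Suc n)) \<subseteq> comp_of G (t - {f}) (q (Suc 0))" by blast
  then have "finite (range (\<lambda>n. q (Suc n)))" using E_fin[OF qv] f(1) finite_subset by metis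
  moreover have "inj (\<lambda>n. q (Suc n))" using qi by (auto simp: inj_def)
  ultimately show False using finite_imageD by blast
qed

lemma ray_unique:
  assumes q: "is_ray G t q"
  shows "q n = (P ^^ n) (q 0)"
proof (induction n)
  case (Suc n)
  have "inj (\<lambda>k. q (k + n))"
  proof (rule injI)
    fix x y assume "q (x + n) = q (y + n)"
    moreover have "inj q" using q by (simp add: is_ray_def)
    ultimately show "x = y" using injD by fastforce
  qed
  then have "is_ray G t (\<lambda>k. q (k + n))"
    using q by (auto simp: is_ray_def)
  from ray_first_step[OF this] show ?case using Suc by simp
qed simp

lemma ray_from_eq: "v \<in> verts G \<Longrightarrow> ray_from G t v = (\<lambda>n. (P ^^ n) v)"
  unfolding ray_from_def
proof (rule the_equality)
  assume v: "v \<in> verts G"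
  then show "is_ray G t (\<lambda>n. (P ^^ n) v) \<and> (P ^^ 0) v = v" using P_ray by simp
  fix p assume p: "is_ray G t p \<and> p 0 = v"
  show "p = (\<lambda>n. (P ^^ n) v)"
  proof
    fix n
    show "p n = (P ^^ n) v" using ray_unique[of p n] p by simp
  qed
qed

lemma desc_eq: "desc G t X = {v \<in> verts G. \<exists>n. (P ^^ n) v \<in> X}"
proof -
  have "range (\<lambda>n. (P ^^ n) v) \<inter> X \<noteq> {} \<longleftrightarrow> (\<exists>n. (P ^^ n) v \<in> X)" for v by blast
  then show ?thesis
    unfolding desc_def by (intro Collect_cong conj_cong refl) (simp only: ray_from_eq)
qed

lemma finite_desc: "finite X \<Longrightarrow> X \<subseteq> verts G \<Longrightarrow> finite (desc G t X)"
proof -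
  assume X: "finite X" "X \<subseteq> verts G"
  have "desc G t X \<subseteq> (\<Union>u\<in>X. comp_of G (t - {E u}) u)"
  proof
    fix v assume "v \<in> desc G t X"
    then obtain n where n: "v \<in> verts G" "(P ^^ n) v \<in> X" by (auto simp: desc_eq)
    then have "v \<in> comp_of G (t - {E ((P ^^ n) v)}) ((P ^^ n) v)"
      using X(2) by (subst finite_side_iff) auto
    then show "v \<in> (\<Union>u\<in>X. comp_of G (t - {E u}) u)" using n(2) by blast
  qed
  moreover have "finite (\<Union>u\<in>X. comp_of G (t - {E u}) u)" using X E_fin by blast
  ultimately show ?thesis by (rule finite_subset)
qed

text \<open>Every ray follows \<open>P\<close>, and neighbours differ by one step of \<open>P\<close>, so two rays in one component meet;
  from then on they coincide.\<close>

lemma one_ended: "v \<in> verts G \<Longrightarrow> one_ended G t (comp_of G t v)"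
proof -
  assume v: "v \<in> verts G"
  have meet: "\<exists>i k. (P ^^ i) v = (P ^^ k) w" if "(v, w) \<in> (adj_rel G t)\<^sup>*" for w
    using that
  proof (induction rule: rtrancl_induct)
    case base
    then show ?case by blast
  next
    case (step w u)
    obtain i k where ik: "(P ^^ i) v = (P ^^ k) w" using step.IH by blast
    obtain f where "f \<in> t" "ends G f = {w, u}" using step.hyps by (auto simp: adj_rel_def)
    then consider "P w = u" | "P u = w" using edge_cases by blast
    then show ?case
    proof cases
      case 1
      have "(P ^^ Suc i) v = (P ^^ k) u" using ik 1 by (simp add: funpow_swap1)
      then show ?thesis by blast
    next
      case 2
      have "(P ^^ i) v = (P ^^ Suc k) u" using ik 2 by (simp add: funpow_swap1)
      then show ?thesis by blast
    qed
  qed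
  have fin: "finite (range q - range p)"
    if p: "is_ray G t p" "range p \<subseteq> comp_of G t v" and q: "is_ray G t q" "range q \<subseteq> comp_of G t v" for p q
  proof -
    have "p 0 \<in> comp_of G t v" "q 0 \<in> comp_of G t v" using p q by auto
    then obtain i k i' k' where "(P ^^ i) v = (P ^^ k) (p 0)" "(P ^^ i') v = (P ^^ k') (q 0)"
      using meet unfolding comp_of_def by blast
    note eq = this
    have "(P ^^ (i' + k)) (p 0) = (P ^^ i') ((P ^^ i) v)" by (simp add: funpow_add eq(1))
    also have "\<dots> = (P ^^ i) ((P ^^ i') v)" by (simp add: add.commute flip: funpow_add[THEN fun_cong, unfolded o_apply])
    also have "\<dots> = (P ^^ (i + k')) (q 0)" by (simp add: funpow_add eq(2))
    finally have "(P ^^ (n + (i' + k))) (p 0) = (P ^^ (n + (i + k'))) (q 0)" for n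
      by (simp only: funpow_add o_apply)
    then have pq: "p (n + (i' + k)) = q (n + (i + k'))" for n
      using ray_unique[OF p(1), of "n + (i' + k)"] ray_unique[OF q(1), of "n + (i + k')"] by simp
    have "range q - range p \<subseteq> q ` {..<i + k'}"
    proof
      fix x assume x: "x \<in> range q - range p"
      then obtain m where m: "x = q m" by blast
      have "m < i + k'"
      proof (rule ccontr)
        assume "\<not> m < i + k'"
        then have "m = (m - (i + k')) + (i + k')" by simp
        then have "x \<in> range p" using m pq[of "m - (i + k')"] by (metis rangeI)
        then show False using x by simp
      qed
      then show "x \<in> q ` {..<i + k'}" using m by simp
    qed
    then show ?thesis using finite_subset by blast
  qed
  then show ?thesis by (auto simp: one_ended_def)
qed

end

text \<open>If both sides of an edge were infinite, Koenig's lemma would give two disjoint rays in one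
  component.\<close>

lemma one_end_forests_iff:
  assumes mg: "multigraph G" and lf: "locally_finite G"
  shows "t \<in> one_end_forests G \<longleftrightarrow> directed_forest G t"
proof
  assume "directed_forest G t"
  then interpret directed_forest G t .
  show "t \<in> one_end_forests G"
    using t_edges acyclic inf_comp one_ended by (auto simp: one_end_forests_def)
next
  assume "t \<in> one_end_forests G"
  then have t: "t \<subseteq> edges G" "acyclic_edges G t" "\<And>v. v \<in> verts G \<Longrightarrow> infinite (comp_of G t v)"
    "\<And>v. v \<in> verts G \<Longrightarrow> one_ended G t (comp_of G t v)"
    by (auto simp: one_end_forests_def)
  have "\<exists>v\<in>ends G e. finite (comp_of G (t - {e}) v)" if e: "e \<in> t" for e
  proof (rule ccontr)
    assume c: "\<not> (\<exists>v\<in>ends G e. finite (comp_of G (t - {e}) v))"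
    have eG: "e \<in> edges G" using e t by blast
    obtain x y where xy: "ends G e = {x, y}" "x \<in> verts G" "y \<in> verts G"
      using multigraphD[OF mg eG] by (auto simp: card_2_iff)
    have te: "t - {e} \<subseteq> edges G" using t by blast
    obtain p where p: "is_ray G (t - {e}) p" "p 0 = x"
      using koenig_ray[OF mg lf te xy(2)] c xy(1) by auto
    obtain q where q: "is_ray G (t - {e}) q" "q 0 = y"
      using koenig_ray[OF mg lf te xy(3)] c xy(1) by auto
    have pr: "range p \<subseteq> comp_of G (t - {e}) x" and qr: "range q \<subseteq> comp_of G (t - {e}) y"
      using ray_in_comp p q by metis+
    have disj: "comp_of G (t - {e}) x \<inter> comp_of G (t - {e}) y = {}"
    proof (rule ccontr)
      assume "comp_of G (t - {e}) x \<inter> comp_of G (t - {e}) y \<noteq> {}"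
      then obtain z where z: "z \<in> comp_of G (t - {e}) x" "z \<in> comp_of G (t - {e}) y" by blast
      have "y \<in> comp_of G (t - {e}) x" by (rule comp_of_trans[OF z(1) comp_of_sym[OF z(2)]])
      then show False using acyclic_bridge[OF t(2) e xy(1)] by simp
    qed
    have sub: "comp_of G (t - {e}) z \<subseteq> comp_of G t z" for z by (rule comp_of_mono) auto
    have "y \<in> comp_of G t x" using comp_of_step[OF comp_of_refl adj_relI[OF e xy(1)]] .
    then have "comp_of G t y = comp_of G t x" by (rule comp_of_eq)
    then have "range p \<subseteq> comp_of G t x" "range q \<subseteq> comp_of G t x" using pr qr sub[of x] sub[of y] by auto
    moreover have "is_ray G t p" "is_ray G t q" using p q by (auto intro: ray_mono)
    ultimately have "finite ((range p - range q) \<union> (range q - range p))"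
      using t(4)[OF xy(2)] unfolding one_ended_def by blast
    moreover have "range p - range q = range p" using pr qr disj by blast
    ultimately have "finite (range p)" by simp
    then show False using p(1) finite_imageD by (auto simp: is_ray_def)
  qed
  then show "directed_forest G t"
    unfolding directed_forest_def using mg lf t by blast
qed

section \<open>The sandpile of a forest\<close>

locale anchored =
  fixes G :: "('v, 'e) mgraph" and D :: "nat \<Rightarrow> 'v set" and prec :: "'v \<Rightarrow> 'e rel"
  assumes mg: "multigraph G" and lf: "locally_finite G" and anchor: "anchor G D"
    and prec: "\<forall>v\<in>verts G. strict_linear_order_on (incident G v) (prec v)"
begin

lemma D0: "D 0 = {}" using anchor by (simp add: anchor_def)

lemma D_mono: "mono D"
proof (rule mono_iff_le_Suc[THEN iffD2], rule allI)
  fix n show "D n \<le> D (Suc n)" using anchor by (cases n) (auto simp: anchor_def)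
qed

lemma D_finite: "finite (D k)"
  using anchor D0 by (cases k) (auto simp: anchor_def)

lemma D_verts: "D k \<subseteq> verts G"
  using anchor D0 by (cases k) (auto simp: anchor_def)

lemma finite_subset_D:
  assumes "finite X" "X \<subseteq> verts G"
  obtains k where "k \<ge> 1" "X \<subseteq> D k"
proof -
  have "\<exists>k\<ge>1. X \<subseteq> D k"
    using assms
  proof (induction rule: finite_induct)
    case (insert x X)
    then obtain k where k: "X \<subseteq> D k" by blast
    have "x \<in> (\<Union>k\<in>{1..}. D k)" using insert anchor by (auto simp: anchor_def)
    then obtain l where l: "x \<in> D l" by blast
    have "D k \<subseteq> D (max 1 (max k l))" "D l \<subseteq> D (max 1 (max k l))" using D_mono by (auto simp: mono_def)
    then have "insert x X \<subseteq> D (max 1 (max k l))" using k l by blast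
    then show ?case by (meson max.cobounded1)
  qed auto
  with that show ?thesis by blast
qed

lemma verts_countable: "countable (verts G)"
proof -
  have "verts G = (\<Union>k\<in>{1..}. D k)" using anchor by (simp add: anchor_def)
  moreover have "countable (\<Union>k\<in>{1..}. D k)" by (intro countable_UN) (auto intro: countable_finite D_finite)
  ultimately show ?thesis by simp
qed

lemma sink_burning_anchored:
  assumes "finite W" "W \<subseteq> verts G" "1 \<le> k" "D k \<subseteq> W"
  shows "sink_burning G D prec W (anchored_edges G W (D k)) (k - 1)"
proof -
  let ?F = "anchored_edges G W (D k)"
  have k: "Suc (k - 1) = k" using assms(3) by simp
  have "sink_edges G D W k ?F"
    unfolding sink_edges_def
  proof (intro conjI ballI impI)
    show "?F \<subseteq> edges G" "{f \<in> edges G. ends G f \<subseteq> W} \<subseteq> ?F" by (auto simp: anchored_edges_def)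
    fix f assume "f \<in> ?F"
    then show "ends G f \<inter> W \<noteq> {}"
      using assms(4) multigraphD(2)[OF mg, of f] by (auto simp: anchored_edges_def card_2_iff)
  next
    fix v assume v: "v \<in> W" and c: "v \<in> D (k - 1) \<or> (\<exists>f\<in>?F. v \<in> ends G f \<and> \<not> ends G f \<subseteq> W)"
    have "v \<in> D k"
      using c
    proof
      assume "v \<in> D (k - 1)"
      then show ?thesis using monoD[OF D_mono, of "k - 1" k] by auto
    qed (use v assms(4) in \<open>auto simp: anchored_edges_def\<close>)
    show "incident G v \<subseteq> ?F"
    proof
      fix f assume f: "f \<in> incident G v"
      then obtain w where "ends G f = {v, w}" "w \<in> verts G"
        using other_end_exists[OF mg, of f v] by (auto simp: incident_def)
      then show "f \<in> ?F" using f v \<open>v \<in> D k\<close>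
        by (cases "w \<in> W") (auto simp: anchored_edges_def incident_def)
    qed
  qed
  then show ?thesis
    using mg lf assms D_mono D0 prec k by unfold_locales auto
qed

lemma sink_burning_wired:
  assumes "finite \<Lambda>" "\<Lambda> \<subseteq> verts G"
  shows "sink_burning G D prec \<Lambda> {e \<in> edges G. ends G e \<inter> \<Lambda> \<noteq> {}} m"
proof -
  have "ends G f \<inter> \<Lambda> \<noteq> {}" if "f \<in> edges G" "ends G f \<subseteq> \<Lambda>" for f
    using that multigraphD(2)[OF mg that(1)] by (auto simp: card_2_iff)
  then have "sink_edges G D \<Lambda> (Suc m) {e \<in> edges G. ends G e \<inter> \<Lambda> \<noteq> {}}"
    by (auto simp: sink_edges_def incident_def)
  then show ?thesis
    using mg lf assms D_mono D0 prec by unfold_locales auto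
qed

end

text \<open>
  \<open>W k\<close> is the set of descendants of \<open>D k\<close>, with labels \<open>r k\<close>, \<open>j k\<close> for burning in the anchored
  graph on \<open>W k\<close>, where \<open>k\<close> is the number of phases.
\<close>

locale anchored_forest = anchored G D prec + directed_forest G t
  for G :: "('v, 'e) mgraph" and D prec t
begin

definition W :: "nat \<Rightarrow> 'v set" where "W k = desc G t (D k)"
definition r :: "nat \<Rightarrow> 'v \<Rightarrow> nat" where "r k = tree_phase G D (W k) k E"
definition j :: "nat \<Rightarrow> 'v \<Rightarrow> nat" where "j k = tree_step G D (W k) k E"
abbreviation "h k \<equiv> label_height prec G (r k) (j k) E"

lemma W_iff: "v \<in> W k \<longleftrightarrow> v \<in> verts G \<and> (\<exists>n. (P ^^ n) v \<in> D k)"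
  by (simp add: W_def desc_eq)

lemma D_W: "D k \<subseteq> W k"
proof
  fix v assume v: "v \<in> D k"
  then have "(P ^^ 0) v \<in> D k" by simp
  then show "v \<in> W k" unfolding W_iff using v D_verts by blast
qed

lemma W_verts: "W k \<subseteq> verts G" by (auto simp: W_iff)

lemma W_finite: "finite (W k)"
  unfolding W_def by (rule finite_desc[OF D_finite D_verts])

lemma W_mono: "k \<le> l \<Longrightarrow> W k \<subseteq> W l"
  using monoD[OF D_mono, of k l] unfolding W_def desc_eq by blast

lemma W_P: "v \<in> verts G \<Longrightarrow> P v \<in> W k \<Longrightarrow> v \<in> W k"
proof -
  assume v: "v \<in> verts G" and "P v \<in> W k"
  then obtain n where "(P ^^ n) (P v) \<in> D k" by (auto simp: W_iff)
  then have "(P ^^ Suc n) v \<in> D k" by (simp add: funpow_swap1)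
  then show "v \<in> W k" using v unfolding W_iff by blast
qed

text \<open>This is why the anchored graph keeps edges to the sink at \<open>D k\<close> only: the forest leaves
  \<open>W k\<close> nowhere else.\<close>

lemma exit_D: "v \<in> W k \<Longrightarrow> P v \<notin> W k \<Longrightarrow> v \<in> D k"
proof -
  assume v: "v \<in> W k" and out: "P v \<notin> W k"
  then obtain n where n: "(P ^^ n) v \<in> D k" by (auto simp: W_iff)
  show "v \<in> D k"
  proof (cases n)
    case (Suc n')
    then have "(P ^^ n') (P v) \<in> D k" using n by (simp add: funpow_swap1)
    then show ?thesis using out v P_verts unfolding W_iff by blast
  qed (use n in simp)
qed

lemma climb_eq: "(\<And>i. i < n \<Longrightarrow> (P ^^ i) v \<in> W k) \<Longrightarrow> (climb G (W k) E ^^ n) v = (P ^^ n) v"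
  by (induction n) (auto simp: climb_def)

lemma climb_in: "(climb G (W k) E ^^ n) v \<in> W k \<Longrightarrow> (climb G (W k) E ^^ n) v = (P ^^ n) v"
proof (induction n)
  case (Suc n)
  have "(climb G (W k) E ^^ n) v \<in> W k"
  proof (rule ccontr)
    assume "(climb G (W k) E ^^ n) v \<notin> W k"
    then show False using Suc.prems by (simp add: climb_def[of G "W k" E "(climb G (W k) E ^^ n) v"])
  qed
  then show ?case using Suc.IH by (simp add: climb_def[of G "W k" E "(P ^^ n) v"])
qed simp

lemma directed_tree_W:
  assumes k: "1 \<le> k"
  shows "directed_tree G D (W k) k E"
proof
  fix v assume v: "v \<in> W k"
  then have vG: "v \<in> verts G" by (simp add: W_iff)
  show "E v \<in> edges G" "v \<in> ends G (E v)" using E_t[OF vG] t_edges E_at[OF vG] by auto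
  show "\<exists>n. (climb G (W k) E ^^ n) v \<notin> W k"
  proof (rule ccontr)
    assume c: "\<nexists>n. (climb G (W k) E ^^ n) v \<notin> W k"
    have "(P ^^ n) v \<in> W k" for n using c climb_in[of n k v] by (metis c)
    then have "range (\<lambda>n. (P ^^ n) v) \<subseteq> W k" by blast
    then have "finite (range (\<lambda>n. (P ^^ n) v))" using W_finite by (rule finite_subset)
    then show False using P_pow_inj[OF vG] finite_imageD by blast
  qed
qed (use mg D_mono D0 W_verts k in auto)

lemma labelled_burning_W:
  assumes k: "1 \<le> k"
  shows "labelled_burning G D prec (W k) (anchored_edges G (W k) (D k)) (k - 1) (r k) (j k) E"
proof -
  interpret T: directed_tree G D "W k" k E by (rule directed_tree_W[OF k])
  have "labelled_tree G D (W k) (Suc (k - 1)) (r k) (j k) E"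
    using T.labelled k by (simp add: r_def j_def)
  moreover have "E v \<in> anchored_edges G (W k) (D k)" if v: "v \<in> W k" for v
  proof -
    have vG: "v \<in> verts G" using v by (simp add: W_iff)
    note ends = ends_E[OF vG] and edge = T.e_edge[OF v]
    show ?thesis
    proof (cases "P v \<in> W k")
      case False
      then show ?thesis using exit_D[OF v False] ends edge P_verts[OF vG] by (auto simp: anchored_edges_def)
    qed (use ends edge v in \<open>auto simp: anchored_edges_def\<close>)
  qed
  ultimately show ?thesis
    using sink_burning_anchored[OF W_finite W_verts k D_W]
    by (simp add: labelled_burning_def labelled_burning_axioms_def)
qed

lemma labelled_tree_W: "1 \<le> k \<Longrightarrow> labelled_tree G D (W k) k (r k) (j k) E"
  using labelled_burning_W[of k] by (simp add: labelled_burning_def)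

lemma forest_edges_at_W:
  assumes "ends G f \<inter> W k \<noteq> {}"
  shows "f \<in> E ` W k \<longleftrightarrow> f \<in> t"
proof
  assume "f \<in> t"
  then obtain u where u: "u \<in> verts G" "f = E u" using t_eq by blast
  have "u \<in> W k \<or> P u \<in> W k" using assms u ends_E[OF u(1)] by auto
  then show "f \<in> E ` W k" using W_P[OF u(1)] u(2) by blast
qed (use E_t W_verts in blast)

lemma forest_restrict: "1 \<le> k \<Longrightarrow> t \<inter> anchored_edges G (W k) (D k) = E ` W k"
proof (intro equalityI subsetI)
  fix f assume "f \<in> t \<inter> anchored_edges G (W k) (D k)"
  moreover from this have "ends G f \<noteq> {}"
    using multigraphD(2)[OF mg, of f] t_edges by auto
  ultimately have "f \<in> t" "ends G f \<inter> W k \<noteq> {}"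
    using D_W[of k] by (auto simp: anchored_edges_def)
  then show "f \<in> E ` W k" using forest_edges_at_W by blast
next
  fix f assume k: "1 \<le> k" and f: "f \<in> E ` W k"
  interpret B: labelled_burning G D prec "W k" "anchored_edges G (W k) (D k)" "k - 1" "r k" "j k" E
    by (rule labelled_burning_W[OF k])
  show "f \<in> t \<inter> anchored_edges G (W k) (D k)" using f B.eF E_t W_verts by blast
qed

lemma anchored_psi_W:
  "1 \<le> k \<Longrightarrow> anchored_psi prec G D (W k) k (t \<inter> anchored_edges G (W k) (D k)) = restrict (h k) (W k)"
  unfolding anchored_psi_def anchored_graph_def Let_def forest_restrict
  by (rule sink_burning.inverse_burn_tree[OF sink_burning_anchored labelled_burning_W])
    (use W_finite W_verts D_W in auto)

text \<open>The descendants of \<open>D k\<close> in the infinite forest are the descendants in the finite tree on \<open>W l\<close>, since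
  the path from such a vertex to \<open>D k\<close> does not leave \<open>W l\<close>.\<close>

lemma r_le_iff: "1 \<le> l \<Longrightarrow> k < l \<Longrightarrow> r l v \<le> k \<longleftrightarrow> v \<in> W k"
proof -
  assume l: "1 \<le> l" and kl: "k < l"
  interpret T: directed_tree G D "W l" l E by (rule directed_tree_W[OF l])
  show "r l v \<le> k \<longleftrightarrow> v \<in> W k"
  proof (cases "v \<in> W l")
    case True
    have "(\<exists>n. (climb G (W l) E ^^ n) v \<in> W l \<inter> D k) \<longleftrightarrow> (\<exists>n. (P ^^ n) v \<in> D k)"
    proof
      assume "\<exists>n. (climb G (W l) E ^^ n) v \<in> W l \<inter> D k"
      then obtain n where "(climb G (W l) E ^^ n) v \<in> W l \<inter> D k" by blast
      then show "\<exists>n. (P ^^ n) v \<in> D k" using climb_in[of n l v] by auto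
    next
      assume "\<exists>n. (P ^^ n) v \<in> D k"
      then obtain n where n: "(P ^^ n) v \<in> D k" by blast
      have vG: "v \<in> verts G" using True W_verts by blast
      have "(P ^^ i) v \<in> W l" if "i \<le> n" for i
      proof -
        have "(P ^^ (n - i)) ((P ^^ i) v) \<in> D k" using n that by (simp flip: funpow_add[THEN fun_cong, unfolded o_apply])
        then have "(P ^^ i) v \<in> W k" using P_pow_verts[OF vG] unfolding W_iff by blast
        then show ?thesis using W_mono[of k l] kl by auto
      qed
      then have "(climb G (W l) E ^^ n) v = (P ^^ n) v" "(P ^^ n) v \<in> W l" by (auto intro: climb_eq)
      with n have "(climb G (W l) E ^^ n) v \<in> W l \<inter> D k" by simp
      then show "\<exists>n. (climb G (W l) E ^^ n) v \<in> W l \<inter> D k" by blast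
    qed
    then show ?thesis
      using T.ph_le_iff[OF True kl] True W_verts by (auto simp: r_def W_iff)
  next
    case False
    then have "v \<notin> W k" using W_mono[of k l] kl by auto
    then show ?thesis using False kl T.ph_out[OF False] by (simp add: r_def)
  qed
qed

lemma h_consistent:
  assumes k: "1 \<le> k" "k \<le> l" and v: "v \<in> W k"
  shows "h l v = h k v"
proof (cases "k = l")
  case False
  then have kl: "k < l" using k by simp
  have l: "1 \<le> l" using k by simp
  have Wk: "{v. r l v \<le> k} = W k" using r_le_iff[OF l kl] by blast
  note tr = labelled_tree_truncate[OF labelled_tree_W[OF l] kl]
  have "label_height prec G (\<lambda>v. min (r l v) (Suc k)) (j l) E v = h k v"
    using labelled_trees_unique(4)[OF labelled_tree_W[OF k(1)] tr(1)[unfolded Wk] refl v] .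
  moreover have "label_height prec G (\<lambda>v. min (r l v) (Suc k)) (j l) E v = h l v"
    by (rule tr(2)) (use r_le_iff[OF l kl] v in simp)
  ultimately show ?thesis by simp
qed simp

lemma
  shows psi_ext: "psi prec G D t \<in> extensional (verts G)"
    and psi_eq: "1 \<le> k \<Longrightarrow> v \<in> W k \<Longrightarrow> psi prec G D t v = h k v"
proof -
  define \<eta> where "\<eta> = (\<lambda>v\<in>verts G. h (LEAST k. 1 \<le> k \<and> v \<in> W k) v)"
  have \<eta>: "\<eta> v = h k v" if k: "1 \<le> k" "v \<in> W k" for k v
  proof -
    let ?l = "LEAST k. 1 \<le> k \<and> v \<in> W k"
    have "1 \<le> ?l \<and> v \<in> W ?l" by (rule LeastI) (use k in blast)
    moreover have "?l \<le> k" by (rule Least_le) (use k in blast)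
    ultimately show ?thesis using h_consistent[of ?l k v] k W_verts by (auto simp: \<eta>_def)
  qed
  have cond: "(\<forall>k\<ge>1. let W = desc G t (D k) in restrict \<zeta> W =
      anchored_psi prec G D W k (t \<inter> anchored_edges G W (D k))) \<longleftrightarrow> (\<forall>k\<ge>1. \<forall>v\<in>W k. \<zeta> v = h k v)" for \<zeta>
  proof -
    have "restrict \<zeta> (W k) = restrict (h k) (W k) \<longleftrightarrow> (\<forall>v\<in>W k. \<zeta> v = h k v)" for k
      by (auto simp: restrict_def fun_eq_iff)
    then show ?thesis unfolding Let_def W_def[symmetric] by (simp add: anchored_psi_W)
  qed
  have "psi prec G D t = \<eta>"
    unfolding psi_def cond
  proof (rule the_equality)
    show "\<eta> \<in> extensional (verts G) \<and> (\<forall>k\<ge>1. \<forall>v\<in>W k. \<eta> v = h k v)"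
      using \<eta> by (auto simp: \<eta>_def)
    fix \<zeta> assume \<zeta>: "\<zeta> \<in> extensional (verts G) \<and> (\<forall>k\<ge>1. \<forall>v\<in>W k. \<zeta> v = h k v)"
    show "\<zeta> = \<eta>"
    proof (rule extensionalityI[of _ "verts G"])
      fix v assume "v \<in> verts G"
      then obtain k where "1 \<le> k" "{v} \<subseteq> D k" using finite_subset_D[of "{v}"] by blast
      moreover from this have "v \<in> W k" using D_W by blast
      ultimately show "\<zeta> v = \<eta> v" using \<zeta> \<eta>[of k v] by simp
    qed (use \<zeta> in \<open>auto simp: \<eta>_def\<close>)
  qed
  then show "psi prec G D t \<in> extensional (verts G)" "1 \<le> k \<Longrightarrow> v \<in> W k \<Longrightarrow> psi prec G D t v = h k v"
    using \<eta> by (auto simp: \<eta>_def)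
qed

lemma psi_less_degree:
  assumes v: "v \<in> verts G"
  shows "psi prec G D t v < Defs.degree G v"
proof -
  obtain k where k: "1 \<le> k" "{v} \<subseteq> D k" using finite_subset_D[of "{v}"] v by blast
  then have vW: "v \<in> W k" using D_W by blast
  interpret B: labelled_burning G D prec "W k" "anchored_edges G (W k) (D k)" "k - 1" "r k" "j k" E
    by (rule labelled_burning_W[OF k(1)])
  have "h k v < Defs.degree B.H (Some v)"
    using B.height_recurrent vW by (auto simp: recurrent_def)
  also have "\<dots> \<le> Defs.degree G v"
    unfolding Defs.degree_def B.incident_H[OF vW] by (rule card_mono) (use B.finite_incident[OF vW] in auto)
  finally show ?thesis using psi_eq[OF k(1) vW] by simp
qed

lemma psi_recurrent: "psi prec G D t \<in> recurrent_inf G"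
  unfolding recurrent_inf_def mem_Collect_eq
proof (intro conjI allI impI)
  show "psi prec G D t \<in> (\<Pi>\<^sub>E x\<in>verts G. {..<Defs.degree G x})"
    using psi_ext psi_less_degree by (auto simp: PiE_def)
  fix X assume X: "finite X \<and> X \<noteq> {} \<and> X \<subseteq> verts G"
  then obtain k where k: "1 \<le> k" "X \<subseteq> D k" using finite_subset_D[of X] by blast
  then have XW: "X \<subseteq> W k" using D_W by blast
  interpret B: labelled_burning G D prec "W k" "anchored_edges G (W k) (D k)" "k - 1" "r k" "j k" E
    by (rule labelled_burning_W[OF k(1)])
  have "X \<noteq> {}" using X by blast
  obtain x where x: "x \<in> X" "card (edges_into G x X) \<le> h k x"
    by (rule B.earliest_vertex[OF XW \<open>X \<noteq> {}\<close>])
  then show "ample G (psi prec G D t) X"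
    using psi_eq[OF k(1), of x] XW unfolding ample_def degree_in_def by (intro bexI[of _ x]) auto
qed

text \<open>The next two lemmas recover \<open>W k\<close> from the sandpile: it is the largest finite set in which,
  once everything else has burnt, no vertex outside \<open>D k\<close> can burn.\<close>

lemma W_unburnable:
  assumes k: "1 \<le> k" and v: "v \<in> W k" "v \<notin> D k"
  shows "psi prec G D t v < card (edges_into G v (W k))"
proof -
  interpret B: labelled_burning G D prec "W k" "anchored_edges G (W k) (D k)" "k - 1" "r k" "j k" E
    by (rule labelled_burning_W[OF k])
  have "h k v < Defs.degree B.H (Some v)"
    using B.height_recurrent v by (auto simp: recurrent_def)
  also have "\<dots> = card (edges_into G v (W k)) + card (anchored_edges G (W k) (D k) \<inter> edges_into G v (- W k))"
    by (rule B.degree_H_split[OF v(1) subset_refl])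
  also have "anchored_edges G (W k) (D k) \<inter> edges_into G v (- W k) = {}"
    using v D_W[of k] by (auto simp: anchored_edges_def edges_into_def doubleton_eq_iff)
  finally show ?thesis using psi_eq[OF k v(1)] by simp
qed

lemma unburnable_subset_W:
  assumes k: "1 \<le> k" and X: "finite X" "X \<subseteq> verts G"
    and low: "\<And>v. v \<in> X \<Longrightarrow> v \<notin> D k \<Longrightarrow> psi prec G D t v < card (edges_into G v X)"
  shows "X \<subseteq> W k"
proof (rule ccontr)
  assume "\<not> X \<subseteq> W k"
  then obtain y where y: "y \<in> X" "y \<notin> W k" by blast
  obtain l where "1 \<le> l" "X \<subseteq> D l" using finite_subset_D[OF X] .
  then have l: "1 \<le> max l (Suc k)" "k < max l (Suc k)" "X \<subseteq> W (max l (Suc k))"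
    using D_W[of "max l (Suc k)"] monoD[OF D_mono, of l "max l (Suc k)"] by auto
  define L where "L = max l (Suc k)"
  note l = l[folded L_def]
  interpret B: labelled_burning G D prec "W L" "anchored_edges G (W L) (D L)" "L - 1" "r L" "j L" E
    by (rule labelled_burning_W[OF l(1)])
  have "X \<noteq> {}" using y(1) by blast
  obtain x where x: "x \<in> X" "X \<subseteq> not_before (r L) (j L) x" "card (edges_into G x X) \<le> h L x"
    by (rule B.earliest_vertex[OF l(3) \<open>X \<noteq> {}\<close>])
  \<comment> \<open>The first vertex of \<open>X\<close> to burn does so no later than \<open>y\<close>, hence outside \<open>W k\<close>.\<close>
  have "r L y \<le> r L x" using x(2) y(1) by (auto simp: not_before_def)
  then have "x \<notin> W k" using y(2) r_le_iff[OF l(1,2)] by (meson le_trans)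
  then have "psi prec G D t x < card (edges_into G x X)" using low[OF x(1)] D_W by blast
  then show False using x psi_eq[OF l(1), of x] l(3) by auto
qed

end

text \<open>The two locality statements carry the theorem: the first gives continuity, the second compares
  the infinite graph with wired finite graphs.  Finite labels are needed on one level above \<open>k\<close>, so
  that \<open>k\<close> is below the number of phases.\<close>

lemma psi_local:
  assumes A0: "anchored_forest G D prec t0" and A: "anchored_forest G D prec t" and k: "1 \<le> k"
    and same: "\<And>f. ends G f \<inter> desc G t0 (D k) \<noteq> {} \<Longrightarrow> f \<in> t0 \<longleftrightarrow> f \<in> t"
    and v: "v \<in> desc G t0 (D k)"
  shows "psi prec G D t v = psi prec G D t0 v"
proof -
  interpret T0: anchored_forest G D prec t0 by (fact A0)
  interpret T: anchored_forest G D prec t by (fact A)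
  note same = same[folded T0.W_def] and v = v[folded T0.W_def]
  obtain l where "1 \<le> l" "T0.W k \<subseteq> D l" using T0.finite_subset_D[OF T0.W_finite T0.W_verts] .
  moreover define L where "L = max l (Suc k)"
  ultimately have L: "1 \<le> L" "k < L" "T0.W k \<subseteq> T.W L"
    using T.D_W[of L] monoD[OF T0.D_mono, of l L] by auto
  have A: "T0.W k = {v. T0.r (Suc k) v \<le> k}" using T0.r_le_iff[of "Suc k" k] by auto
  have "label_height prec G (T.r L) (T.j L) T.E v = label_height prec G (T0.r (Suc k)) (T0.j (Suc k)) T0.E v"
  proof (rule labelled_trees_agree_height[OF T0.labelled_tree_W T.labelled_tree_W _ L(2) A L(3) T0.D_W _ v])
    fix f assume f: "ends G f \<inter> T0.W k \<noteq> {}"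
    then have "ends G f \<inter> T0.W (Suc k) \<noteq> {}" "ends G f \<inter> T.W L \<noteq> {}" using T0.W_mono[of k "Suc k"] L(3) by auto
    then show "f \<in> T0.E ` T0.W (Suc k) \<longleftrightarrow> f \<in> T.E ` T.W L"
      using T0.forest_edges_at_W T.forest_edges_at_W same[OF f] by metis
  qed (use L in auto)
  moreover have "v \<in> T0.W (Suc k)" "v \<in> T.W L" using v L T0.W_mono[of k "Suc k"] by auto
  ultimately show ?thesis using T.psi_eq[OF L(1)] T0.psi_eq[of "Suc k" v] by simp
qed

lemma burn_tree_inverse_local:
  assumes A0: "anchored_forest G D prec t0" and k: "1 \<le> k" "k \<le> m"
    and \<Lambda>: "finite \<Lambda>" "\<Lambda> \<subseteq> verts G" "desc G t0 (D k) \<subseteq> \<Lambda>"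
    and t: "t \<in> spanning_trees (wired_graph G \<Lambda>)"
    and same: "\<And>f. ends G f \<inter> desc G t0 (D k) \<noteq> {} \<Longrightarrow> f \<in> t0 \<longleftrightarrow> f \<in> t"
    and v: "v \<in> desc G t0 (D k)"
  shows "the_inv_into (recurrent (wired_graph G \<Lambda>)) (burn_tree prec (wired_graph G \<Lambda>) D m) t v = psi prec G D t0 v"
proof -
  interpret T0: anchored_forest G D prec t0 by (fact A0)
  note same = same[folded T0.W_def] and v = v[folded T0.W_def] and sub = \<Lambda>(3)[folded T0.W_def]
  interpret S: sink_burning G D prec \<Lambda> "{e \<in> edges G. ends G e \<inter> \<Lambda> \<noteq> {}}" m
    by (rule T0.sink_burning_wired[OF \<Lambda>(1,2)])
  obtain r j e where L: "labelled_burning G D prec \<Lambda> {e \<in> edges G. ends G e \<inter> \<Lambda> \<noteq> {}} m r j e" "t = e ` \<Lambda>"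
    using S.labelling_of_spanning_tree[OF t[unfolded wired_graph_def]] .
  have tree: "labelled_tree G D \<Lambda> (Suc m) r j e" using L(1) by (simp add: labelled_burning_def)
  have A: "T0.W k = {v. T0.r (Suc k) v \<le> k}" using T0.r_le_iff[of "Suc k" k] by auto
  have "label_height prec G r j e v = label_height prec G (T0.r (Suc k)) (T0.j (Suc k)) T0.E v"
  proof (rule labelled_trees_agree_height[OF T0.labelled_tree_W tree _ _ A sub T0.D_W _ v])
    fix f assume f: "ends G f \<inter> T0.W k \<noteq> {}"
    then have "ends G f \<inter> T0.W (Suc k) \<noteq> {}" using T0.W_mono[of k "Suc k"] by auto
    then show "f \<in> T0.E ` T0.W (Suc k) \<longleftrightarrow> f \<in> e ` \<Lambda>"
      using T0.forest_edges_at_W same[OF f] L(2) by metis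
  qed (use k in auto)
  moreover have "v \<in> T0.W (Suc k)" "v \<in> \<Lambda>" using v sub T0.W_mono[of k "Suc k"] by auto
  ultimately show ?thesis
    using T0.psi_eq[of "Suc k" v] S.inverse_burn_tree[OF L(1)] L(2) by (simp add: wired_graph_def)
qed

text \<open>The sandpile determines the sets \<open>W k\<close>, and on each of them the finite burning map
  returns the edges of the forest.\<close>

lemma psi_inj:
  assumes A: "anchored_forest G D prec t" "anchored_forest G D prec t'"
    and eq: "psi prec G D t = psi prec G D t'"
  shows "t = t'"
proof -
  have sub: "t1 \<subseteq> t2" if A: "anchored_forest G D prec t1" "anchored_forest G D prec t2"
    and eq: "psi prec G D t1 = psi prec G D t2" for t1 t2
  proof
    interpret T1: anchored_forest G D prec t1 by (fact A)
    interpret T2: anchored_forest G D prec t2 by (fact A)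
    fix f assume f: "f \<in> t1"
    then have fG: "f \<in> edges G" using T1.t_edges by blast
    have "finite (ends G f)" "ends G f \<subseteq> verts G"
      using multigraphD[OF T1.mg fG] by (auto intro: card_ge_0_finite)
    then obtain k where k: "1 \<le> k" "ends G f \<subseteq> D k" by (rule T1.finite_subset_D)
    have "T1.W k \<subseteq> T2.W k"
      using T1.W_unburnable[OF k(1)] eq by (intro T2.unburnable_subset_W[OF k(1) T1.W_finite T1.W_verts]) simp
    moreover have "T2.W k \<subseteq> T1.W k"
      using T2.W_unburnable[OF k(1)] eq by (intro T1.unburnable_subset_W[OF k(1) T2.W_finite T2.W_verts]) simp
    ultimately have W: "T2.W k = T1.W k" by simp
    interpret B1: labelled_burning G D prec "T1.W k" "anchored_edges G (T1.W k) (D k)" "k - 1" "T1.r k" "T1.j k" T1.E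
      by (rule T1.labelled_burning_W[OF k(1)])
    interpret B2: labelled_burning G D prec "T1.W k" "anchored_edges G (T1.W k) (D k)" "k - 1" "T2.r k" "T2.j k" T2.E
      using T2.labelled_burning_W[OF k(1)] by (simp add: W)
    have "B1.lheight v = B2.lheight v" if "v \<in> T1.W k" for v
      using T1.psi_eq[OF k(1) that] T2.psi_eq[OF k(1), of v] W that eq by simp
    then have "T1.E ` T1.W k = T2.E ` T1.W k"
      using B1.burn_tree_labels[of B1.lheight] B2.burn_tree_labels[of B1.lheight] by simp
    moreover have "f \<in> anchored_edges G (T1.W k) (D k)"
      using fG k(2) T1.D_W by (auto simp: anchored_edges_def)
    ultimately show "f \<in> t2"
      using T1.forest_restrict[OF k(1)] T2.forest_restrict[OF k(1), unfolded W] f by blast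
  qed
  show ?thesis using sub[OF A eq] sub[OF A(2,1) eq[symmetric]] by blast
qed

section \<open>Cylinder events\<close>

lemma space_borel_of [simp]: "space (borel_of X) = topspace X"
  unfolding borel_of_def by (rule space_measure_of) (auto dest: openin_subset)

lemma sets_borel_of: "sets (borel_of X) = sigma_sets (topspace X) {U. openin X U}"
  unfolding borel_of_def by (rule sets_measure_of) (auto dest: openin_subset)

lemma openin_sets_borel_of: "openin X U \<Longrightarrow> U \<in> sets (borel_of X)"
  by (auto simp: sets_borel_of)

lemma continuous_map_borel_measurable:
  assumes "continuous_map X euclideanreal f"
  shows "f \<in> borel_measurable (borel_of X)"
proof (rule borel_measurableI)
  fix S :: "real set" assume "open S"
  then have "openin X {x \<in> topspace X. f x \<in> S}"
    using assms by (auto simp: continuous_map_def)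
  moreover have "f -` S \<inter> space (borel_of X) = {x \<in> topspace X. f x \<in> S}" by auto
  ultimately show "f -` S \<inter> space (borel_of X) \<in> sets (borel_of X)" by (simp add: openin_sets_borel_of)
qed

lemma topspace_edge_topology [simp]: "topspace (edge_topology G) = Pow (edges G)"
  by (auto simp: edge_topology_def topspace_pullback_topology)

lemma topspace_sandpile_topology: "topspace (sandpile_topology G) = (\<Pi>\<^sub>E x\<in>verts G. {..<Defs.degree G x})"
  by (simp add: sandpile_topology_def)

lemma openin_edge_cylinder:
  assumes "finite K" "K \<subseteq> edges G"
  shows "openin (edge_topology G) {t \<in> Pow (edges G). Q (t \<inter> K)}"
proof -
  have basic: "openin (edge_topology G) {t \<in> Pow (edges G). t \<inter> K = s}" if s: "s \<subseteq> K" for s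
  proof -
    let ?U = "\<Pi>\<^sub>E e\<in>edges G. if e \<in> K then {e \<in> s} else (UNIV :: bool set)"
    have "finite {e \<in> edges G. (if e \<in> K then {e \<in> s} else (UNIV :: bool set)) \<noteq> UNIV}"
      by (rule finite_subset[OF _ assms(1)]) auto
    then have "openin (product_topology (\<lambda>_. discrete_topology (UNIV :: bool set)) (edges G)) ?U"
      by (subst openin_PiE_gen) auto
    moreover have "{t \<in> Pow (edges G). t \<inter> K = s} = (\<lambda>t. \<lambda>e\<in>edges G. e \<in> t) -` ?U \<inter> Pow (edges G)"
      using s assms(2) by (auto simp: PiE_iff split: if_splits) blast
    ultimately show ?thesis unfolding edge_topology_def openin_pullback_topology by blast
  qed
  have "{t \<in> Pow (edges G). Q (t \<inter> K)} = \<Union> ((\<lambda>s. {t \<in> Pow (edges G). t \<inter> K = s}) ` {s. s \<subseteq> K \<and> Q s})"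
    by auto
  moreover have "openin (edge_topology G) \<dots>" using basic by (intro openin_Union) auto
  ultimately show ?thesis by simp
qed

lemma continuous_edge_cylinder:
  fixes f :: "'e set \<Rightarrow> real"
  assumes "finite K" "K \<subseteq> edges G" "\<And>t. t \<subseteq> edges G \<Longrightarrow> f t = f (t \<inter> K)"
  shows "continuous_map (edge_topology G) euclideanreal f"
  unfolding continuous_map_def
proof (intro conjI allI impI)
  fix U :: "real set"
  have "{t \<in> topspace (edge_topology G). f t \<in> U} = {t \<in> Pow (edges G). f (t \<inter> K) \<in> U}"
    using assms(3) by auto
  then show "openin (edge_topology G) {t \<in> topspace (edge_topology G). f t \<in> U}"
    using openin_edge_cylinder[OF assms(1,2), of "\<lambda>s. f s \<in> U"] by simp
qed auto

lemma bounded_edge_cylinder: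
  fixes f :: "'e set \<Rightarrow> real"
  assumes "finite K" "\<And>t. t \<subseteq> edges G \<Longrightarrow> f t = f (t \<inter> K)"
  shows "bounded (f ` Pow (edges G))"
proof (rule finite_imp_bounded, rule finite_subset)
  show "f ` Pow (edges G) \<subseteq> f ` Pow K" using assms(2) by force
qed (use assms(1) in simp)

lemma openin_sandpile_cylinder:
  assumes "finite K" "K \<subseteq> verts G"
  shows "openin (sandpile_topology G) {\<eta> \<in> topspace (sandpile_topology G). Q (restrict \<eta> K)}"
proof -
  let ?X = "topspace (sandpile_topology G)"
  have basic: "openin (sandpile_topology G) {\<eta> \<in> ?X. restrict \<eta> K = restrict \<xi> K}" if \<xi>: "\<xi> \<in> ?X" for \<xi>
  proof -
    let ?U = "\<Pi>\<^sub>E x\<in>verts G. if x \<in> K then {\<xi> x} else {..<Defs.degree G x}"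
    have "finite {x \<in> verts G. (if x \<in> K then {\<xi> x} else {..<Defs.degree G x}) \<noteq> {..<Defs.degree G x}}"
      by (rule finite_subset[OF _ assms(1)]) auto
    then have "openin (sandpile_topology G) ?U"
      unfolding sandpile_topology_def using \<xi>
      by (subst openin_PiE_gen) (auto simp: topspace_sandpile_topology PiE_iff)
    moreover have "{\<eta> \<in> ?X. restrict \<eta> K = restrict \<xi> K} = ?U"
    proof -
      have "restrict \<eta> K = restrict \<xi> K \<longleftrightarrow> (\<forall>x\<in>K. \<eta> x = \<xi> x)" for \<eta>
        by (auto simp: restrict_def fun_eq_iff)
      moreover have "{\<eta> \<in> ?X. \<forall>x\<in>K. \<eta> x = \<xi> x} = ?U"
      proof (intro equalityI subsetI)
        fix \<eta> assume "\<eta> \<in> {\<eta> \<in> ?X. \<forall>x\<in>K. \<eta> x = \<xi> x}"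
        then show "\<eta> \<in> ?U" by (simp add: topspace_sandpile_topology PiE_iff)
      next
        fix \<eta> assume U: "\<eta> \<in> ?U"
        have K: "\<eta> x = \<xi> x" if "x \<in> K" for x using PiE_mem[OF U, of x] that assms(2) by auto
        have "\<eta> x < Defs.degree G x" if "x \<in> verts G" for x
          using PiE_mem[OF U that] PiE_mem[OF \<xi>[unfolded topspace_sandpile_topology] that] by (cases "x \<in> K") auto
        then show "\<eta> \<in> {\<eta> \<in> ?X. \<forall>x\<in>K. \<eta> x = \<xi> x}"
          using K U by (simp add: topspace_sandpile_topology PiE_iff)
      qed
      ultimately show ?thesis by simp
    qed
    ultimately show ?thesis by simp
  qed
  have "{\<eta> \<in> ?X. Q (restrict \<eta> K)} = \<Union> ((\<lambda>\<xi>. {\<eta> \<in> ?X. restrict \<eta> K = restrict \<xi> K}) ` {\<xi> \<in> ?X. Q (restrict \<xi> K)})"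
    by auto
  moreover have "openin (sandpile_topology G) \<dots>" using basic by (intro openin_Union) auto
  ultimately show ?thesis by simp
qed

lemma sandpile_nbhd:
  assumes "openin (sandpile_topology G) U" "\<eta> \<in> U"
  obtains K where "finite K" "K \<subseteq> verts G"
    "{\<eta>' \<in> topspace (sandpile_topology G). restrict \<eta>' K = restrict \<eta> K} \<subseteq> U"
proof -
  obtain B where B: "\<eta> \<in> Pi\<^sub>E (verts G) B" "finite {x. B x \<noteq> {..<Defs.degree G x}}" "Pi\<^sub>E (verts G) B \<subseteq> U"
    using product_topology_open_contains_basis[OF assms(1)[unfolded sandpile_topology_def] assms(2)] by auto
  let ?K = "{x \<in> verts G. B x \<noteq> {..<Defs.degree G x}}"
  have "{\<eta>' \<in> topspace (sandpile_topology G). restrict \<eta>' ?K = restrict \<eta> ?K} \<subseteq> Pi\<^sub>E (verts G) B"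
  proof
    fix \<eta>' assume "\<eta>' \<in> {\<eta>' \<in> topspace (sandpile_topology G). restrict \<eta>' ?K = restrict \<eta> ?K}"
    then have \<eta>': "\<eta>' \<in> (\<Pi>\<^sub>E x\<in>verts G. {..<Defs.degree G x})" "restrict \<eta>' ?K = restrict \<eta> ?K"
      by (auto simp: topspace_sandpile_topology)
    show "\<eta>' \<in> Pi\<^sub>E (verts G) B"
    proof (rule PiE_I)
      fix x assume x: "x \<in> verts G"
      show "\<eta>' x \<in> B x"
      proof (cases "x \<in> ?K")
        case True
        then have "\<eta>' x = \<eta> x" using fun_cong[OF \<eta>'(2), of x] by simp
        then show ?thesis using B(1) x by (auto simp: PiE_iff)
      qed (use \<eta>'(1) x in \<open>auto simp: PiE_iff\<close>)
    qed (use \<eta>'(1) in \<open>auto simp: PiE_iff extensional_def\<close>)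
  qed
  moreover have "finite ?K" by (rule finite_subset[OF _ B(2)]) auto
  ultimately show ?thesis using B(3) that[of ?K] by blast
qed

lemma continuous_sandpile_cylinder:
  fixes f :: "('v \<Rightarrow> nat) \<Rightarrow> real"
  assumes "finite K" "K \<subseteq> verts G" "\<And>\<eta>. \<eta> \<in> topspace (sandpile_topology G) \<Longrightarrow> f \<eta> = g (restrict \<eta> K)"
  shows "continuous_map (sandpile_topology G) euclideanreal f"
  unfolding continuous_map_def
proof (intro conjI allI impI)
  fix U :: "real set"
  have "{\<eta> \<in> topspace (sandpile_topology G). f \<eta> \<in> U} = {\<eta> \<in> topspace (sandpile_topology G). g (restrict \<eta> K) \<in> U}"
    using assms(3) by auto
  then show "openin (sandpile_topology G) {\<eta> \<in> topspace (sandpile_topology G). f \<eta> \<in> U}"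
    using openin_sandpile_cylinder[OF assms(1,2), of "\<lambda>\<eta>. g \<eta> \<in> U"] by simp
qed auto

section \<open>Uniqueness of weak limits of sandpile measures\<close>

text \<open>Indicators of cylinders are continuous, and cylinders generate the Borel sets because there are
  countably many of the form \<open>{\<eta>. restrict \<eta> K = \<xi>}\<close>.\<close>

lemma sandpile_weak_limit_unique:
  assumes V: "countable (verts G)" and \<F>: "\<F> \<noteq> bot"
    and N: "weak_limit (sandpile_topology G) M \<F> N" "weak_limit (sandpile_topology G) M \<F> N'"
  shows "N = N'"
proof -
  let ?X = "topspace (sandpile_topology G)"
  interpret N: prob_space N using N(1) by (simp add: weak_limit_def)
  interpret N': prob_space N' using N(2) by (simp add: weak_limit_def)
  have sets: "sets N = sets (borel_of (sandpile_topology G))" "sets N' = sets (borel_of (sandpile_topology G))"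
    using N by (auto simp: weak_limit_def)
  define C where "C = (\<lambda>K Q. {\<eta> \<in> ?X. Q (restrict \<eta> K)})"
  define cyl where "cyl = (\<Union>K\<in>{K. finite K \<and> K \<subseteq> verts G}. range (C K))"
  have cylE: "\<exists>K Q. finite K \<and> K \<subseteq> verts G \<and> A = C K Q" if "A \<in> cyl" for A
    using that by (auto simp: cyl_def)
  have cylI: "C K Q \<in> cyl" if "finite K" "K \<subseteq> verts G" for K Q
    using that by (auto simp: cyl_def)
  have cyl_open: "openin (sandpile_topology G) A" if A: "A \<in> cyl" for A
    using cylE[OF A] openin_sandpile_cylinder by (auto simp: C_def)
  have eq: "measure N A = measure N' A" if "A \<in> cyl" for A
  proof -
    obtain K Q where K: "finite K" "K \<subseteq> verts G" and "A = C K Q" using cylE[OF \<open>A \<in> cyl\<close>] by blast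
    then have A: "A = {\<eta> \<in> ?X. Q (restrict \<eta> K)}" by (simp add: C_def)
    let ?f = "indicator A :: ('a \<Rightarrow> nat) \<Rightarrow> real"
    have "continuous_map (sandpile_topology G) euclideanreal ?f"
      by (rule continuous_sandpile_cylinder[OF K, where g = "\<lambda>\<eta>. of_bool (Q \<eta>)"]) (simp add: A indicator_def)
    moreover have "bounded (?f ` ?X)"
      by (rule bounded_subset[of "{0, 1}"]) (auto simp: indicator_def)
    ultimately have "integral\<^sup>L N ?f = integral\<^sup>L N' ?f"
      using N tendsto_unique[OF \<F>] unfolding weak_limit_def by blast
    moreover have "A \<in> sets N" "A \<in> sets N'" using openin_sets_borel_of[OF cyl_open[OF that]] sets by auto
    ultimately show ?thesis by simp
  qed
  have gen: "sigma_sets ?X {U. openin (sandpile_topology G) U} = sigma_sets ?X cyl"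
  proof (rule sigma_sets_eqI)
    fix U assume U: "U \<in> {U. openin (sandpile_topology G) U}"
    define I where "I = (SIGMA K:{K. finite K \<and> K \<subseteq> verts G}. \<Pi>\<^sub>E x\<in>K. {..<Defs.degree G x})"
    define c where "c = (\<lambda>(K, \<xi>). {\<eta> \<in> ?X. restrict \<eta> K = \<xi>})"
    have "countable I"
      unfolding I_def
      by (intro countable_SIGMA countable_Collect_finite_subset V countable_finite finite_PiE) auto
    have "U = \<Union> (c ` {i \<in> I. c i \<subseteq> U})"
    proof (intro equalityI subsetI)
      fix \<eta> assume \<eta>: "\<eta> \<in> U"
      then obtain K where K: "finite K" "K \<subseteq> verts G" "{\<eta>' \<in> ?X. restrict \<eta>' K = restrict \<eta> K} \<subseteq> U"
        using U sandpile_nbhd by blast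
      have \<eta>X: "\<eta> \<in> ?X" using \<eta> U openin_subset by blast
      then have "(K, restrict \<eta> K) \<in> I"
        using K(1,2) by (auto simp: I_def topspace_sandpile_topology PiE_iff)
      moreover have "c (K, restrict \<eta> K) \<subseteq> U" "\<eta> \<in> c (K, restrict \<eta> K)" using K(3) \<eta>X by (auto simp: c_def)
      ultimately show "\<eta> \<in> \<Union> (c ` {i \<in> I. c i \<subseteq> U})" by blast
    qed auto
    moreover have "\<Union> (c ` {i \<in> I. c i \<subseteq> U}) \<in> sigma_sets ?X cyl"
    proof (rule sigma_sets_UNION)
      show "countable (c ` {i \<in> I. c i \<subseteq> U})"
        using \<open>countable I\<close> by (intro countable_image) (auto intro: countable_subset)
      fix A assume "A \<in> c ` {i \<in> I. c i \<subseteq> U}"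
      then obtain K \<xi> where "A = c (K, \<xi>)" "(K, \<xi>) \<in> I" by auto
      moreover have "c (K, \<xi>) = C K (\<lambda>\<zeta>. \<zeta> = \<xi>)" by (simp add: c_def C_def)
      ultimately have "A \<in> cyl" using cylI[of K "\<lambda>\<zeta>. \<zeta> = \<xi>"] by (simp add: I_def)
      then show "A \<in> sigma_sets ?X cyl" by (rule sigma_sets.Basic)
    qed
    ultimately show "U \<in> sigma_sets ?X cyl" by simp
  qed (use cyl_open in auto)
  show ?thesis
  proof (rule measure_eqI_generator_eq[where E = cyl and \<Omega> = ?X and A = "\<lambda>_. ?X"])
    show "Int_stable cyl"
    proof (rule Int_stableI)
      fix A B assume "A \<in> cyl" "B \<in> cyl"
      then obtain K Q K' Q' where K: "finite K" "K \<subseteq> verts G" "finite K'" "K' \<subseteq> verts G"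
        and A: "A = C K Q" "B = C K' Q'"
        using cylE by meson
      have "restrict (restrict \<eta> (K \<union> K')) K = restrict \<eta> K" "restrict (restrict \<eta> (K \<union> K')) K' = restrict \<eta> K'" for \<eta> :: "'a \<Rightarrow> nat"
        by (simp_all add: Int_absorb1 restrict_restrict)
      then have "A \<inter> B = C (K \<union> K') (\<lambda>\<xi>. Q (restrict \<xi> K) \<and> Q' (restrict \<xi> K'))"
        by (auto simp: A C_def)
      then show "A \<inter> B \<in> cyl" using K cylI by simp
    qed
    show "emeasure N A = emeasure N' A" if "A \<in> cyl" for A
      using eq[OF that] by (simp add: N.emeasure_eq_measure N'.emeasure_eq_measure)
    have "?X = C {} (\<lambda>_. True)" by (simp add: C_def)
    then show "range (\<lambda>_::nat. ?X) \<subseteq> cyl" using cylI[of "{}" "\<lambda>_. True"] by auto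
    show "cyl \<subseteq> Pow ?X" by (auto simp: cyl_def C_def)
    show "sets N = sigma_sets ?X cyl" "sets N' = sigma_sets ?X cyl" using sets gen by (simp_all add: sets_borel_of)
  qed auto
qed

section \<open>Measurability of the set of one-ended forests\<close>

text \<open>Finiteness of a component is witnessed by a finite set without crossing edges; there are
  only countably many such sets.\<close>

lemma finite_comp_iff:
  assumes "multigraph G" "t \<subseteq> edges G" "v \<in> verts G"
  shows "finite (comp_of G t v) \<longleftrightarrow>
    (\<exists>K\<in>{K. finite K \<and> K \<subseteq> verts G \<and> v \<in> K}. \<forall>f\<in>t. ends G f \<inter> K = {} \<or> ends G f \<subseteq> K)"
proof
  assume fin: "finite (comp_of G t v)"
  have "ends G f \<inter> comp_of G t v = {} \<or> ends G f \<subseteq> comp_of G t v" if f: "f \<in> t" for f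
  proof -
    have "f \<in> edges G" using f assms(2) by blast
    then obtain a b where ab: "ends G f = {a, b}" using multigraphD(2)[OF assms(1), of f] by (auto simp: card_2_iff)
    then have "(a, b) \<in> adj_rel G t" "(b, a) \<in> adj_rel G t" using f by (auto simp: adj_rel_def insert_commute)
    then show ?thesis using ab comp_of_step[of a G t v b] comp_of_step[of b G t v a] by auto
  qed
  then show "\<exists>K\<in>{K. finite K \<and> K \<subseteq> verts G \<and> v \<in> K}. \<forall>f\<in>t. ends G f \<inter> K = {} \<or> ends G f \<subseteq> K"
    using fin comp_of_verts[OF assms] by (intro bexI[of _ "comp_of G t v"]) auto
next
  assume "\<exists>K\<in>{K. finite K \<and> K \<subseteq> verts G \<and> v \<in> K}. \<forall>f\<in>t. ends G f \<inter> K = {} \<or> ends G f \<subseteq> K"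
  then obtain K where K: "finite K" "v \<in> K" "\<forall>f\<in>t. ends G f \<inter> K = {} \<or> ends G f \<subseteq> K" by blast
  have "comp_of G t v \<subseteq> K"
    by (rule comp_of_subset[OF K(2)]) (use K(3) in \<open>fastforce simp: adj_rel_def\<close>)
  then show "finite (comp_of G t v)" using K(1) finite_subset by blast
qed

context anchored begin

lemma edges_countable: "countable (edges G)"
proof -
  have "edges G \<subseteq> (\<Union>v\<in>verts G. incident G v)"
  proof
    fix f assume f: "f \<in> edges G"
    then obtain a b where "ends G f = {a, b}" using multigraphD(2)[OF mg f] by (auto simp: card_2_iff)
    moreover from this have "a \<in> verts G" using multigraphD(1)[OF mg f] by auto
    ultimately show "f \<in> (\<Union>v\<in>verts G. incident G v)" using f by (auto simp: incident_def)
  qed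
  moreover have "countable (\<Union>v\<in>verts G. incident G v)"
    using lf verts_countable by (intro countable_UN) (auto simp: locally_finite_def intro: countable_finite)
  ultimately show ?thesis by (rule countable_subset)
qed

lemma finite_edges_touching: "finite K \<Longrightarrow> K \<subseteq> verts G \<Longrightarrow> finite {f \<in> edges G. ends G f \<inter> K \<noteq> {}}"
proof -
  assume K: "finite K" "K \<subseteq> verts G"
  have "{f \<in> edges G. ends G f \<inter> K \<noteq> {}} = (\<Union>v\<in>K. incident G v)" by (auto simp: incident_def)
  moreover have "finite (\<Union>v\<in>K. incident G v)"
    using K lf by (auto simp: locally_finite_def)
  ultimately show ?thesis by simp
qed

definition cycle_edges :: "'e list set" where
  "cycle_edges = {es \<in> lists (edges G). \<exists>vs. is_cycle G vs es}"

lemma cycle_edges_countable: "countable cycle_edges"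
  unfolding cycle_edges_def
  by (rule countable_subset[of _ "lists (edges G)"]) (auto intro: countable_lists edges_countable)

lemma acyclic_iff: "t \<subseteq> edges G \<Longrightarrow> acyclic_edges G t \<longleftrightarrow> (\<forall>es\<in>cycle_edges. \<not> (\<forall>f\<in>set es. f \<in> t))"
  unfolding acyclic_edges_def cycle_edges_def by blast

lemma finite_sets_countable: "countable {K. finite K \<and> K \<subseteq> verts G \<and> v \<in> K}"
  by (rule countable_subset[of _ "{K. finite K \<and> K \<subseteq> verts G}"])
    (auto intro: countable_Collect_finite_subset verts_countable)

text \<open>The description of one-ended forests by finite sides of edges is a countable
  combination of events about single edges.\<close>

lemma one_end_forests_measurable: "one_end_forests G \<in> sets (borel_of (edge_topology G))"
proof -
  let ?M = "borel_of (edge_topology G)" and ?\<Omega> = "Pow (edges G)"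
  interpret sigma_algebra ?\<Omega> "sets ?M"
    using sets.sigma_algebra_axioms[of ?M] by simp
  have edge: "{t \<in> ?\<Omega>. Q (f \<in> t)} \<in> sets ?M" if "f \<in> edges G" for f Q
  proof -
    have "{t \<in> ?\<Omega>. Q (f \<in> t)} = {t \<in> ?\<Omega>. (\<lambda>s. Q (f \<in> s)) (t \<inter> {f})}" by auto
    moreover have "openin (edge_topology G) \<dots>" by (rule openin_edge_cylinder) (use that in auto)
    ultimately show ?thesis using openin_sets_borel_of by metis
  qed
  have comp: "{t \<in> ?\<Omega>. finite (comp_of G (t - X) v)} \<in> sets ?M" if v: "v \<in> verts G" for v X
  proof -
    have "{t \<in> ?\<Omega>. finite (comp_of G (t - X) v)} =
      {t \<in> ?\<Omega>. \<exists>K\<in>{K. finite K \<and> K \<subseteq> verts G \<and> v \<in> K}. \<forall>f\<in>edges G. f \<in> t \<longrightarrow>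
        f \<in> X \<or> ends G f \<inter> K = {} \<or> ends G f \<subseteq> K}"
      (is "_ = ?R")
    proof (rule Collect_cong, rule conj_cong[OF refl])
      fix t assume "t \<in> ?\<Omega>"
      then have "t - X \<subseteq> edges G" by blast
      note finite_comp_iff[OF mg this v]
      moreover have "(\<forall>f\<in>t - X. ends G f \<inter> K = {} \<or> ends G f \<subseteq> K) \<longleftrightarrow>
          (\<forall>f\<in>edges G. f \<in> t \<longrightarrow> f \<in> X \<or> ends G f \<inter> K = {} \<or> ends G f \<subseteq> K)" for K
        using \<open>t \<in> ?\<Omega>\<close> by blast
      ultimately show "finite (comp_of G (t - X) v) \<longleftrightarrow>
        (\<exists>K\<in>{K. finite K \<and> K \<subseteq> verts G \<and> v \<in> K}. \<forall>f\<in>edges G. f \<in> t \<longrightarrow>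
          f \<in> X \<or> ends G f \<inter> K = {} \<or> ends G f \<subseteq> K)"
        by simp
    qed
    moreover have "?R \<in> sets ?M"
      by (intro sets_Collect_countable_Ex'[OF _ finite_sets_countable] sets_Collect_countable_All'[OF _ edges_countable] edge)
    ultimately show ?thesis by simp
  qed
  have "one_end_forests G = {t \<in> ?\<Omega>. (\<forall>es\<in>cycle_edges. \<not> (\<forall>f\<in>set es. f \<in> t)) \<and>
      (\<forall>v\<in>verts G. \<not> finite (comp_of G (t - {}) v)) \<and>
      (\<forall>e\<in>edges G. e \<in> t \<longrightarrow> (\<exists>v\<in>ends G e. finite (comp_of G (t - {e}) v)))}" (is "_ = ?R")
  proof (intro set_eqI)
    fix t
    have "t \<in> one_end_forests G \<longleftrightarrow> directed_forest G t" by (rule one_end_forests_iff[OF mg lf])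
    also have "\<dots> \<longleftrightarrow> t \<in> ?R"
      unfolding directed_forest_def using mg lf acyclic_iff[of t] by auto
    finally show "t \<in> one_end_forests G \<longleftrightarrow> t \<in> ?R" .
  qed
  moreover have "?R \<in> sets ?M"
  proof (intro sets_Collect_conj)
    show "{t \<in> ?\<Omega>. \<forall>es\<in>cycle_edges. \<not> (\<forall>f\<in>set es. f \<in> t)} \<in> sets ?M"
    proof (intro sets_Collect_countable_All'[OF _ cycle_edges_countable] sets_Collect_neg)
      fix es assume "es \<in> cycle_edges"
      then have "set es \<subseteq> edges G" by (auto simp: cycle_edges_def)
      then show "{t \<in> ?\<Omega>. \<forall>f\<in>set es. f \<in> t} \<in> sets ?M"
        by (intro sets_Collect_countable_All' edge[where Q = "\<lambda>b. b"]) (auto intro: countable_finite)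
    qed
    show "{t \<in> ?\<Omega>. \<forall>v\<in>verts G. \<not> finite (comp_of G (t - {}) v)} \<in> sets ?M"
      by (intro sets_Collect_countable_All'[OF _ verts_countable] sets_Collect_neg comp)
    show "{t \<in> ?\<Omega>. \<forall>e\<in>edges G. e \<in> t \<longrightarrow> (\<exists>v\<in>ends G e. finite (comp_of G (t - {e}) v))} \<in> sets ?M"
    proof (intro sets_Collect_countable_All'[OF _ edges_countable] sets_Collect_imp)
      fix e assume e: "e \<in> edges G"
      show "{t \<in> ?\<Omega>. e \<in> t} \<in> sets ?M" by (rule edge[OF e, where Q = "\<lambda>b. b"])
      have "finite (ends G e)" "ends G e \<subseteq> verts G" using multigraphD[OF mg e] by (auto intro: card_ge_0_finite)
      then show "{t \<in> ?\<Omega>. \<exists>v\<in>ends G e. finite (comp_of G (t - {e}) v)} \<in> sets ?M"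
        by (intro sets_Collect_countable_Ex' comp) (auto intro: countable_finite)
    qed
  qed
  ultimately show ?thesis by simp
qed

end

section \<open>Averages over spanning trees\<close>

abbreviation wired_trees :: "('v, 'e) mgraph \<Rightarrow> 'v set \<Rightarrow> 'e set set" where
  "wired_trees G \<Lambda> \<equiv> spanning_trees (wired_graph G \<Lambda>)"

definition tree_average :: "('v, 'e) mgraph \<Rightarrow> ('e set \<Rightarrow> real) \<Rightarrow> 'v set \<Rightarrow> real" where
  "tree_average G f \<Lambda> = sum f (wired_trees G \<Lambda>) / card (wired_trees G \<Lambda>)"

lemma (in anchored) forest_iff: "t \<in> one_end_forests G \<longleftrightarrow> anchored_forest G D prec t"
  using one_end_forests_iff[OF mg lf] anchored_axioms by (simp add: anchored_forest_def)

context anchored begin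

lemma wired_trees_sub: "t \<in> wired_trees G \<Lambda> \<Longrightarrow> t \<subseteq> {e \<in> edges G. ends G e \<inter> \<Lambda> \<noteq> {}}"
  by (auto simp: spanning_trees_def wired_graph_def sink_graph_def)

lemma wired_trees_finite:
  assumes "finite \<Lambda>" "\<Lambda> \<subseteq> verts G" shows "finite (wired_trees G \<Lambda>)"
  by (rule finite_subset[of _ "Pow {e \<in> edges G. ends G e \<inter> \<Lambda> \<noteq> {}}"])
    (use wired_trees_sub finite_edges_touching[OF assms] in auto)

lemma UST_integral:
  assumes \<Lambda>: "finite \<Lambda>" "\<Lambda> \<subseteq> verts G" and f: "continuous_map (edge_topology G) euclideanreal f"
  shows "integral\<^sup>L (distr (UST (wired_graph G \<Lambda>)) (borel_of (edge_topology G)) (\<lambda>t. t)) f = tree_average G f \<Lambda>"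
proof -
  have "(\<lambda>t. t) \<in> measurable (UST (wired_graph G \<Lambda>)) (borel_of (edge_topology G))"
    using wired_trees_sub[of _ \<Lambda>]
    by (auto simp: measurable_def UST_def space_uniform_count_measure sets_uniform_count_measure)
  then have "integral\<^sup>L (distr (UST (wired_graph G \<Lambda>)) (borel_of (edge_topology G)) (\<lambda>t. t)) f =
      integral\<^sup>L (UST (wired_graph G \<Lambda>)) f"
    by (rule integral_distr[OF _ continuous_map_borel_measurable[OF f]])
  also have "\<dots> = tree_average G f \<Lambda>"
    unfolding UST_def tree_average_def by (rule integral_uniform_count_measure[OF wired_trees_finite[OF \<Lambda>]])
  finally show ?thesis .
qed

lemma WSF_limit:
  assumes W: "is_WSF G WSF" and f: "continuous_map (edge_topology G) euclideanreal f" "bounded (f ` Pow (edges G))"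
  shows "(tree_average G f \<longlongrightarrow> integral\<^sup>L WSF f) (finite_subsets_at_top (verts G))"
proof -
  have "((\<lambda>\<Lambda>. integral\<^sup>L (distr (UST (wired_graph G \<Lambda>)) (borel_of (edge_topology G)) (\<lambda>t. t)) f)
      \<longlongrightarrow> integral\<^sup>L WSF f) (finite_subsets_at_top (verts G))"
    using W f by (simp add: is_WSF_def weak_limit_def)
  moreover have "\<forall>\<^sub>F \<Lambda> in finite_subsets_at_top (verts G).
      integral\<^sup>L (distr (UST (wired_graph G \<Lambda>)) (borel_of (edge_topology G)) (\<lambda>t. t)) f = tree_average G f \<Lambda>"
    by (rule eventually_finite_subsets_at_top_weakI) (use UST_integral f in auto)
  ultimately show ?thesis by (rule Lim_transform_eventually)
qed

section \<open>Almost sure properties of the wired spanning forest\<close>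

text \<open>The indicator of a cylinder event is continuous, so its probability is the limit of the
  probabilities in the wired graphs.\<close>

lemma WSF_null:
  assumes W: "is_WSF G WSF" and K: "finite K" "K \<subseteq> edges G" and \<Lambda>0: "finite \<Lambda>0" "\<Lambda>0 \<subseteq> verts G"
    and none: "\<And>\<Lambda> t. finite \<Lambda> \<Longrightarrow> \<Lambda>0 \<subseteq> \<Lambda> \<Longrightarrow> \<Lambda> \<subseteq> verts G \<Longrightarrow> t \<in> wired_trees G \<Lambda> \<Longrightarrow> \<not> Q (t \<inter> K)"
  shows "AE t in WSF. \<not> Q (t \<inter> K)"
proof -
  interpret prob_space WSF using W by (simp add: is_WSF_def weak_limit_def)
  have sets: "sets WSF = sets (borel_of (edge_topology G))" using W by (simp add: is_WSF_def weak_limit_def)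
  then have space: "space WSF = Pow (edges G)" using sets_eq_imp_space_eq[OF sets] by simp
  let ?f = "\<lambda>t. of_bool (Q (t \<inter> K)) :: real"
  let ?A = "{t \<in> Pow (edges G). Q (t \<inter> K)}"
  have A: "?A \<in> sets WSF" using openin_sets_borel_of[OF openin_edge_cylinder[OF K]] sets by simp
  have "(tree_average G ?f \<longlongrightarrow> integral\<^sup>L WSF ?f) (finite_subsets_at_top (verts G))"
    using K by (intro WSF_limit[OF W] continuous_edge_cylinder[of K] bounded_edge_cylinder[of K]) auto
  moreover have "\<forall>\<^sub>F \<Lambda> in finite_subsets_at_top (verts G). tree_average G ?f \<Lambda> = 0"
    unfolding eventually_finite_subsets_at_top
    by (rule exI[of _ \<Lambda>0]) (use none \<Lambda>0 in \<open>auto simp: tree_average_def\<close>)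
  then have "(tree_average G ?f \<longlongrightarrow> 0) (finite_subsets_at_top (verts G))"
    by (rule tendsto_eventually)
  ultimately have "integral\<^sup>L WSF ?f = 0" using tendsto_unique finite_subsets_at_top_neq_bot by blast
  also have "integral\<^sup>L WSF ?f = integral\<^sup>L WSF (indicator ?A)"
    by (rule Bochner_Integration.integral_cong) (auto simp: space indicator_def)
  also have "\<dots> = measure WSF ?A" using A by simp
  finally have "emeasure WSF ?A = 0" by (simp add: emeasure_eq_measure)
  then show ?thesis by (rule AE_I[rotated]) (use A space in auto)
qed

text \<open>A cycle of \<open>G\<close> is a cycle of every wired graph that contains its vertices.\<close>

lemma WSF_acyclic:
  assumes W: "is_WSF G WSF"
  shows "AE t in WSF. \<forall>es\<in>cycle_edges. \<not> (\<forall>f\<in>set es. f \<in> t)"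
proof (rule AE_ball_countable'[OF _ cycle_edges_countable])
  fix es assume es: "es \<in> cycle_edges"
  then obtain vs where c: "is_cycle G vs es" and esE: "set es \<subseteq> edges G" by (auto simp: cycle_edges_def)
  have len: "length es = length vs" using c by (simp add: is_cycle_def)
  have vsV: "set vs \<subseteq> verts G"
  proof
    fix v assume "v \<in> set vs"
    then obtain i where i: "i < length vs" "v = vs ! i" by (auto simp: in_set_conv_nth)
    then have "es ! i \<in> edges G" "v \<in> ends G (es ! i)" using c esE len by (auto simp: is_cycle_def)
    then show "v \<in> verts G" using multigraphD(1)[OF mg] by blast
  qed
  have "AE t in WSF. \<not> (\<forall>f\<in>set es. f \<in> t \<inter> set es)"
  proof (rule WSF_null[OF W _ esE _ vsV])
    fix \<Lambda> t assume \<Lambda>: "set vs \<subseteq> \<Lambda>" and t: "t \<in> wired_trees G \<Lambda>"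
    show "\<not> (\<forall>f\<in>set es. f \<in> t \<inter> set es)"
    proof
      assume all: "\<forall>f\<in>set es. f \<in> t \<inter> set es"
      have "is_cycle (wired_graph G \<Lambda>) (map Some vs) es"
        unfolding is_cycle_def
      proof (intro conjI allI impI)
        show "distinct (map Some vs)" using c by (simp add: is_cycle_def distinct_map)
        fix i assume "i < length (map Some vs)"
        then have i: "i < length vs" "Suc i mod length vs < length vs"
          using mod_less_divisor[of "length vs" "Suc i"] by (simp, fastforce)
        have "ends G (es ! i) = {vs ! i, vs ! (Suc i mod length vs)}" using c i(1) by (simp add: is_cycle_def)
        moreover have "vs ! i \<in> \<Lambda>" "vs ! (Suc i mod length vs) \<in> \<Lambda>" using \<Lambda> i nth_mem by blast+
        ultimately show "ends (wired_graph G \<Lambda>) (es ! i) =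
            {map Some vs ! i, map Some vs ! (Suc i mod length (map Some vs))}"
          using i by (simp add: wired_graph_def sink_graph_def)
      qed (use c in \<open>auto simp: is_cycle_def\<close>)
      moreover have "acyclic_edges (wired_graph G \<Lambda>) t" using t by (simp add: spanning_trees_def)
      ultimately show False using all by (auto simp: acyclic_edges_def)
    qed
  qed auto
  then show "AE t in WSF. \<not> (\<forall>f\<in>set es. f \<in> t)" by simp
qed

text \<open>A spanning tree of a wired graph connects each finite set of vertices to the sink.\<close>

lemma WSF_infinite_comp:
  assumes W: "is_WSF G WSF"
  shows "AE t in WSF. \<forall>v\<in>verts G. infinite (comp_of G t v)"
proof (rule AE_ball_countable'[OF _ verts_countable])
  fix v assume v: "v \<in> verts G"
  let ?cross = "\<lambda>K. {f \<in> edges G. ends G f \<inter> K \<noteq> {} \<and> \<not> ends G f \<subseteq> K}"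
  have "AE t in WSF. \<forall>K\<in>{K. finite K \<and> K \<subseteq> verts G \<and> v \<in> K}. \<not> t \<inter> ?cross K = {}"
  proof (rule AE_ball_countable'[OF _ finite_sets_countable])
    fix K assume "K \<in> {K. finite K \<and> K \<subseteq> verts G \<and> v \<in> K}"
    then have K: "finite K" "K \<subseteq> verts G" "v \<in> K" by auto
    show "AE t in WSF. \<not> t \<inter> ?cross K = {}"
    proof (rule WSF_null[OF W _ _ K(1,2)])
      show "finite (?cross K)" by (rule finite_subset[OF _ finite_edges_touching[OF K(1,2)]]) auto
      fix \<Lambda> t assume \<Lambda>: "K \<subseteq> \<Lambda>" and t: "t \<in> wired_trees G \<Lambda>"
      show "\<not> t \<inter> ?cross K = {}"
      proof
        assume empty: "t \<inter> ?cross K = {}"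
        have "comp_of (wired_graph G \<Lambda>) t (Some v) \<subseteq> Some ` K"
        proof (rule comp_of_subset)
          fix x y assume "x \<in> Some ` K" and xy: "(x, y) \<in> adj_rel (wired_graph G \<Lambda>) t"
          then obtain u where u: "u \<in> K" "x = Some u" by blast
          obtain f where f: "f \<in> t" "(\<lambda>v. if v \<in> \<Lambda> then Some v else None) ` ends G f = {x, y}"
            using xy by (auto simp: adj_rel_def wired_graph_def sink_graph_def)
          have "Some u \<in> (\<lambda>v. if v \<in> \<Lambda> then Some v else None) ` ends G f" using f(2) u(2) by simp
          then have "u \<in> ends G f" by (auto split: if_splits)
          moreover have "f \<in> edges G" using wired_trees_sub[OF t] f(1) by blast
          ultimately have "ends G f \<subseteq> K" using empty f(1) u(1) by blast
          moreover have "y \<in> (\<lambda>v. if v \<in> \<Lambda> then Some v else None) ` ends G f" using f(2) by simp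
          ultimately show "y \<in> Some ` K" using \<Lambda> by auto
        qed (use K in blast)
        moreover have "None \<in> comp_of (wired_graph G \<Lambda>) t (Some v)"
          using t K(3) \<Lambda> by (auto simp: spanning_trees_def connected_by_def comp_of_def wired_graph_def sink_graph_def)
        ultimately show False by blast
      qed
    qed auto
  qed
  note crossing = this
  have space: "space WSF = Pow (edges G)"
    using W sets_eq_imp_space_eq[of WSF "borel_of (edge_topology G)"] by (simp add: is_WSF_def weak_limit_def)
  from crossing AE_space[of WSF] show "AE t in WSF. infinite (comp_of G t v)"
  proof eventually_elim
    case (elim t)
    have "t \<subseteq> edges G" using elim(2) space by simp
    show ?case
    proof
      assume "finite (comp_of G t v)"
      then obtain K where K: "K \<in> {K. finite K \<and> K \<subseteq> verts G \<and> v \<in> K}"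
        "\<forall>f\<in>t. ends G f \<inter> K = {} \<or> ends G f \<subseteq> K"
        using finite_comp_iff[OF mg \<open>t \<subseteq> edges G\<close> v] by auto
      then have "t \<inter> ?cross K = {}" by blast
      then show False using bspec[OF elim(1) K(1)] by simp
    qed
  qed
qed

end

locale wired_forest = anchored G D prec
  for G :: "('v, 'e) mgraph" and D prec +
  fixes WSF :: "'e set measure"
  assumes con: "connected_graph G" and inf: "infinite (verts G)" and W: "is_WSF G WSF"
    and ends: "AE t in WSF. \<forall>v\<in>verts G. one_ended G t (comp_of G t v)"
begin

sublocale P: prob_space WSF
  using W by (simp add: is_WSF_def weak_limit_def)

lemma sets_WSF: "sets WSF = sets (borel_of (edge_topology G))"
  using W by (simp add: is_WSF_def weak_limit_def)

lemma space_WSF: "space WSF = Pow (edges G)"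
  using sets_eq_imp_space_eq[OF sets_WSF] by simp

abbreviation "\<T> \<equiv> one_end_forests G"
abbreviation "\<psi> \<equiv> psi prec G D"

lemma forests_sets: "\<T> \<in> sets WSF"
  using one_end_forests_measurable sets_WSF by simp

lemma forests_AE: "AE t in WSF. t \<in> \<T>"
  using ends WSF_acyclic[OF W] WSF_infinite_comp[OF W] AE_space[of WSF]
proof eventually_elim
  case (elim t)
  then have "t \<subseteq> edges G" using space_WSF by simp
  with elim acyclic_iff[of t] show ?case by (auto simp: one_end_forests_def)
qed

lemma forests_prob: "measure WSF \<T> = 1"
  using P.AE_in_set_eq_1[OF forests_sets] forests_AE by simp

lemma degree_pos: "v \<in> verts G \<Longrightarrow> 0 < Defs.degree G v"
proof -
  assume v: "v \<in> verts G"
  obtain w where w: "w \<in> verts G" "w \<noteq> v" using inf by (metis finite.emptyI finite.insertI finite_subset insertCI subsetI)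
  have "(v, w) \<in> (adj_rel G (edges G))\<^sup>*" using con v w by (simp add: connected_graph_def connected_by_def)
  then obtain u where "(v, u) \<in> adj_rel G (edges G)" using w(2) by (auto elim: converse_rtranclE)
  then have "incident G v \<noteq> {}" by (auto simp: adj_rel_def incident_def)
  then show ?thesis using lf v by (auto simp: Defs.degree_def locally_finite_def card_gt_0_iff)
qed

section \<open>Continuity\<close>

text \<open>The cylinder \<open>C\<close> fixes the edges at the descendants of a set \<open>D k\<close> containing \<open>K\<close>; the
  number of phases on the wired graphs may be any number not below \<open>k\<close>.\<close>

lemma psi_locally_constant:
  assumes t0: "t0 \<in> \<T>" and K: "finite K" "K \<subseteq> verts G"
  obtains C k \<Lambda>0 where "finite C" "C \<subseteq> edges G" "finite \<Lambda>0" "\<Lambda>0 \<subseteq> verts G"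
    "\<And>t v. t \<in> \<T> \<Longrightarrow> t \<inter> C = t0 \<inter> C \<Longrightarrow> v \<in> K \<Longrightarrow> \<psi> t v = \<psi> t0 v"
    "\<And>m \<Lambda> t v. k \<le> m \<Longrightarrow> finite \<Lambda> \<Longrightarrow> \<Lambda>0 \<subseteq> \<Lambda> \<Longrightarrow> \<Lambda> \<subseteq> verts G \<Longrightarrow> t \<in> wired_trees G \<Lambda> \<Longrightarrow>
       t \<inter> C = t0 \<inter> C \<Longrightarrow> v \<in> K \<Longrightarrow>
       the_inv_into (recurrent (wired_graph G \<Lambda>)) (burn_tree prec (wired_graph G \<Lambda>) D m) t v = \<psi> t0 v \<and> v \<in> \<Lambda>"
proof -
  interpret T0: anchored_forest G D prec t0 using t0 forest_iff by simp
  obtain k where k: "1 \<le> k" "K \<subseteq> D k" using finite_subset_D[OF K] .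
  have KW: "K \<subseteq> T0.W k" using k(2) T0.D_W by blast
  define C where "C = {f \<in> edges G. ends G f \<inter> T0.W k \<noteq> {}}"
  have same: "f \<in> t0 \<longleftrightarrow> f \<in> t" if "t \<inter> C = t0 \<inter> C" "t \<subseteq> edges G" "ends G f \<inter> T0.W k \<noteq> {}" for t f
    using that T0.t_edges unfolding C_def by blast
  show ?thesis
  proof (rule that[of C "T0.W k" k])
    show "finite C" unfolding C_def by (rule finite_edges_touching[OF T0.W_finite T0.W_verts])
    show "C \<subseteq> edges G" by (auto simp: C_def)
    show "finite (T0.W k)" "T0.W k \<subseteq> verts G" by (rule T0.W_finite, rule T0.W_verts)
  next
    fix t v assume t: "t \<in> \<T>" "t \<inter> C = t0 \<inter> C" and v: "v \<in> K"
    have "t \<subseteq> edges G" using t(1) by (simp add: one_end_forests_def)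
    note s = same[OF t(2) this, unfolded T0.W_def]
    show "\<psi> t v = \<psi> t0 v"
      by (rule psi_local[OF T0.anchored_forest_axioms _ k(1)]) (use t(1) forest_iff s v KW T0.W_def in auto)
  next
    fix m \<Lambda> t v
    assume a: "k \<le> m" "finite \<Lambda>" "T0.W k \<subseteq> \<Lambda>" "\<Lambda> \<subseteq> verts G" "t \<in> wired_trees G \<Lambda>" "t \<inter> C = t0 \<inter> C" "v \<in> K"
    have "t \<subseteq> edges G" using wired_trees_sub[OF a(5)] by blast
    note s = same[OF a(6) this, unfolded T0.W_def]
    have "the_inv_into (recurrent (wired_graph G \<Lambda>)) (burn_tree prec (wired_graph G \<Lambda>) D m) t v = \<psi> t0 v"
      by (rule burn_tree_inverse_local[OF T0.anchored_forest_axioms k(1) a(1,2,4) _ a(5)])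
        (use s a(3,7) KW T0.W_def in auto)
    then show "the_inv_into (recurrent (wired_graph G \<Lambda>)) (burn_tree prec (wired_graph G \<Lambda>) D m) t v = \<psi> t0 v \<and> v \<in> \<Lambda>"
      using a(3,7) KW by blast
  qed
qed

lemma psi_topspace: "t \<in> \<T> \<Longrightarrow> \<psi> t \<in> topspace (sandpile_topology G)"
  using anchored_forest.psi_recurrent[of G D prec t] forest_iff
  by (auto simp: recurrent_inf_def topspace_sandpile_topology)

lemma psi_continuous:
  "continuous_map (subtopology (edge_topology G) \<T>) (subtopology (sandpile_topology G) (recurrent_inf G)) \<psi>"
  unfolding continuous_map_in_subtopology
proof (intro conjI)
  have top: "topspace (subtopology (edge_topology G) \<T>) = \<T>"
    by (auto simp: one_end_forests_def)
  show "\<psi> \<in> topspace (subtopology (edge_topology G) \<T>) \<rightarrow> recurrent_inf G"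
    unfolding top using anchored_forest.psi_recurrent forest_iff by blast
  show "continuous_map (subtopology (edge_topology G) \<T>) (sandpile_topology G) \<psi>"
    unfolding continuous_map_def top
  proof (intro conjI allI impI)
    show "\<psi> \<in> \<T> \<rightarrow> topspace (sandpile_topology G)" using psi_topspace by blast
    fix U assume U: "openin (sandpile_topology G) U"
    show "openin (subtopology (edge_topology G) \<T>) {t \<in> \<T>. \<psi> t \<in> U}"
    proof (subst openin_subopen, intro ballI)
      fix t0 assume "t0 \<in> {t \<in> \<T>. \<psi> t \<in> U}"
      then have t0: "t0 \<in> \<T>" "\<psi> t0 \<in> U" by auto
      obtain K where K: "finite K" "K \<subseteq> verts G"
        "{\<eta> \<in> topspace (sandpile_topology G). restrict \<eta> K = restrict (\<psi> t0) K} \<subseteq> U"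
        using sandpile_nbhd[OF U t0(2)] .
      obtain C k \<Lambda>0 where C: "finite C" "C \<subseteq> edges G"
        "\<And>t v. t \<in> \<T> \<Longrightarrow> t \<inter> C = t0 \<inter> C \<Longrightarrow> v \<in> K \<Longrightarrow> \<psi> t v = \<psi> t0 v"
        using psi_locally_constant[OF t0(1) K(1,2)] by metis
      let ?N = "{t \<in> Pow (edges G). t \<inter> C = t0 \<inter> C}"
      have "openin (edge_topology G) ?N" by (rule openin_edge_cylinder[OF C(1,2)])
      then have "openin (subtopology (edge_topology G) \<T>) (\<T> \<inter> ?N)"
        by (rule openin_subtopology_Int2)
      moreover have "t0 \<in> \<T> \<inter> ?N" using t0(1) by (auto simp: one_end_forests_def)
      moreover have "\<T> \<inter> ?N \<subseteq> {t \<in> \<T>. \<psi> t \<in> U}"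
      proof
        fix t assume t: "t \<in> \<T> \<inter> ?N"
        then have "restrict (\<psi> t) K = restrict (\<psi> t0) K" using C(3) by (intro restrict_ext) auto
        then show "t \<in> {t \<in> \<T>. \<psi> t \<in> U}" using K(3) psi_topspace[of t] t by auto
      qed
      ultimately show "\<exists>N. openin (subtopology (edge_topology G) \<T>) N \<and> t0 \<in> N \<and> N \<subseteq> {t \<in> \<T>. \<psi> t \<in> U}"
        by blast
    qed
  qed
qed

lemma psi_measurable:
  "\<psi> \<in> measurable (restrict_space WSF \<T>) (borel_of (sandpile_topology G))"
  unfolding borel_of_def
proof (rule measurable_measure_of)
  have space: "space (restrict_space WSF \<T>) = \<T>"
    using space_WSF by (auto simp: space_restrict_space one_end_forests_def)
  show "\<psi> \<in> space (restrict_space WSF \<T>) \<rightarrow> topspace (sandpile_topology G)"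
    unfolding space using psi_topspace by blast
  fix U assume "U \<in> {U. openin (sandpile_topology G) U}"
  moreover have "continuous_map (subtopology (edge_topology G) \<T>) (sandpile_topology G) \<psi>"
    using psi_continuous continuous_map_into_fulltopology by blast
  ultimately have "openin (subtopology (edge_topology G) \<T>) {t \<in> topspace (subtopology (edge_topology G) \<T>). \<psi> t \<in> U}"
    by (auto simp: continuous_map_def)
  then obtain S where S: "openin (edge_topology G) S" "{t \<in> topspace (subtopology (edge_topology G) \<T>). \<psi> t \<in> U} = S \<inter> \<T>"
    unfolding openin_subtopology by blast
  have "\<psi> -` U \<inter> \<T> = \<T> \<inter> S" using S(2) by (auto simp: one_end_forests_def)
  moreover have "S \<in> sets WSF" using S(1) sets_WSF openin_sets_borel_of by blast
  ultimately show "\<psi> -` U \<inter> space (restrict_space WSF \<T>) \<in> sets (restrict_space WSF \<T>)"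
    unfolding space sets_restrict_space by auto
qed (auto dest: openin_subset)

end

section \<open>Weak convergence of the sandpile measures\<close>

definition sandpile_average :: "('v, 'e) mgraph \<Rightarrow> (('v \<Rightarrow> nat) \<Rightarrow> real) \<Rightarrow> 'v set \<Rightarrow> real" where
  "sandpile_average G f \<Lambda> = (\<Sum>\<eta>\<in>recurrent (wired_graph G \<Lambda>). f (extend_conf G \<Lambda> \<eta>)) /
     card (recurrent (wired_graph G \<Lambda>))"

context wired_forest begin

abbreviation "wired_burn \<Lambda> m \<equiv> burn_tree prec (wired_graph G \<Lambda>) D m"
abbreviation "unburn \<Lambda> m \<equiv> the_inv_into (recurrent (wired_graph G \<Lambda>)) (wired_burn \<Lambda> m)"

lemma wired_burn_bij:
  assumes "finite \<Lambda>" "\<Lambda> \<subseteq> verts G"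
  shows "bij_betw (wired_burn \<Lambda> m) (recurrent (wired_graph G \<Lambda>)) (wired_trees G \<Lambda>)"
  using sink_burning.burn_tree_bij[OF sink_burning_wired[OF assms]] by (simp add: wired_graph_def)

lemma extend_conf_topspace:
  assumes \<Lambda>: "finite \<Lambda>" "\<Lambda> \<subseteq> verts G" and \<eta>: "\<eta> \<in> recurrent (wired_graph G \<Lambda>)"
  shows "extend_conf G \<Lambda> \<eta> \<in> topspace (sandpile_topology G)"
proof -
  interpret S: sink_burning G D prec \<Lambda> "{e \<in> edges G. ends G e \<inter> \<Lambda> \<noteq> {}}" 0
    by (rule sink_burning_wired[OF \<Lambda>])
  have "\<eta> x < Defs.degree G x" if x: "x \<in> \<Lambda>" for x
  proof -
    have "\<eta> x < Defs.degree S.H (Some x)"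
      using \<eta> x by (auto simp: recurrent_def wired_graph_def)
    also have "\<dots> \<le> Defs.degree G x"
      unfolding Defs.degree_def S.incident_H[OF x] by (rule card_mono) (use S.finite_incident[OF x] in auto)
    finally show ?thesis .
  qed
  then show ?thesis using degree_pos by (auto simp: topspace_sandpile_topology extend_conf_def)
qed

lemma sandpile_integral:
  assumes \<Lambda>: "finite \<Lambda>" "\<Lambda> \<subseteq> verts G" and f: "continuous_map (sandpile_topology G) euclideanreal f"
  shows "integral\<^sup>L (distr (sandpile_finite (wired_graph G \<Lambda>)) (borel_of (sandpile_topology G)) (extend_conf G \<Lambda>)) f =
    sandpile_average G f \<Lambda>"
proof -
  have fin: "finite (recurrent (wired_graph G \<Lambda>))"
    using bij_betw_finite[OF wired_burn_bij[OF \<Lambda>]] wired_trees_finite[OF \<Lambda>] by simp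
  have "extend_conf G \<Lambda> \<in> measurable (sandpile_finite (wired_graph G \<Lambda>)) (borel_of (sandpile_topology G))"
    using extend_conf_topspace[OF \<Lambda>]
    by (auto simp: measurable_def sandpile_finite_def space_uniform_count_measure sets_uniform_count_measure)
  then have "integral\<^sup>L (distr (sandpile_finite (wired_graph G \<Lambda>)) (borel_of (sandpile_topology G)) (extend_conf G \<Lambda>)) f =
      integral\<^sup>L (sandpile_finite (wired_graph G \<Lambda>)) (\<lambda>\<eta>. f (extend_conf G \<Lambda> \<eta>))"
    by (rule integral_distr[OF _ continuous_map_borel_measurable[OF f]])
  also have "\<dots> = sandpile_average G f \<Lambda>"
    unfolding sandpile_finite_def sandpile_average_def by (rule integral_uniform_count_measure[OF fin])
  finally show ?thesis .
qed

text \<open>The burning bijection turns sandpile averages into tree averages.\<close>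

lemma sandpile_average_trees:
  assumes \<Lambda>: "finite \<Lambda>" "\<Lambda> \<subseteq> verts G"
  shows "sandpile_average G f \<Lambda> = tree_average G (\<lambda>t. f (extend_conf G \<Lambda> (unburn \<Lambda> m t))) \<Lambda>"
proof -
  have b: "bij_betw (unburn \<Lambda> m) (wired_trees G \<Lambda>) (recurrent (wired_graph G \<Lambda>))"
    by (rule bij_betw_the_inv_into[OF wired_burn_bij[OF \<Lambda>]])
  show ?thesis
    unfolding sandpile_average_def tree_average_def
    using sum.reindex_bij_betw[OF b, of "\<lambda>\<eta>. f (extend_conf G \<Lambda> \<eta>)"] bij_betw_same_card[OF b] by simp
qed

text \<open>The average of the constant 1 is 0 where there are no spanning trees and 1 elsewhere; it converges
  to 1 because the limit is a probability measure.\<close>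

lemma wired_trees_nonempty: "\<forall>\<^sub>F \<Lambda> in finite_subsets_at_top (verts G). card (wired_trees G \<Lambda>) \<noteq> 0"
proof -
  have "(tree_average G (\<lambda>_. 1) \<longlongrightarrow> integral\<^sup>L WSF (\<lambda>_. 1)) (finite_subsets_at_top (verts G))"
    by (rule WSF_limit[OF W]) (auto intro: bounded_edge_cylinder[of "{}"])
  then have "(tree_average G (\<lambda>_. 1) \<longlongrightarrow> 1) (finite_subsets_at_top (verts G))"
    by (simp add: P.prob_space)
  then have "\<forall>\<^sub>F \<Lambda> in finite_subsets_at_top (verts G). 0 < tree_average G (\<lambda>_. 1) \<Lambda>"
    by (rule order_tendstoD) simp
  then show ?thesis by eventually_elim (auto simp: tree_average_def split: if_splits)
qed

definition sandpile_limit :: "('v \<Rightarrow> nat) measure" where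
  "sandpile_limit = distr (restrict_space WSF \<T>) (borel_of (sandpile_topology G)) \<psi>"

lemma sandpile_limit_prob: "prob_space sandpile_limit"
proof -
  have "prob_space (restrict_space WSF \<T>)"
    using forests_prob by (intro prob_space_restrict_space forests_sets) (simp add: P.emeasure_eq_measure)
  then show ?thesis
    unfolding sandpile_limit_def by (rule prob_space.prob_space_distr[OF _ psi_measurable])
qed

lemma sandpile_limit_integral:
  assumes f: "continuous_map (sandpile_topology G) euclideanreal f"
  shows "integral\<^sup>L sandpile_limit f = integral\<^sup>L WSF (\<lambda>t. indicator \<T> t * f (\<psi> t))"
proof -
  have "integral\<^sup>L sandpile_limit f = integral\<^sup>L (restrict_space WSF \<T>) (\<lambda>t. f (\<psi> t))"
    unfolding sandpile_limit_def
    by (rule integral_distr[OF psi_measurable continuous_map_borel_measurable[OF f]])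
  also have "\<dots> = integral\<^sup>L WSF (\<lambda>t. indicator \<T> t *\<^sub>R f (\<psi> t))"
    by (rule integral_restrict_space) (use forests_sets in \<open>simp add: sets.Int_space_eq2\<close>)
  finally show ?thesis by simp
qed

text \<open>
  Each forest has a cylinder neighbourhood on which \<open>f \<circ> \<psi>\<close> is nearly constant,
  and on which, for large \<open>\<Lambda>\<close>, the sandpiles of spanning trees of the wired graph give nearly
  the same value.  Countably many cylinders suffice, finitely many carry almost all mass, and on
  these \<open>f \<circ> \<psi>\<close> is bounded below by a cylinder function up to a small error.
\<close>

definition good_cylinder :: "(('v \<Rightarrow> nat) \<Rightarrow> real) \<Rightarrow> real \<Rightarrow> 'e set \<times> 'e set \<Rightarrow> real \<times> nat \<times> 'v set \<Rightarrow> bool" where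
  "good_cylinder f \<delta> = (\<lambda>(C, s) (c, k, \<Lambda>0). finite \<Lambda>0 \<and> \<Lambda>0 \<subseteq> verts G \<and>
     (\<forall>t\<in>\<T>. t \<inter> C = s \<longrightarrow> f (\<psi> t) \<le> c + \<delta>) \<and>
     (\<forall>m \<Lambda> t. k \<le> m \<longrightarrow> finite \<Lambda> \<longrightarrow> \<Lambda>0 \<subseteq> \<Lambda> \<longrightarrow> \<Lambda> \<subseteq> verts G \<longrightarrow> t \<in> wired_trees G \<Lambda> \<longrightarrow>
        t \<inter> C = s \<longrightarrow> c - \<delta> \<le> f (extend_conf G \<Lambda> (unburn \<Lambda> m t))))"

lemma good_cylinder_exists:
  assumes f: "continuous_map (sandpile_topology G) euclideanreal f" and \<delta>: "0 < \<delta>" and t0: "t0 \<in> \<T>"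
  shows "\<exists>C x. finite C \<and> C \<subseteq> edges G \<and> good_cylinder f \<delta> (C, t0 \<inter> C) x"
proof -
  let ?X = "topspace (sandpile_topology G)"
  let ?c = "f (\<psi> t0)"
  have "openin (sandpile_topology G) {\<eta> \<in> ?X. f \<eta> \<in> {?c - \<delta> <..< ?c + \<delta>}}"
    using f by (auto simp: continuous_map_def)
  moreover have "\<psi> t0 \<in> {\<eta> \<in> ?X. f \<eta> \<in> {?c - \<delta> <..< ?c + \<delta>}}"
    using psi_topspace[OF t0] \<delta> by simp
  ultimately obtain K where K: "finite K" "K \<subseteq> verts G"
    "{\<eta> \<in> ?X. restrict \<eta> K = restrict (\<psi> t0) K} \<subseteq> {\<eta> \<in> ?X. f \<eta> \<in> {?c - \<delta> <..< ?c + \<delta>}}"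
    by (rule sandpile_nbhd)
  have near: "f \<eta> \<le> ?c + \<delta>" "?c - \<delta> \<le> f \<eta>" if "\<eta> \<in> ?X" "\<And>v. v \<in> K \<Longrightarrow> \<eta> v = \<psi> t0 v" for \<eta>
  proof -
    have "restrict \<eta> K = restrict (\<psi> t0) K" using that(2) by (rule restrict_ext)
    then have "f \<eta> \<in> {?c - \<delta> <..< ?c + \<delta>}" using K(3) that(1) by blast
    then show "f \<eta> \<le> ?c + \<delta>" "?c - \<delta> \<le> f \<eta>" by auto
  qed
  show ?thesis
  proof (rule psi_locally_constant[OF t0 K(1,2)])
    fix C k \<Lambda>0
    assume C: "finite C" "C \<subseteq> edges G" and \<Lambda>0: "finite \<Lambda>0" "\<Lambda>0 \<subseteq> verts G"
      and 1: "\<And>t v. t \<in> \<T> \<Longrightarrow> t \<inter> C = t0 \<inter> C \<Longrightarrow> v \<in> K \<Longrightarrow> \<psi> t v = \<psi> t0 v"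
      and 2: "\<And>m \<Lambda> t v. k \<le> m \<Longrightarrow> finite \<Lambda> \<Longrightarrow> \<Lambda>0 \<subseteq> \<Lambda> \<Longrightarrow> \<Lambda> \<subseteq> verts G \<Longrightarrow> t \<in> wired_trees G \<Lambda> \<Longrightarrow>
        t \<inter> C = t0 \<inter> C \<Longrightarrow> v \<in> K \<Longrightarrow> unburn \<Lambda> m t v = \<psi> t0 v \<and> v \<in> \<Lambda>"
    have "f (\<psi> t) \<le> ?c + \<delta>" if "t \<in> \<T>" "t \<inter> C = t0 \<inter> C" for t
      by (rule near(1)[OF psi_topspace[OF that(1)] 1[OF that]])
    moreover have "?c - \<delta> \<le> f (extend_conf G \<Lambda> (unburn \<Lambda> m t))"
      if a: "k \<le> m" "finite \<Lambda>" "\<Lambda>0 \<subseteq> \<Lambda>" "\<Lambda> \<subseteq> verts G" "t \<in> wired_trees G \<Lambda>" "t \<inter> C = t0 \<inter> C" for m \<Lambda> t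
    proof (rule near(2))
      have b: "bij_betw (unburn \<Lambda> m) (wired_trees G \<Lambda>) (recurrent (wired_graph G \<Lambda>))"
        by (rule bij_betw_the_inv_into[OF wired_burn_bij[OF a(2,4)]])
      show "extend_conf G \<Lambda> (unburn \<Lambda> m t) \<in> ?X"
        by (rule extend_conf_topspace[OF a(2,4) bij_betwE[OF b, rule_format, OF a(5)]])
      fix v assume v: "v \<in> K"
      show "extend_conf G \<Lambda> (unburn \<Lambda> m t) v = \<psi> t0 v"
        using 2[OF a v] v K(2) by (auto simp: extend_conf_def)
    qed
    ultimately have "good_cylinder f \<delta> (C, t0 \<inter> C) (?c, k, \<Lambda>0)"
      using \<Lambda>0 unfolding good_cylinder_def by simp
    then show ?thesis using C by blast
  qed
qed

text \<open>Since \<open>f \<ge> 0\<close>, the cylinder function \<open>g n\<close> below \<open>f\<close> can be 0 where nothing is known about the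
  sandpile.\<close>

lemma sandpile_average_lower:
  assumes f: "continuous_map (sandpile_topology G) euclideanreal f"
    and bounds: "\<And>\<eta>. \<eta> \<in> topspace (sandpile_topology G) \<Longrightarrow> 0 \<le> f \<eta> \<and> f \<eta> \<le> B"
    and \<epsilon>: "0 < \<epsilon>"
  shows "\<forall>\<^sub>F \<Lambda> in finite_subsets_at_top (verts G). integral\<^sup>L sandpile_limit f - \<epsilon> \<le> sandpile_average G f \<Lambda>"
proof -
  define \<delta> where "\<delta> = \<epsilon> / 4"
  have \<delta>: "0 < \<delta>" using \<epsilon> by (simp add: \<delta>_def)
  define \<A> where "\<A> = {(C, s). finite C \<and> C \<subseteq> edges G \<and> s \<subseteq> C \<and> (\<exists>x. good_cylinder f \<delta> (C, s) x)}"
  have "countable ({C. finite C \<and> C \<subseteq> edges G} \<times> {C. finite C \<and> C \<subseteq> edges G})"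
    by (intro countable_SIGMA countable_Collect_finite_subset edges_countable)
  then have "countable \<A>"
    by (rule countable_subset[rotated]) (auto simp: \<A>_def intro: finite_subset)
  have cover: "\<exists>(C, s)\<in>\<A>. t \<inter> C = s" if "t \<in> \<T>" for t
    using good_cylinder_exists[OF f \<delta> that] unfolding \<A>_def by blast
  have "\<T> \<noteq> {}" using forests_prob by auto
  then have "\<A> \<noteq> {}" using cover by blast
  define A where "A = from_nat_into \<A>"
  have A: "A i \<in> \<A>" for i unfolding A_def by (rule from_nat_into[OF \<open>\<A> \<noteq> {}\<close>])
  define C s where "C i = fst (A i)" and "s i = snd (A i)" for i
  have C: "finite (C i)" "C i \<subseteq> edges G" for i using A[of i] by (auto simp: \<A>_def C_def)
  have "\<exists>x. good_cylinder f \<delta> (C i, s i) x" for i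
    using A[of i] by (cases "A i") (simp add: \<A>_def C_def s_def)
  then obtain x where x: "\<And>i. good_cylinder f \<delta> (C i, s i) (x i)" by metis
  define c k \<Lambda>0 where "c i = fst (x i)" and "k i = fst (snd (x i))" and "\<Lambda>0 i = snd (snd (x i))" for i
  have good: "good_cylinder f \<delta> (C i, s i) (c i, k i, \<Lambda>0 i)" for i
    using x by (simp add: c_def k_def \<Lambda>0_def)
  define Cyl where "Cyl n = {t \<in> Pow (edges G). \<exists>i\<le>n. t \<inter> C i = s i}" for n
  define CC where "CC n = (\<Union>i\<le>n. C i)" for n
  have CC: "finite (CC n)" "CC n \<subseteq> edges G" for n using C by (auto simp: CC_def)
  have loc: "t \<inter> CC n \<inter> C i = t \<inter> C i" if "i \<le> n" for t n i using that by (auto simp: CC_def)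
  define g where "g n t = Max ((\<lambda>i. if t \<inter> C i = s i then max 0 (c i - \<delta>) else 0) ` {..n})" for n t
  have g_local: "g n t = g n (t \<inter> CC n)" for n t
    unfolding g_def by (rule arg_cong[where f = Max], rule image_cong) (auto simp: loc)
  have g_ge: "(if t \<inter> C i = s i then max 0 (c i - \<delta>) else 0) \<le> g n t" if "i \<le> n" for i n t
    unfolding g_def using that by (intro Max_ge) auto
  have g_le: "g n t \<le> z" if z: "\<And>i. i \<le> n \<Longrightarrow> (if t \<inter> C i = s i then max 0 (c i - \<delta>) else 0) \<le> z" for n t z
    unfolding g_def
  proof (rule Max.boundedI)
    fix a assume "a \<in> (\<lambda>i. if t \<inter> C i = s i then max 0 (c i - \<delta>) else 0) ` {..n}"
    then obtain i where "i \<le> n" "a = (if t \<inter> C i = s i then max 0 (c i - \<delta>) else 0)" by blast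
    then show "a \<le> z" using z by simp
  qed auto
  have g_nonneg: "0 \<le> g n t" for n t using g_ge[of 0 n t] by (auto split: if_splits)
  have Cyl_sets: "Cyl n \<in> sets WSF" for n
  proof -
    have "Cyl n = {t \<in> Pow (edges G). (\<lambda>u. \<exists>i\<le>n. u \<inter> C i = s i) (t \<inter> CC n)}"
      unfolding Cyl_def by (simp add: loc cong: conj_cong)
    then show ?thesis using openin_sets_borel_of[OF openin_edge_cylinder[OF CC]] sets_WSF by simp
  qed
  have "(\<lambda>n. measure WSF (Cyl n)) \<longlonglongrightarrow> measure WSF (\<Union>n. Cyl n)"
  proof (rule P.finite_Lim_measure_incseq)
    show "range Cyl \<subseteq> sets WSF" using Cyl_sets by blast
    show "incseq Cyl" by (auto simp: incseq_def Cyl_def intro: le_trans)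
  qed
  moreover have "\<T> \<subseteq> (\<Union>n. Cyl n)"
  proof
    fix t assume t: "t \<in> \<T>"
    then obtain C' s' where "(C', s') \<in> \<A>" "t \<inter> C' = s'" using cover by blast
    moreover from this obtain i where "A i = (C', s')"
      unfolding A_def using from_nat_into_surj[OF \<open>countable \<A>\<close>] by metis
    ultimately have "t \<inter> C i = s i" by (simp add: C_def s_def)
    moreover have "t \<subseteq> edges G" using t by (simp add: one_end_forests_def)
    ultimately show "t \<in> (\<Union>n. Cyl n)" unfolding Cyl_def by blast
  qed
  then have "measure WSF \<T> \<le> measure WSF (\<Union>n. Cyl n)"
    using Cyl_sets by (intro P.finite_measure_mono) auto
  then have "measure WSF (\<Union>n. Cyl n) = 1" using forests_prob P.prob_le_1 by (simp add: antisym)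
  ultimately have "(\<lambda>n. \<bar>B\<bar> * (1 - measure WSF (Cyl n))) \<longlonglongrightarrow> \<bar>B\<bar> * (1 - 1)"
    by (intro tendsto_intros) simp
  then have "\<forall>\<^sub>F n in sequentially. \<bar>B\<bar> * (1 - measure WSF (Cyl n)) < \<delta>"
    using \<delta> by (intro order_tendstoD) auto
  then obtain n where n: "\<bar>B\<bar> * (1 - measure WSF (Cyl n)) < \<delta>"
    by (auto simp: eventually_sequentially)
  have g_cont: "continuous_map (edge_topology G) euclideanreal (g n)"
    by (rule continuous_edge_cylinder[OF CC]) (rule g_local)
  have g_bdd: "bounded (g n ` Pow (edges G))"
    by (rule bounded_edge_cylinder[OF CC(1)]) (rule g_local)
  have g_int: "integrable WSF (g n)"
  proof -
    obtain b where "\<And>t. t \<in> Pow (edges G) \<Longrightarrow> norm (g n t) \<le> b" using g_bdd by (auto simp: bounded_iff)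
    moreover have "g n \<in> borel_measurable WSF"
      using continuous_map_borel_measurable[OF g_cont] measurable_cong_sets[OF sets_WSF refl] by blast
    ultimately show ?thesis
      by (intro P.integrable_const_bound[where B = b] AE_I2) (auto simp: space_WSF)
  qed
  \<comment> \<open>On the chosen cylinders \<open>f \<circ> \<psi>\<close> exceeds \<open>g n\<close> by at most \<open>2\<delta>\<close>; elsewhere \<open>f\<close> is at most \<open>B\<close>.\<close>
  have pointwise: "indicator \<T> t * f (\<psi> t) \<le> g n t + 2 * \<delta> + \<bar>B\<bar> * indicator (space WSF - Cyl n) t"
    if t: "t \<in> space WSF" for t
  proof (cases "t \<in> \<T>")
    case False
    then show ?thesis using g_nonneg[of n t] \<delta> by (auto simp: indicator_def)
  next
    case True
    show ?thesis
    proof (cases "t \<in> Cyl n")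
      case in_cyl: True
      then obtain i where i: "i \<le> n" "t \<inter> C i = s i" by (auto simp: Cyl_def)
      have "f (\<psi> t) \<le> c i + \<delta>" using good[of i] True i(2) by (simp add: good_cylinder_def)
      moreover have "c i - \<delta> \<le> g n t" using g_ge[OF i(1), of t] i(2) by simp
      ultimately show ?thesis using True in_cyl by (simp add: indicator_def)
    next
      case False
      then show ?thesis using bounds[OF psi_topspace[OF True]] True t g_nonneg[of n t] \<delta> by (simp add: indicator_def)
    qed
  qed
  have "integral\<^sup>L sandpile_limit f = integral\<^sup>L WSF (\<lambda>t. indicator \<T> t * f (\<psi> t))"
    by (rule sandpile_limit_integral[OF f])
  also have "\<dots> \<le> integral\<^sup>L WSF (\<lambda>t. g n t + 2 * \<delta> + \<bar>B\<bar> * indicator (space WSF - Cyl n) t)"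
  proof (rule integral_mono_AE')
    show "integrable WSF (\<lambda>t. g n t + 2 * \<delta> + \<bar>B\<bar> * indicator (space WSF - Cyl n) t)"
      using g_int Cyl_sets
      by (intro Bochner_Integration.integrable_add integrable_mult_right integrable_real_indicator)
        (auto simp: P.emeasure_eq_measure)
    show "AE t in WSF. indicator \<T> t * f (\<psi> t) \<le> g n t + 2 * \<delta> + \<bar>B\<bar> * indicator (space WSF - Cyl n) t"
      using pointwise by (rule AE_I2)
    show "AE t in WSF. 0 \<le> g n t + 2 * \<delta> + \<bar>B\<bar> * indicator (space WSF - Cyl n) t"
      using g_nonneg[of n] \<delta> by (intro AE_I2 add_nonneg_nonneg) auto
  qed
  also have "\<dots> = integral\<^sup>L WSF (g n) + 2 * \<delta> + \<bar>B\<bar> * measure WSF (space WSF - Cyl n)"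
    using g_int Cyl_sets by (simp add: P.prob_space P.emeasure_eq_measure)
  also have "measure WSF (space WSF - Cyl n) = 1 - measure WSF (Cyl n)"
    by (rule P.prob_compl[OF Cyl_sets])
  finally have lower: "integral\<^sup>L sandpile_limit f \<le> integral\<^sup>L WSF (g n) + 3 * \<delta>" using n by simp
  have "(tree_average G (g n) \<longlongrightarrow> integral\<^sup>L WSF (g n)) (finite_subsets_at_top (verts G))"
    by (rule WSF_limit[OF W g_cont g_bdd])
  then have conv: "\<forall>\<^sub>F \<Lambda> in finite_subsets_at_top (verts G). integral\<^sup>L WSF (g n) - \<delta> < tree_average G (g n) \<Lambda>"
    by (rule order_tendstoD) (use \<delta> in simp)
  \<comment> \<open>One number of phases serves all chosen cylinders.\<close>
  define m where "m = Max (k ` {..n})"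
  have "\<forall>\<^sub>F \<Lambda> in finite_subsets_at_top (verts G). tree_average G (g n) \<Lambda> \<le> sandpile_average G f \<Lambda>"
    unfolding eventually_finite_subsets_at_top
  proof (intro exI conjI allI impI)
    have "finite (\<Lambda>0 i)" "\<Lambda>0 i \<subseteq> verts G" for i using good[of i] by (simp_all add: good_cylinder_def)
    then show "finite (\<Union>i\<le>n. \<Lambda>0 i)" "(\<Union>i\<le>n. \<Lambda>0 i) \<subseteq> verts G" by blast+
    fix \<Lambda> assume "finite \<Lambda> \<and> (\<Union>i\<le>n. \<Lambda>0 i) \<subseteq> \<Lambda> \<and> \<Lambda> \<subseteq> verts G"
    then have \<Lambda>: "finite \<Lambda>" "\<Lambda> \<subseteq> verts G" "\<And>i. i \<le> n \<Longrightarrow> \<Lambda>0 i \<subseteq> \<Lambda>" by auto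
    have b: "bij_betw (unburn \<Lambda> m) (wired_trees G \<Lambda>) (recurrent (wired_graph G \<Lambda>))"
      by (rule bij_betw_the_inv_into[OF wired_burn_bij[OF \<Lambda>(1,2)]])
    have "g n t \<le> f (extend_conf G \<Lambda> (unburn \<Lambda> m t))" if t: "t \<in> wired_trees G \<Lambda>" for t
    proof (rule g_le)
      fix i assume i: "i \<le> n"
      have "k i \<le> m" unfolding m_def using i by (intro Max_ge) auto
      then have "t \<inter> C i = s i \<Longrightarrow> c i - \<delta> \<le> f (extend_conf G \<Lambda> (unburn \<Lambda> m t))"
        using good[of i] \<Lambda>(1,2) \<Lambda>(3)[OF i] t by (simp add: good_cylinder_def)
      moreover have "0 \<le> f (extend_conf G \<Lambda> (unburn \<Lambda> m t))"
        using bounds[OF extend_conf_topspace[OF \<Lambda>(1,2) bij_betwE[OF b, rule_format, OF t]]] by simp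
      ultimately show "(if t \<inter> C i = s i then max 0 (c i - \<delta>) else 0) \<le> f (extend_conf G \<Lambda> (unburn \<Lambda> m t))"
        by simp
    qed
    then show "tree_average G (g n) \<Lambda> \<le> sandpile_average G f \<Lambda>"
      unfolding sandpile_average_trees[OF \<Lambda>(1,2), of f m] tree_average_def
      by (intro divide_right_mono sum_mono) auto
  qed
  with conv show ?thesis
    by eventually_elim (use lower in \<open>simp add: \<delta>_def\<close>)
qed

lemma sandpile_average_affine:
  assumes "finite \<Lambda>" "\<Lambda> \<subseteq> verts G" "card (wired_trees G \<Lambda>) \<noteq> 0"
  shows "sandpile_average G (\<lambda>\<eta>. a * f \<eta> + b) \<Lambda> = a * sandpile_average G f \<Lambda> + b"
proof -
  have "card (recurrent (wired_graph G \<Lambda>)) \<noteq> 0"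
    using assms(3) bij_betw_same_card[OF wired_burn_bij[OF assms(1,2)]] by simp
  then show ?thesis
    by (simp add: sandpile_average_def sum.distrib sum_distrib_left[symmetric] add_divide_distrib)
qed

lemma sandpile_limit_affine:
  fixes f :: "('v \<Rightarrow> nat) \<Rightarrow> real"
  assumes f: "continuous_map (sandpile_topology G) euclideanreal f"
    and bounds: "\<And>\<eta>. \<eta> \<in> topspace (sandpile_topology G) \<Longrightarrow> \<bar>f \<eta>\<bar> \<le> B"
  shows "integral\<^sup>L sandpile_limit (\<lambda>\<eta>. a * f \<eta> + b) = a * integral\<^sup>L sandpile_limit f + b"
proof -
  interpret N: prob_space sandpile_limit by (rule sandpile_limit_prob)
  have "f \<in> borel_measurable sandpile_limit"
    using continuous_map_borel_measurable[OF f] by (simp add: sandpile_limit_def)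
  then have "integrable sandpile_limit f"
    using bounds by (intro N.integrable_const_bound[where B = B] AE_I2) (auto simp: sandpile_limit_def)
  then show ?thesis by (simp add: N.prob_space)
qed

text \<open>The lower bound is applied to \<open>B + f\<close> and to \<open>B - f\<close>, where \<open>B\<close> bounds \<open>\<bar>f\<bar>\<close>.\<close>

theorem sandpile_weak_limit:
  "weak_limit (sandpile_topology G)
     (\<lambda>\<Lambda>. distr (sandpile_finite (wired_graph G \<Lambda>)) (borel_of (sandpile_topology G)) (extend_conf G \<Lambda>))
     (finite_subsets_at_top (verts G)) sandpile_limit"
  unfolding weak_limit_def
proof (intro conjI allI impI)
  show "prob_space sandpile_limit" by (rule sandpile_limit_prob)
  show "sets sandpile_limit = sets (borel_of (sandpile_topology G))" by (simp add: sandpile_limit_def)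
  fix f :: "('v \<Rightarrow> nat) \<Rightarrow> real"
  assume "continuous_map (sandpile_topology G) euclideanreal f \<and> bounded (f ` topspace (sandpile_topology G))"
  then obtain B where f: "continuous_map (sandpile_topology G) euclideanreal f"
    and B: "\<And>\<eta>. \<eta> \<in> topspace (sandpile_topology G) \<Longrightarrow> \<bar>f \<eta>\<bar> \<le> B"
    by (auto simp: bounded_iff)
  let ?F = "finite_subsets_at_top (verts G)"
  have fin: "\<forall>\<^sub>F \<Lambda> in ?F. finite \<Lambda> \<and> \<Lambda> \<subseteq> verts G"
    by (rule eventually_finite_subsets_at_top_weakI) auto
  have one_side: "\<forall>\<^sub>F \<Lambda> in ?F. a * integral\<^sup>L sandpile_limit f - \<epsilon> \<le> a * sandpile_average G f \<Lambda>"
    if a: "a = 1 \<or> a = -1" and \<epsilon>: "0 < \<epsilon>" for a \<epsilon> :: real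
  proof -
    have "continuous_map (sandpile_topology G) euclideanreal (\<lambda>\<eta>. a * f \<eta> + B)"
      by (intro continuous_intros f)
    moreover have "0 \<le> a * f \<eta> + B \<and> a * f \<eta> + B \<le> 2 * B" if "\<eta> \<in> topspace (sandpile_topology G)" for \<eta>
      using B[OF that] a by (auto simp: abs_le_iff)
    ultimately have "\<forall>\<^sub>F \<Lambda> in ?F. integral\<^sup>L sandpile_limit (\<lambda>\<eta>. a * f \<eta> + B) - \<epsilon> \<le>
        sandpile_average G (\<lambda>\<eta>. a * f \<eta> + B) \<Lambda>"
      using \<epsilon> by (rule sandpile_average_lower)
    then show ?thesis
      using fin wired_trees_nonempty
    proof eventually_elim
      case (elim \<Lambda>)
      then show ?case
        using sandpile_limit_affine[OF f B, of a B] sandpile_average_affine[of \<Lambda> a f B] by simp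
    qed
  qed
  have "(sandpile_average G f \<longlongrightarrow> integral\<^sup>L sandpile_limit f) ?F"
  proof (rule tendstoI)
    fix \<epsilon> :: real assume "0 < \<epsilon>"
    then have "0 < \<epsilon> / 2" by simp
    from one_side[OF disjI1[OF refl] this] one_side[OF disjI2[OF refl] this]
    show "\<forall>\<^sub>F \<Lambda> in ?F. dist (sandpile_average G f \<Lambda>) (integral\<^sup>L sandpile_limit f) < \<epsilon>"
      by eventually_elim (use \<open>0 < \<epsilon>\<close> in \<open>simp add: dist_real_def abs_if field_simps\<close>)
  qed
  moreover have "\<forall>\<^sub>F \<Lambda> in ?F. sandpile_average G f \<Lambda> =
      integral\<^sup>L (distr (sandpile_finite (wired_graph G \<Lambda>)) (borel_of (sandpile_topology G)) (extend_conf G \<Lambda>)) f"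
    using fin by eventually_elim (use sandpile_integral f in auto)
  ultimately show "((\<lambda>\<Lambda>. integral\<^sup>L (distr (sandpile_finite (wired_graph G \<Lambda>)) (borel_of (sandpile_topology G))
      (extend_conf G \<Lambda>)) f) \<longlongrightarrow> integral\<^sup>L sandpile_limit f) ?F"
    by (rule Lim_transform_eventually)
qed

lemma sandpile_measure_eq: "sandpile_measure G = sandpile_limit"
  unfolding sandpile_measure_def
proof (rule the_equality)
  fix N assume "weak_limit (sandpile_topology G)
     (\<lambda>\<Lambda>. distr (sandpile_finite (wired_graph G \<Lambda>)) (borel_of (sandpile_topology G)) (extend_conf G \<Lambda>))
     (finite_subsets_at_top (verts G)) N"
  then show "N = sandpile_limit"
    by (rule sandpile_weak_limit_unique[OF verts_countable finite_subsets_at_top_neq_bot _ sandpile_weak_limit])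
qed (rule sandpile_weak_limit)

end

theorem theorem1:
  fixes G :: "('v, 'e) mgraph"
    and WSF :: "'e set measure"
    and D :: "nat \<Rightarrow> 'v set"
    and prec :: "'v \<Rightarrow> 'e rel"
  assumes "multigraph G" and "locally_finite G" and "connected_graph G" and "infinite (verts G)"
    and "is_WSF G WSF"
    and "AE t in WSF. \<forall>v\<in>verts G. one_ended G t (comp_of G t v)"
    and "anchor G D"
    and "\<forall>v\<in>verts G. strict_linear_order_on (incident G v) (prec v)"
  shows "continuous_map (subtopology (edge_topology G) (one_end_forests G))
           (subtopology (sandpile_topology G) (recurrent_inf G)) (psi prec G D)
       \<and> inj_on (psi prec G D) (one_end_forests G)
       \<and> psi prec G D \<in> measurable (restrict_space WSF (one_end_forests G))
           (borel_of (sandpile_topology G))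
       \<and> distr (restrict_space WSF (one_end_forests G)) (borel_of (sandpile_topology G))
           (psi prec G D) = sandpile_measure G"
proof -
  interpret wired_forest G D prec WSF
    using assms by unfold_locales
  have "inj_on \<psi> \<T>"
    using psi_inj forest_iff by (blast intro: inj_onI)
  then show ?thesis
    using psi_continuous psi_measurable sandpile_measure_eq by (simp add: sandpile_limit_def)
qed

end
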